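(* Let $\Gamma\subset\mathrm{SO}(4)$ be a finite subgroup acting freely on $S^3$ and $M=\Gamma\backslash S^3$ with the induced metric (constant curvature $1$) and orientation. Define the Poincaré series $F_+(z)=\sum_{k\ge0}m(\operatorname{curl},2+k)z^k$ and $F_-(z)=\sum_{k\ge0}m(\operatorname{curl},-(2+k))z^k$, multiplicities taken for $\operatorname{curl}$ on $M$. Then for $|z|<1$ these series converge absolutely and $$F_+(z)=\frac{1}{1+z^2}\Big(1+\frac1{|\Gamma|}\sum_{\gamma\in\Gamma}\frac{\chi^+(\gamma)-1-z^2(\chi^-(\gamma)-1)}{\det(1-z\gamma)}\Big),$$ $$F_-(z)=\frac{1}{1+z^2}\Big(1+\frac1{|\Gamma|}\sum_{\gamma\in\Gamma}\frac{\chi^-(\gamma)-1-z^2(\chi^+(\gamma)-1)}{\det(1-z\gamma)}\Big),$$ where $\det(1-z\gamma)$ is the determinant of the $4\times4$ matrix $1-z\gamma$.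
   Context: $S^3\subset\mathbb R^4$ is the round unit sphere, oriented so that $(\mathbf n,e_1,e_2,e_3)$ is a positively oriented basis of $\mathbb R^4$ (standard orientation) whenever $(e_1,e_2,e_3)$ is positively oriented in $TS^3$, $\mathbf n$ the outward normal; $\mathrm{SO}(4)$ acts by matrix multiplication. On an oriented Riemannian 3-manifold $\operatorname{curl}=\ast d$ on complex-valued $1$-forms, and $m(\operatorname{curl},\lambda)$ is the dimension of its eigenspace for $\lambda$ (the nonzero eigenvalues on $M$ are among $\pm(2+k)$, $k\ge0$). $\Lambda^2\mathbb R^4=\Lambda^+\oplus\Lambda^-$ is the splitting into selfdual and antiselfdual $2$-forms, and $\chi^\pm:\mathrm{SO}(4)\to\mathbb R$ are the characters of the representations of $\mathrm{SO}(4)$ on $\Lambda^\pm$. *)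

theory Defs
  imports "HOL-Analysis.Analysis" "HOL-Library.Function_Algebras"
begin

definition S3 :: "(real^4) set" where
  "S3 = sphere 0 1"

definition lc :: "4 \<Rightarrow> 4 \<Rightarrow> 4 \<Rightarrow> 4 \<Rightarrow> real" where
  "lc i j k l = det (vector [axis i 1, axis j 1, axis k 1, axis l 1] :: real^4^4)"

definition cmat :: "real^4^4 \<Rightarrow> complex^4^4" where
  "cmat g = (\<chi> i j. complex_of_real (g $ i $ j))"

fun Ck :: "nat \<Rightarrow> (real^4 \<Rightarrow> 'b::real_normed_vector) \<Rightarrow> bool" where
  "Ck 0 f = continuous_on UNIV f"
| "Ck (Suc n) f = (f differentiable_on UNIV \<and> continuous_on UNIV f \<and>
      (\<forall>i. Ck n (\<lambda>p. frechet_derivative f (at p) (axis i 1))))"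

definition smooth :: "(real^4 \<Rightarrow> 'b::real_normed_vector) \<Rightarrow> bool" where
  "smooth f = (\<forall>n. Ck n f)"

text \<open>Complex 1-forms on S^3 are identified (via the round metric) with tangent
  vector fields X : S^3 -> C^4, X(p) . p = 0, given by a smooth extension Y to R^4.
  For such Y, curl Y = *dY at p in S^3 (orientation: (n,e1,e2,e3) positive),
  written with ambient coordinates: (curl Y)_a = sum_{b,c,d} eps_{b a c d} p_b d_c Y_d.
  Only derivatives tangent to S^3 contribute.\<close>
definition curl_S3 :: "(real^4 \<Rightarrow> complex^4) \<Rightarrow> real^4 \<Rightarrow> complex^4" where
  "curl_S3 Y p = (\<chi> a. \<Sum>b\<in>UNIV. \<Sum>c\<in>UNIV. \<Sum>d\<in>UNIV.
      complex_of_real (lc b a c d * p $ b) * (frechet_derivative Y (at p) (axis c 1)) $ d)"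

text \<open>The lambda-eigenspace of curl on M = G\S^3: the G-invariant complex 1-forms on S^3
  (functions vanishing off S^3, so that they are determined by their values on S^3).\<close>
definition curl_eigenspace :: "(real^4^4) set \<Rightarrow> real \<Rightarrow> (real^4 \<Rightarrow> complex^4) set" where
  "curl_eigenspace G lam = {X.
      (\<forall>p. p \<notin> S3 \<longrightarrow> X p = 0) \<and>
      (\<exists>Y. smooth Y \<and> (\<forall>p\<in>S3. X p = Y p \<and>
            (\<Sum>i\<in>UNIV. X p $ i * complex_of_real (p $ i)) = 0 \<and>
            curl_S3 Y p = complex_of_real lam *s Y p)) \<and>
      (\<forall>g\<in>G. \<forall>p\<in>S3. X (g *v p) = cmat g *v X p)}"

definition curl_mult :: "(real^4^4) set \<Rightarrow> real \<Rightarrow> nat" where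
  "curl_mult G lam = vector_space.dim (\<lambda>(c::complex) (X::real^4 \<Rightarrow> complex^4). \<lambda>p. c *s X p)
                      (curl_eigenspace G lam)"

text \<open>Characters of SO(4) on Lambda^2 R^4 = Lambda^+ + Lambda^-: with the Hodge star,
  chi^{+/-}(g) = (tr(Lambda^2 g) +/- tr(Lambda^2 g o * ))/2, where
  tr(Lambda^2 g) = sum_{i<j} (g_ii g_jj - g_ij g_ji) and
  tr(Lambda^2 g o * ) = (1/2) sum_{i,j,k,l} eps_{ijkl} g_ik g_jl.\<close>
definition tr_L2 :: "real^4^4 \<Rightarrow> real" where
  "tr_L2 g = (\<Sum>i\<in>UNIV. \<Sum>j\<in>UNIV. if i < j then g$i$i * g$j$j - g$i$j * g$j$i else 0)"

definition tr_L2_star :: "real^4^4 \<Rightarrow> real" where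
  "tr_L2_star g = (1/2) * (\<Sum>i\<in>UNIV. \<Sum>j\<in>UNIV. \<Sum>k\<in>UNIV. \<Sum>l\<in>UNIV.
                     lc i j k l * g$i$k * g$j$l)"

definition chi_plus :: "real^4^4 \<Rightarrow> real" where
  "chi_plus g = (tr_L2 g + tr_L2_star g) / 2"

definition chi_minus :: "real^4^4 \<Rightarrow> real" where
  "chi_minus g = (tr_L2 g - tr_L2_star g) / 2"

end

theory Submission imports Defs begin

text \<open>The vector fields p \<mapsto> J p, for J in one of the two triples of anticommuting complex structures of
  R^4 (sign s = 1 or s = -1), trivialise the tangent bundle of S^3, and for g in SO(4) the conjugation
  by g acts on the triple through \<Lambda>^+ or \<Lambda>^-. Forms on the quotient thus become functions u from S^3 to C^3
  that are equivariant under this 3-dimensional representation. On these, curl satisfies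
  curl^2 - 2 s curl = (scalar Laplacian) modulo gradients, so the eigenspace of the scalar Laplacian
  for n (n + 2) splits into the eigenspaces of curl for s (n + 2) and - s n and the gradients of
  invariant functions. Its dimension is given by Molien's formula, because every eigenfunction on
  S^3 is a polynomial. Both signs of s together give two linear relations between F_+ and F_-.\<close>

section \<open>Smooth functions\<close>

text \<open>Neither frame alone determines a multiplicity: at level n the frame of sign s sees only
  the sum of those of s(n+2) and -sn. Write P, Q, T for the Molien series of the representations
  with characters \<open>chi_plus\<close>, \<open>chi_minus\<close> and 1. The restriction to S^3 of
  a homogeneous polynomial of degree n splits uniquely into a Laplace eigenfunction and one of
  degree n-2, so the eigenspaces have the series (1-z^2)P, (1-z^2)Q, (1-z^2)T. The two frames then
  say F_+ + z^2 F_- = 1 + (1-z^2)(P-T) and F_- + z^2 F_+ = 1 + (1-z^2)(Q-T). Eliminating one unknown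
  produces 1-z^4, and cancelling 1-z^2 leaves the factor 1/(1+z^2). Two low levels need care. At n =
  0 the invariant constants have zero gradient, which accounts for the summand 1. At n = 1 the
  partner eigenvalue -s lies outside both series; in the frame of sign -s it would force the
  eigenvalue -1 of the nonnegative Laplacian, so it does not occur.\<close>

lemma differentiable_onD: "F differentiable_on UNIV \<Longrightarrow> F differentiable (at p)"
  by (simp add: differentiable_on_def)

lemma Ck_Suc_imp: "Ck (Suc n) F \<Longrightarrow> Ck n F"
proof (induction n arbitrary: F)
  case (Suc n)
  then show ?case by (metis Ck.simps(2))
qed simp

lemma Ck_bounded_linear:
  fixes F :: "real^4 \<Rightarrow> 'b::real_normed_vector" and L :: "'b \<Rightarrow> 'c::real_normed_vector"
  assumes "bounded_linear L"
  shows "Ck n F \<Longrightarrow> Ck n (\<lambda>p. L (F p))"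
proof (induction n arbitrary: F)
  case 0
  then show ?case
    using assms by (simp add: bounded_linear.continuous_on)
next
  case (Suc n)
  have hd: "((\<lambda>p. L (F p)) has_derivative (\<lambda>v. L (frechet_derivative F (at p) v))) (at p)" for p
    using Suc.prems
    by (intro bounded_linear.has_derivative[OF assms]) (simp add: differentiable_onD frechet_derivative_works[symmetric])
  have fd: "frechet_derivative (\<lambda>p. L (F p)) (at p) = (\<lambda>v. L (frechet_derivative F (at p) v))" for p
    using frechet_derivative_at[OF hd] by simp
  show ?case
    using Suc assms hd
    by (auto simp: fd bounded_linear.continuous_on differentiable_on_def differentiable_def)
qed

lemma Ck_add:
  fixes F H :: "real^4 \<Rightarrow> 'b::real_normed_vector"
  shows "Ck n F \<Longrightarrow> Ck n H \<Longrightarrow> Ck n (\<lambda>p. F p + H p)"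
proof (induction n arbitrary: F H)
  case 0
  then show ?case by (simp add: continuous_on_add)
next
  case (Suc n)
  have hd: "((\<lambda>p. F p + H p) has_derivative
      (\<lambda>v. frechet_derivative F (at p) v + frechet_derivative H (at p) v)) (at p)" for p
    using Suc.prems
    by (intro has_derivative_add) (simp_all add: differentiable_onD frechet_derivative_works[symmetric])
  have fd: "frechet_derivative (\<lambda>p. F p + H p) (at p)
      = (\<lambda>v. frechet_derivative F (at p) v + frechet_derivative H (at p) v)" for p
    using frechet_derivative_at[OF hd] by simp
  show ?case
    using Suc hd
    by (auto simp: fd continuous_on_add differentiable_on_def differentiable_def)
qed

lemma Ck_mult:
  fixes F H :: "real^4 \<Rightarrow> 'b::real_normed_algebra"
  shows "Ck n F \<Longrightarrow> Ck n H \<Longrightarrow> Ck n (\<lambda>p. F p * H p)"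
proof (induction n arbitrary: F H)
  case 0
  then show ?case by (simp add: continuous_on_mult)
next
  case (Suc n)
  have hd: "((\<lambda>p. F p * H p) has_derivative
      (\<lambda>v. F p * frechet_derivative H (at p) v + frechet_derivative F (at p) v * H p)) (at p)" for p
    using Suc.prems
    by (intro has_derivative_mult) (simp_all add: differentiable_onD frechet_derivative_works[symmetric])
  have fd: "frechet_derivative (\<lambda>p. F p * H p) (at p)
      = (\<lambda>v. F p * frechet_derivative H (at p) v + frechet_derivative F (at p) v * H p)" for p
    using frechet_derivative_at[OF hd] by simp
  \<comment> \<open>The product rule leaves one factor undifferentiated, so its order is lowered to
    fit the induction hypothesis.\<close>
  have "Ck n F" "Ck n H" using Suc.prems Ck_Suc_imp by blast+
  then have "Ck n (\<lambda>p. F p * frechet_derivative H (at p) (axis i 1) + frechet_derivative F (at p) (axis i 1) * H p)" for i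
    using Suc.prems by (intro Ck_add Suc.IH) auto
  then show ?case
    using Suc.prems hd
    by (auto simp: fd continuous_on_mult differentiable_on_def differentiable_def)
qed

lemma Ck_const: "Ck n (\<lambda>p. c)"
  by (induction n arbitrary: c) (auto simp: differentiable_on_const)

lemma Ck_linear:
  assumes "bounded_linear L"
  shows "Ck n L"
proof (cases n)
  case 0
  then show ?thesis using assms by (simp add: linear_continuous_on)
next
  case (Suc m)
  have "frechet_derivative L (at p) = L" for p
    using frechet_derivative_at[OF bounded_linear_imp_has_derivative[OF assms]] by metis
  then show ?thesis
    using assms by (simp add: Suc Ck_const bounded_linear_imp_differentiable_on linear_continuous_on)
qed

lemma smooth_bounded_linear: "bounded_linear L \<Longrightarrow> smooth F \<Longrightarrow> smooth (\<lambda>p. L (F p))"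
  by (simp add: smooth_def Ck_bounded_linear)
lemma smooth_add: "smooth F \<Longrightarrow> smooth H \<Longrightarrow> smooth (\<lambda>p. F p + H p)"
  by (simp add: smooth_def Ck_add)
lemma smooth_mult:
  fixes F H :: "real^4 \<Rightarrow> 'b::real_normed_algebra"
  shows "smooth F \<Longrightarrow> smooth H \<Longrightarrow> smooth (\<lambda>p. F p * H p)"
  by (simp add: smooth_def Ck_mult)
lemma smooth_const: "smooth (\<lambda>p. c)"
  by (simp add: smooth_def Ck_const)
lemma smooth_linear: "bounded_linear L \<Longrightarrow> smooth L"
  by (simp add: smooth_def Ck_linear)

lemma smooth_sum:
  "finite I \<Longrightarrow> (\<And>i. i \<in> I \<Longrightarrow> smooth (F i)) \<Longrightarrow> smooth (\<lambda>p. \<Sum>i\<in>I. F i p)"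
  by (induction I rule: finite_induct) (auto simp: smooth_const smooth_add)

section \<open>Partial derivatives and their symmetry\<close>

abbreviation pd :: "4 \<Rightarrow> (real^4 \<Rightarrow> 'b::real_normed_vector) \<Rightarrow> real^4 \<Rightarrow> 'b" where
  "pd i F \<equiv> (\<lambda>p. frechet_derivative F (at p) (axis i 1))"

lemma smooth_pd: "smooth F \<Longrightarrow> smooth (pd i F)"
  unfolding smooth_def by (metis Ck.simps(2))

lemma smooth_has_derivative:
  "smooth F \<Longrightarrow> (F has_derivative frechet_derivative F (at p)) (at p)"
  unfolding smooth_def
  by (metis Ck.simps(2) differentiable_onD frechet_derivative_works)

lemma smooth_continuous: "smooth F \<Longrightarrow> continuous_on UNIV F"
  unfolding smooth_def by (metis Ck.simps(1))

lemma frechet_derivative_pd: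
  assumes "smooth F"
  shows "frechet_derivative F (at p) v = (\<Sum>i\<in>UNIV. (v $ i) *\<^sub>R pd i F p)"
proof -
  interpret bounded_linear "frechet_derivative F (at p)"
    using smooth_has_derivative[OF assms] by (rule has_derivative_bounded_linear)
  have "v = (\<Sum>i\<in>UNIV. (v $ i) *\<^sub>R axis i 1)"
    by (simp add: vec_eq_iff axis_def if_distrib sum.delta cong: if_cong)
  then have "frechet_derivative F (at p) v = frechet_derivative F (at p) (\<Sum>i\<in>UNIV. (v $ i) *\<^sub>R axis i 1)"
    by simp
  also have "\<dots> = (\<Sum>i\<in>UNIV. (v $ i) *\<^sub>R pd i F p)" by (simp add: sum scaleR)
  finally show ?thesis .
qed

text \<open>The mean value theorem is applied once in each coordinate direction. The left-hand side
  is symmetric in i and j while the right-hand side is not, which is the source of the symmetry of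
  second derivatives.\<close>

lemma second_difference_mvt:
  fixes F :: "real^4 \<Rightarrow> real"
  assumes F: "smooth F" and "h > 0"
  obtains s t where "0 < s" "s < h" "0 < t" "t < h"
    "F (p + h *\<^sub>R axis i 1 + h *\<^sub>R axis j 1) - F (p + h *\<^sub>R axis i 1) - F (p + h *\<^sub>R axis j 1) + F p
      = h * h * pd j (pd i F) (p + s *\<^sub>R axis i 1 + t *\<^sub>R axis j 1)"
proof -
  \<comment> \<open>The second difference is the increment over [0, h] in direction i of this first
    difference in direction j.\<close>
  define \<phi> where "\<phi> = (\<lambda>s. F (p + s *\<^sub>R axis i 1 + h *\<^sub>R axis j 1) - F (p + s *\<^sub>R axis i 1))"
  have d: "((\<lambda>s. F (q + s *\<^sub>R axis i 1)) has_real_derivative pd i F (q + s *\<^sub>R axis i 1)) (at s)"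
    if "smooth F" for F :: "real^4 \<Rightarrow> real" and q s i
  proof -
    have "((\<lambda>s. F (q + s *\<^sub>R axis i 1)) has_derivative
       (\<lambda>x. frechet_derivative F (at (q + s *\<^sub>R axis i 1)) (0 + x *\<^sub>R axis i 1))) (at s)"
      by (rule has_derivative_compose[where f = "\<lambda>s. q + s *\<^sub>R axis i 1", OF _ smooth_has_derivative[OF that]])
        (auto intro!: derivative_eq_intros)
    moreover have "frechet_derivative F (at r) (x *\<^sub>R v) = x * frechet_derivative F (at r) v" for r x v
      using linear_simps(5)[OF has_derivative_bounded_linear[OF smooth_has_derivative[OF that]]]
      by simp
    ultimately have "((\<lambda>s. F (q + s *\<^sub>R axis i 1)) has_derivative (\<lambda>x. x * pd i F (q + s *\<^sub>R axis i 1))) (at s)"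
      by simp
    then show ?thesis
      unfolding has_field_derivative_def by (rule has_derivative_eq_rhs) (simp add: fun_eq_iff)
  qed
  have "(\<phi> has_real_derivative pd i F (p + s *\<^sub>R axis i 1 + h *\<^sub>R axis j 1) - pd i F (p + s *\<^sub>R axis i 1)) (at s)" for s
    unfolding \<phi>_def using d[OF F, of "p + h *\<^sub>R axis j 1" i s] d[OF F, of p i s]
    by (auto intro!: DERIV_diff simp: algebra_simps)
  note d\<phi> = this
  have "\<exists>s. 0 < s \<and> s < h \<and> \<phi> h - \<phi> 0
      = (h - 0) * (pd i F (p + s *\<^sub>R axis i 1 + h *\<^sub>R axis j 1) - pd i F (p + s *\<^sub>R axis i 1))"
    by (rule MVT2[OF \<open>h > 0\<close> d\<phi>])
  then obtain s where s: "0 < s" "s < h"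
    "\<phi> h - \<phi> 0 = h * (pd i F (p + s *\<^sub>R axis i 1 + h *\<^sub>R axis j 1) - pd i F (p + s *\<^sub>R axis i 1))"
    by auto
  have "\<exists>t. 0 < t \<and> t < h \<and> pd i F (p + s *\<^sub>R axis i 1 + h *\<^sub>R axis j 1) - pd i F (p + s *\<^sub>R axis i 1 + 0 *\<^sub>R axis j 1)
      = (h - 0) * pd j (pd i F) (p + s *\<^sub>R axis i 1 + t *\<^sub>R axis j 1)"
    using d[OF smooth_pd[OF F, of i], of "p + s *\<^sub>R axis i 1" j]
    by (intro MVT2[OF \<open>h > 0\<close>, of "\<lambda>t. pd i F (p + s *\<^sub>R axis i 1 + t *\<^sub>R axis j 1)"]) auto
  then obtain t where t: "0 < t" "t < h" "pd i F (p + s *\<^sub>R axis i 1 + h *\<^sub>R axis j 1) - pd i F (p + s *\<^sub>R axis i 1)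
      = h * pd j (pd i F) (p + s *\<^sub>R axis i 1 + t *\<^sub>R axis j 1)"
    by auto
  show ?thesis
    by (rule that[OF s(1,2) t(1,2)]) (use s(3) t(3) in \<open>simp add: \<phi>_def algebra_simps\<close>)
qed

text \<open>Schwarz's theorem: the quotient \<open>\<Delta> i j\<close> converges to
  \<open>pd j (pd i F) p\<close> by continuity of the second derivatives, and it is symmetric in i
  and j.\<close>

lemma pd_commute_real:
  fixes F :: "real^4 \<Rightarrow> real"
  assumes F: "smooth F"
  shows "pd i (pd j F) p = pd j (pd i F) p"
proof (rule LIMSEQ_unique)
  define h where "h = (\<lambda>n. inverse (real (Suc n)))"
  have h: "h n > 0" for n by (simp add: h_def)
  define \<Delta> where "\<Delta> = (\<lambda>i j n. (F (p + h n *\<^sub>R axis i 1 + h n *\<^sub>R axis j 1)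
    - F (p + h n *\<^sub>R axis i 1) - F (p + h n *\<^sub>R axis j 1) + F p) / (h n * h n))"
  have lim: "\<Delta> i j \<longlonglongrightarrow> pd j (pd i F) p" for i j
  proof -
    have "\<exists>s t. 0 < s \<and> s < h n \<and> 0 < t \<and> t < h n \<and>
       \<Delta> i j n = pd j (pd i F) (p + s *\<^sub>R axis i 1 + t *\<^sub>R axis j 1)" for n
    proof -
      obtain s t where *: "0 < s" "s < h n" "0 < t" "t < h n"
        "F (p + h n *\<^sub>R axis i 1 + h n *\<^sub>R axis j 1) - F (p + h n *\<^sub>R axis i 1) - F (p + h n *\<^sub>R axis j 1) + F p
          = h n * h n * pd j (pd i F) (p + s *\<^sub>R axis i 1 + t *\<^sub>R axis j 1)"
        by (rule second_difference_mvt[OF F h[of n], of p i j])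
      have "\<Delta> i j n = pd j (pd i F) (p + s *\<^sub>R axis i 1 + t *\<^sub>R axis j 1)"
        unfolding \<Delta>_def *(5) using h[of n] by (subst nonzero_mult_div_cancel_left) auto
      with *(1-4) show ?thesis by blast
    qed
    then obtain s t where st: "0 < s n" "s n < h n" "0 < t n" "t n < h n"
       "\<Delta> i j n = pd j (pd i F) (p + s n *\<^sub>R axis i 1 + t n *\<^sub>R axis j 1)" for n
      by metis
    have h0: "h \<longlonglongrightarrow> 0" unfolding h_def by (rule LIMSEQ_inverse_real_of_nat)
    have null: "r \<longlonglongrightarrow> 0" if "\<And>n. 0 < r n" "\<And>n. r n < h n" for r
    proof (rule real_tendsto_sandwich[where f = "\<lambda>_. 0" and h = h])
      show "\<forall>\<^sub>F n in sequentially. 0 \<le> r n"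
        using that(1) by (auto intro!: always_eventually simp: less_imp_le)
      show "\<forall>\<^sub>F n in sequentially. r n \<le> h n"
        using that(2) by (auto intro!: always_eventually simp: less_imp_le)
    qed (use h0 in auto)
    have "s \<longlonglongrightarrow> 0" by (rule null[OF st(1,2)])
    moreover have "t \<longlonglongrightarrow> 0" by (rule null[OF st(3,4)])
    ultimately have "(\<lambda>n. p + s n *\<^sub>R axis i 1 + t n *\<^sub>R axis j 1) \<longlonglongrightarrow> p + 0 *\<^sub>R axis i 1 + 0 *\<^sub>R axis j 1"
      by (intro tendsto_intros)
    then have "(\<lambda>n. pd j (pd i F) (p + s n *\<^sub>R axis i 1 + t n *\<^sub>R axis j 1)) \<longlonglongrightarrow> pd j (pd i F) p"
      using isCont_tendsto_compose[of p "pd j (pd i F)"] smooth_continuous[OF smooth_pd[OF smooth_pd[OF F]], of i j]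
      unfolding continuous_on_eq_continuous_at[OF open_UNIV] by force
    moreover have "\<Delta> i j = (\<lambda>n. pd j (pd i F) (p + s n *\<^sub>R axis i 1 + t n *\<^sub>R axis j 1))"
      using st(5) by (rule ext)
    ultimately show ?thesis by (simp only:)
  qed
  show "\<Delta> i j \<longlonglongrightarrow> pd j (pd i F) p" by (rule lim)
  have sw: "p + h n *\<^sub>R axis i 1 + h n *\<^sub>R axis j 1 = p + h n *\<^sub>R axis j 1 + h n *\<^sub>R axis i 1" for n
    by (simp only: ac_simps)
  have "\<Delta> i j = \<Delta> j i" unfolding \<Delta>_def sw by (intro ext) (simp add: diff_right_commute)
  then show "\<Delta> i j \<longlonglongrightarrow> pd i (pd j F) p" using lim[of j i] by simp
qed

lemma pd_bounded_linear:
  assumes "bounded_linear L" "smooth F"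
  shows "pd i (\<lambda>p. L (F p)) = (\<lambda>p. L (pd i F p))"
  using frechet_derivative_at[OF bounded_linear.has_derivative[OF assms(1) smooth_has_derivative[OF assms(2)]]]
  by metis

lemma pd_commute:
  fixes F :: "real^4 \<Rightarrow> complex"
  assumes F: "smooth F"
  shows "pd i (pd j F) p = pd j (pd i F) p"
proof (rule complex_eqI)
  have *: "L (pd i (pd j F) p) = pd i (pd j (\<lambda>p. L (F p))) p"
    if "bounded_linear L" for L :: "complex \<Rightarrow> real" and i j
  proof -
    have "pd i (pd j (\<lambda>p. L (F p))) p = pd i (\<lambda>p. L (pd j F p)) p"
      by (rule arg_cong[where f = "\<lambda>H. pd i H p", OF pd_bounded_linear[OF that F]])
    also have "\<dots> = L (pd i (pd j F) p)"
      by (rule fun_cong[OF pd_bounded_linear[OF that smooth_pd[OF F]]])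
    finally show ?thesis by simp
  qed
  show "Re (pd i (pd j F) p) = Re (pd j (pd i F) p)"
    unfolding *[OF bounded_linear_Re] by (rule pd_commute_real[OF smooth_bounded_linear[OF bounded_linear_Re F]])
  show "Im (pd i (pd j F) p) = Im (pd j (pd i F) p)"
    unfolding *[OF bounded_linear_Im] by (rule pd_commute_real[OF smooth_bounded_linear[OF bounded_linear_Im F]])
qed

section \<open>Frame fields on the sphere\<close>

text \<open>The matrices of left (s = 1) and right (s = -1) quaternion multiplication by i, j, k, up to sign.\<close>
definition JM :: "real \<Rightarrow> 3 \<Rightarrow> real^4^4" where
  "JM s a = (if a = 1 then vector [vector [0,1,0,0], vector [-1,0,0,0], vector [0,0,0,s], vector [0,0,-s,0]]
    else if a = 2 then vector [vector [0,0,1,0], vector [0,0,0,-s], vector [-1,0,0,0], vector [0,s,0,0]]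
    else vector [vector [0,0,0,1], vector [0,0,s,0], vector [0,-s,0,0], vector [-1,0,0,0]])"

lemma vector_4 [simp]:
  "(vector [a,b,c,d] :: 'a::zero^4) $ 1 = a"
  "(vector [a,b,c,d] :: 'a::zero^4) $ 2 = b"
  "(vector [a,b,c,d] :: 'a::zero^4) $ 3 = c"
  "(vector [a,b,c,d] :: 'a::zero^4) $ 4 = d"
  unfolding vector_def by auto

lemma JM_entries [simp]:
  "JM s 1 $ 1 $ 1 = 0" "JM s 1 $ 1 $ 2 = 1" "JM s 1 $ 1 $ 3 = 0" "JM s 1 $ 1 $ 4 = 0"
  "JM s 1 $ 2 $ 1 = -1" "JM s 1 $ 2 $ 2 = 0" "JM s 1 $ 2 $ 3 = 0" "JM s 1 $ 2 $ 4 = 0"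
  "JM s 1 $ 3 $ 1 = 0" "JM s 1 $ 3 $ 2 = 0" "JM s 1 $ 3 $ 3 = 0" "JM s 1 $ 3 $ 4 = s"
  "JM s 1 $ 4 $ 1 = 0" "JM s 1 $ 4 $ 2 = 0" "JM s 1 $ 4 $ 3 = -s" "JM s 1 $ 4 $ 4 = 0"
  "JM s 2 $ 1 $ 1 = 0" "JM s 2 $ 1 $ 2 = 0" "JM s 2 $ 1 $ 3 = 1" "JM s 2 $ 1 $ 4 = 0"
  "JM s 2 $ 2 $ 1 = 0" "JM s 2 $ 2 $ 2 = 0" "JM s 2 $ 2 $ 3 = 0" "JM s 2 $ 2 $ 4 = -s"
  "JM s 2 $ 3 $ 1 = -1" "JM s 2 $ 3 $ 2 = 0" "JM s 2 $ 3 $ 3 = 0" "JM s 2 $ 3 $ 4 = 0"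
  "JM s 2 $ 4 $ 1 = 0" "JM s 2 $ 4 $ 2 = s" "JM s 2 $ 4 $ 3 = 0" "JM s 2 $ 4 $ 4 = 0"
  "JM s 3 $ 1 $ 1 = 0" "JM s 3 $ 1 $ 2 = 0" "JM s 3 $ 1 $ 3 = 0" "JM s 3 $ 1 $ 4 = 1"
  "JM s 3 $ 2 $ 1 = 0" "JM s 3 $ 2 $ 2 = 0" "JM s 3 $ 2 $ 3 = s" "JM s 3 $ 2 $ 4 = 0"
  "JM s 3 $ 3 $ 1 = 0" "JM s 3 $ 3 $ 2 = -s" "JM s 3 $ 3 $ 3 = 0" "JM s 3 $ 3 $ 4 = 0"
  "JM s 3 $ 4 $ 1 = -1" "JM s 3 $ 4 $ 2 = 0" "JM s 3 $ 4 $ 3 = 0" "JM s 3 $ 4 $ 4 = 0"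
  by (simp_all add: JM_def)

lemma JM_mv [simp]:
  "(JM s 1 *v p) $ 1 = p $ 2" "(JM s 1 *v p) $ 2 = - p $ 1"
  "(JM s 1 *v p) $ 3 = s * p $ 4" "(JM s 1 *v p) $ 4 = - (s * p $ 3)"
  "(JM s 2 *v p) $ 1 = p $ 3" "(JM s 2 *v p) $ 2 = - (s * p $ 4)"
  "(JM s 2 *v p) $ 3 = - p $ 1" "(JM s 2 *v p) $ 4 = s * p $ 2"
  "(JM s 3 *v p) $ 1 = p $ 4" "(JM s 3 *v p) $ 2 = s * p $ 3"
  "(JM s 3 *v p) $ 3 = - (s * p $ 2)" "(JM s 3 *v p) $ 4 = - p $ 1"
  by (simp_all add: matrix_vector_mult_def sum_4)

lemma S3_iff: "p \<in> S3 \<longleftrightarrow> p$1 * p$1 + p$2 * p$2 + p$3 * p$3 + p$4 * p$4 = 1"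
proof -
  have "p \<in> S3 \<longleftrightarrow> p \<bullet> p = 1" unfolding S3_def
    by (simp add: norm_eq_1)
  then show ?thesis by (simp add: inner_vec_def sum_4)
qed

text \<open>Functions on S^3 are represented by their extension by 0 to R^4, hence are determined by their values on S^3.\<close>
definition rS :: "(real^4 \<Rightarrow> complex) \<Rightarrow> real^4 \<Rightarrow> complex" where
  "rS F = (\<lambda>p. if p \<in> S3 then F p else 0)"

definition SF :: "(real^4 \<Rightarrow> complex) set" where
  "SF = {f. \<exists>F. smooth F \<and> f = rS F}"

definition K :: "complex \<Rightarrow> real^4 \<Rightarrow> complex" where "K c = (\<lambda>p. c)"

lemma K_apply [simp]: "K c p = c" by (simp add: K_def)
lemma K_hom: "K 0 = 0" "K 1 = 1" "K (a + b) = K a + K b" "K (a - b) = K a - K b"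
  "K (a * b) = K a * K b" "K (- a) = - K a" "K (numeral n) = numeral n"
  by (simp_all add: fun_eq_iff)

lemma SF_rS: "smooth F \<Longrightarrow> rS F \<in> SF" by (auto simp: SF_def)

lemma SF_outside: "f \<in> SF \<Longrightarrow> p \<notin> S3 \<Longrightarrow> f p = 0" by (auto simp: SF_def rS_def)

lemma SF_K_mult: assumes "f \<in> SF" shows "K c * f \<in> SF"
proof -
  obtain F where F: "smooth F" "f = rS F" using assms by (auto simp: SF_def)
  then have "K c * f = rS (\<lambda>p. c * F p)" by (auto simp: fun_eq_iff rS_def)
  then show ?thesis using F by (auto intro!: SF_rS smooth_mult smooth_const)
qed

lemma SF_add: assumes "f \<in> SF" "g \<in> SF" shows "f + g \<in> SF"
proof -
  obtain F H where F: "smooth F" "f = rS F" "smooth H" "g = rS H" using assms by (auto simp: SF_def)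
  then have "f + g = rS (\<lambda>p. F p + H p)" by (auto simp: fun_eq_iff rS_def)
  then show ?thesis using F by (auto intro!: SF_rS smooth_add)
qed

lemma SF_mult: assumes "f \<in> SF" "g \<in> SF" shows "f * g \<in> SF"
proof -
  obtain F H where F: "smooth F" "f = rS F" "smooth H" "g = rS H" using assms by (auto simp: SF_def)
  then have "f * g = rS (\<lambda>p. F p * H p)" by (auto simp: fun_eq_iff rS_def)
  then show ?thesis using F by (auto intro!: SF_rS smooth_mult)
qed

lemma SF_zero: "0 \<in> SF"
proof -
  have "(0::real^4 \<Rightarrow> complex) = rS (\<lambda>p. 0)" by (auto simp: fun_eq_iff rS_def)
  then show ?thesis using SF_rS[OF smooth_const] by metis
qed

lemma SF_minus: assumes "f \<in> SF" shows "- f \<in> SF"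
proof -
  have "- f = K (-1) * f" by (simp add: fun_eq_iff)
  then show ?thesis using SF_K_mult[OF assms] by simp
qed

lemma SF_diff: "f \<in> SF \<Longrightarrow> g \<in> SF \<Longrightarrow> f - g \<in> SF"
  using SF_add[of f "- g"] SF_minus by simp

lemma SF_sum: "(\<And>i. i \<in> I \<Longrightarrow> f i \<in> SF) \<Longrightarrow> sum f I \<in> SF"
  by (induction I rule: infinite_finite_induct) (auto intro: SF_zero SF_add)

lemma SF_cnj: assumes "f \<in> SF" shows "(\<lambda>p. cnj (f p)) \<in> SF"
proof -
  obtain F where F: "smooth F" "f = rS F" using assms by (auto simp: SF_def)
  then have "(\<lambda>p. cnj (f p)) = rS (\<lambda>p. cnj (F p))" by (auto simp: fun_eq_iff rS_def)
  then show ?thesis using SF_rS[OF smooth_bounded_linear[OF bounded_linear_cnj F(1)]] by simp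
qed

lemma SF_bounded:
  assumes "f \<in> SF" obtains B where "\<And>p. norm (f p) \<le> B"
proof -
  obtain F where F: "smooth F" "f = rS F" using assms by (auto simp: SF_def)
  have "compact (F ` S3)" unfolding S3_def
    by (intro compact_continuous_image continuous_on_subset[OF smooth_continuous[OF F(1)]]) auto
  then have "bounded (F ` S3)" by (rule compact_imp_bounded)
  then obtain B where "\<forall>x\<in>F ` S3. norm x \<le> B" unfolding bounded_iff by (elim exE)
  then have "norm (f p) \<le> max B 0" for p by (auto simp: F rS_def intro: max.coboundedI1)
  then show ?thesis using that by blast
qed

lemma SF_continuous_on: "f \<in> SF \<Longrightarrow> continuous_on S3 f"
proof -
  assume "f \<in> SF"
  then obtain F where F: "smooth F" "f = rS F" by (auto simp: SF_def)
  then have "continuous_on S3 F" using smooth_continuous continuous_on_subset by blast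
  then show ?thesis by (rule continuous_on_eq) (simp add: F rS_def)
qed

section \<open>Derivatives along the flows of the frame\<close>

locale frame =
  fixes s :: real
  assumes ss: "s * s = 1"
begin

lemma s_s_mult [simp]: "s * (s * x) = x"
  using ss by (metis mult.assoc mult_1)

text \<open>The one-parameter group exp(t J) of J = \<open>JM s a\<close>, in closed form because
  J^2 = -1. It consists of rotations.\<close>

definition rot :: "3 \<Rightarrow> real \<Rightarrow> real^4 \<Rightarrow> real^4" where
  "rot a t p = cos t *\<^sub>R p + sin t *\<^sub>R (JM s a *v p)"

text \<open>The derivative is taken along a flow that preserves S^3, so it depends only on values on
  the sphere and makes sense for the extension by 0, which may jump at S^3. \<open>DJ\<close> is its
  counterpart for smooth functions on R^4.\<close>

definition d :: "3 \<Rightarrow> (real^4 \<Rightarrow> complex) \<Rightarrow> real^4 \<Rightarrow> complex" where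
  "d a f = (\<lambda>p. vector_derivative (\<lambda>t. f (rot a t p)) (at 0))"

definition DJ :: "3 \<Rightarrow> (real^4 \<Rightarrow> complex) \<Rightarrow> real^4 \<Rightarrow> complex" where
  "DJ a F = (\<lambda>p. frechet_derivative F (at p) (JM s a *v p))"

lemma JM_sq: "JM s a *v (JM s a *v p) = - p"
  using exhaust_3[of a] by (auto simp: vec_eq_iff forall_4 ss)

text \<open>The structure constants of so(3), scaled by 2 s. The products stand in reverse order
  because the bracket of the vector fields p \<mapsto> J p is minus the commutator of the
  matrices.\<close>

lemma JM_commutators:
  "JM s 2 *v (JM s 1 *v p) - JM s 1 *v (JM s 2 *v p) = (2 * s) *\<^sub>R (JM s 3 *v p)"
  "JM s 3 *v (JM s 2 *v p) - JM s 2 *v (JM s 3 *v p) = (2 * s) *\<^sub>R (JM s 1 *v p)"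
  "JM s 1 *v (JM s 3 *v p) - JM s 3 *v (JM s 1 *v p) = (2 * s) *\<^sub>R (JM s 2 *v p)"
  by (auto simp: vec_eq_iff forall_4 ss)

lemma rot_0 [simp]: "rot a 0 p = p" by (simp add: rot_def)

lemma JM_rot: "JM s a *v rot a t p = cos t *\<^sub>R (JM s a *v p) - sin t *\<^sub>R p"
  by (simp add: rot_def matrix_vector_right_distrib matrix_vector_mult_scaleR JM_sq)

lemma rot_S3 [simp]: "rot a t p \<in> S3 \<longleftrightarrow> p \<in> S3"
proof -
  have "p \<bullet> (JM s a *v p) = 0" "(JM s a *v p) \<bullet> (JM s a *v p) = p \<bullet> p"
    using exhaust_3[of a] ss by (auto simp: inner_vec_def sum_4 algebra_simps)
  then have "rot a t p \<bullet> rot a t p = (cos t * cos t + sin t * sin t) * (p \<bullet> p)"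
    by (simp add: rot_def inner_add_left inner_add_right inner_commute ring_distribs del: sin_cos_squared_add3)
  also have "\<dots> = p \<bullet> p"
    using sin_cos_squared_add3[of t] by simp
  finally show ?thesis by (simp add: S3_def norm_eq_1)
qed

lemma rot_derivative:
  "((\<lambda>t. rot a t p) has_vector_derivative (JM s a *v rot a t p)) (at t)"
  unfolding JM_rot unfolding rot_def
  by (auto intro!: derivative_eq_intros simp: has_vector_derivative_def scaleR_diff_right)

lemma rot_chain:
  assumes "(F has_derivative F') (at (rot a t p))"
  shows "((\<lambda>t. F (rot a t p)) has_vector_derivative F' (JM s a *v rot a t p)) (at t)"
  using vector_derivative_diff_chain_within[OF rot_derivative[of a p t], of F F'] assms
  by (simp add: o_def has_derivative_at_withinI)

lemma d_rS: assumes "smooth F" shows "d a (rS F) = rS (DJ a F)"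
proof
  fix p
  show "d a (rS F) p = rS (DJ a F) p"
  proof (cases "p \<in> S3")
    case True
    have "((\<lambda>t. F (rot a t p)) has_vector_derivative DJ a F p) (at 0)"
      using rot_chain[OF smooth_has_derivative[OF assms], of a p 0] by (simp add: DJ_def)
    then show ?thesis using True by (simp add: d_def rS_def vector_derivative_at)
  next
    case False
    then show ?thesis by (simp add: d_def rS_def)
  qed
qed

lemma DJ_pd: "smooth F \<Longrightarrow> DJ a F p = (\<Sum>i\<in>UNIV. of_real ((JM s a *v p) $ i) * pd i F p)"
  by (simp add: DJ_def frechet_derivative_pd[of F] scaleR_conv_of_real)

lemma bounded_linear_JM_nth: "bounded_linear (\<lambda>p. (JM s a *v p) $ i)"
  by (intro bounded_linear_compose[OF bounded_linear_vec_nth] matrix_vector_mul_bounded_linear)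

lemma smooth_DJ: assumes "smooth F" shows "smooth (DJ a F)"
proof -
  have "DJ a F = (\<lambda>p. \<Sum>i\<in>UNIV. of_real ((JM s a *v p) $ i) * pd i F p)"
    by (rule ext, rule DJ_pd[OF assms])
  moreover have "smooth \<dots>"

    by (intro smooth_sum finite smooth_mult smooth_pd assms smooth_linear[OF
          bounded_linear_compose[OF bounded_linear_of_real bounded_linear_JM_nth]])
  ultimately show ?thesis by (simp only:)
qed

lemma d_SF: "f \<in> SF \<Longrightarrow> d a f \<in> SF"
  by (auto simp: SF_def d_rS intro: smooth_DJ)

lemma d_has_vector_derivative:
  assumes "f \<in> SF"
  shows "((\<lambda>t. f (rot a t p)) has_vector_derivative d a f (rot a t p)) (at t)"
proof -
  obtain F where F: "smooth F" "f = rS F" using assms by (auto simp: SF_def)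
  show ?thesis
  proof (cases "p \<in> S3")
    case True
    then show ?thesis
      using rot_chain[OF smooth_has_derivative[OF F(1)], of a p t] d_rS[OF F(1), of a]
      by (simp add: F(2) rS_def DJ_def)
  next
    case False
    then show ?thesis using d_rS[OF F(1), of a] by (simp add: F(2) rS_def)
  qed
qed

lemma d_eqI:
  assumes "f \<in> SF" "\<And>p. ((\<lambda>t. f (rot a t p)) has_vector_derivative f' p) (at 0)"
  shows "d a f = f'"
  using assms(2) by (auto simp: d_def fun_eq_iff vector_derivative_at)

lemma d_has_vector_derivative_0:
  "f \<in> SF \<Longrightarrow> ((\<lambda>t. f (rot a t p)) has_vector_derivative d a f p) (at 0)"
  using d_has_vector_derivative[of f a p 0] by simp

lemma d_add: "f \<in> SF \<Longrightarrow> g \<in> SF \<Longrightarrow> d a (f + g) = d a f + d a g"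
  by (rule d_eqI) (auto intro!: SF_add has_vector_derivative_add d_has_vector_derivative_0)

lemma d_mult: "f \<in> SF \<Longrightarrow> g \<in> SF \<Longrightarrow> d a (f * g) = f * d a g + d a f * g"
  using has_vector_derivative_mult[OF d_has_vector_derivative_0[of f a] d_has_vector_derivative_0[of g a]]
  by (intro d_eqI) (auto intro!: SF_mult)

lemma d_K_mult: "f \<in> SF \<Longrightarrow> d a (K c * f) = K c * d a f"
  by (rule d_eqI) (auto intro!: SF_K_mult has_vector_derivative_mult_right d_has_vector_derivative_0)

lemma d_minus: "f \<in> SF \<Longrightarrow> d a (- f) = - d a f"
  using d_K_mult[of f a "-1"] by (simp add: K_hom)

lemma d_diff: "f \<in> SF \<Longrightarrow> g \<in> SF \<Longrightarrow> d a (f - g) = d a f - d a g"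
  using d_add[of f "- g" a] by (simp add: d_minus SF_minus)

lemma d_zero: "d a 0 = 0"
  using d_K_mult[OF SF_zero, of a 0] by (simp add: K_hom)

lemma d_cnj: "f \<in> SF \<Longrightarrow> d a (\<lambda>p. cnj (f p)) = (\<lambda>p. cnj (d a f p))"
  by (intro d_eqI SF_cnj bounded_linear.has_vector_derivative[OF bounded_linear_cnj] d_has_vector_derivative_0)

lemma DJ_DJ:
  assumes F: "smooth F"
  shows "DJ a (DJ b F) p = (\<Sum>j\<in>UNIV. \<Sum>i\<in>UNIV. of_real ((JM s b *v p) $ j) * of_real ((JM s a *v p) $ i) * pd i (pd j F) p)
     + frechet_derivative F (at p) (JM s b *v (JM s a *v p))"
proof -
  have eq: "DJ b F = (\<lambda>p. \<Sum>j\<in>UNIV. of_real ((JM s b *v p) $ j) * pd j F p)"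
    by (rule ext, rule DJ_pd[OF F])
  have lin: "((\<lambda>p. complex_of_real ((JM s b *v p) $ j)) has_derivative (\<lambda>v. of_real ((JM s b *v v) $ j))) (at p)" for j
    by (rule bounded_linear_imp_has_derivative bounded_linear_compose[OF bounded_linear_of_real bounded_linear_JM_nth])+
  have "(DJ b F has_derivative (\<lambda>v. \<Sum>j\<in>UNIV. of_real ((JM s b *v p) $ j) * frechet_derivative (pd j F) (at p) v
      + of_real ((JM s b *v v) $ j) * pd j F p)) (at p)"
    unfolding eq
    by (intro has_derivative_sum has_derivative_mult lin smooth_has_derivative[OF smooth_pd[OF F]])
  from frechet_derivative_at[OF this, symmetric]
  have "DJ a (DJ b F) p = (\<Sum>j\<in>UNIV. of_real ((JM s b *v p) $ j) * frechet_derivative (pd j F) (at p) (JM s a *v p)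
      + of_real ((JM s b *v (JM s a *v p)) $ j) * pd j F p)"
    by (simp add: DJ_def[of a "DJ b F"])
  then show ?thesis
    by (simp add: sum.distrib frechet_derivative_pd[OF F, of p "JM s b *v _"] scaleR_conv_of_real
        frechet_derivative_pd[OF smooth_pd[OF F], of _ _ "JM s a *v _"] sum_distrib_left mult.assoc)
qed

text \<open>In \<open>DJ_DJ\<close> the second-order part is symmetric in a and b by equality of
  mixed derivatives, so only the derivative of F along the commutator of the linear coefficient
  fields survives.\<close>

lemma DJ_commutator:
  assumes F: "smooth F"
    and c: "JM s b *v (JM s a *v p) - JM s a *v (JM s b *v p) = (2 * s) *\<^sub>R (JM s c *v p)"
  shows "DJ a (DJ b F) p = DJ b (DJ a F) p + of_real (2 * s) * DJ c F p"
proof -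
  have l: "linear (frechet_derivative F (at p))"
    using has_derivative_linear[OF smooth_has_derivative[OF F]] .
  have "(\<Sum>j\<in>UNIV. \<Sum>i\<in>UNIV. of_real ((JM s b *v p) $ j) * of_real ((JM s a *v p) $ i) * pd i (pd j F) p)
     = (\<Sum>i\<in>UNIV. \<Sum>j\<in>UNIV. of_real ((JM s a *v p) $ i) * of_real ((JM s b *v p) $ j) * pd j (pd i F) p)"
    by (subst sum.swap) (intro sum.cong refl, simp add: pd_commute[OF F] mult_ac)
  moreover have "frechet_derivative F (at p) (JM s b *v (JM s a *v p)) - frechet_derivative F (at p) (JM s a *v (JM s b *v p))
     = of_real (2 * s) * DJ c F p"
    unfolding linear_diff[OF l, symmetric] c linear_cmul[OF l] DJ_def by (simp add: scaleR_conv_of_real)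
  ultimately show ?thesis by (simp add: DJ_DJ[OF F] algebra_simps)
qed

lemma d_commutators:
  assumes "f \<in> SF"
  shows "d 1 (d 2 f) = d 2 (d 1 f) + K (of_real (2 * s)) * d 3 f"
    "d 2 (d 3 f) = d 3 (d 2 f) + K (of_real (2 * s)) * d 1 f"
    "d 3 (d 1 f) = d 1 (d 3 f) + K (of_real (2 * s)) * d 2 f"
proof -
  obtain F where F: "smooth F" "f = rS F" using assms by (auto simp: SF_def)
  show "d 1 (d 2 f) = d 2 (d 1 f) + K (of_real (2 * s)) * d 3 f"
    "d 2 (d 3 f) = d 3 (d 2 f) + K (of_real (2 * s)) * d 1 f"
    "d 3 (d 1 f) = d 1 (d 3 f) + K (of_real (2 * s)) * d 2 f"
    unfolding F(2) d_rS[OF F(1)] d_rS[OF smooth_DJ[OF F(1)]]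
    by (auto simp: fun_eq_iff rS_def DJ_commutator[OF F(1) JM_commutators(1)]
       DJ_commutator[OF F(1) JM_commutators(2)] DJ_commutator[OF F(1) JM_commutators(3)])
qed

end

section \<open>The action of SO(4) on the frame\<close>

lemma det_4:
  "det (A::'a::comm_ring_1^4^4) =
      A$1$1 * (A$2$2 * (A$3$3 * A$4$4 - A$3$4 * A$4$3) - A$2$3 * (A$3$2 * A$4$4 - A$3$4 * A$4$2) + A$2$4 * (A$3$2 * A$4$3 - A$3$3 * A$4$2))
    - A$1$2 * (A$2$1 * (A$3$3 * A$4$4 - A$3$4 * A$4$3) - A$2$3 * (A$3$1 * A$4$4 - A$3$4 * A$4$1) + A$2$4 * (A$3$1 * A$4$3 - A$3$3 * A$4$1))
    + A$1$3 * (A$2$1 * (A$3$2 * A$4$4 - A$3$4 * A$4$2) - A$2$2 * (A$3$1 * A$4$4 - A$3$4 * A$4$1) + A$2$4 * (A$3$1 * A$4$2 - A$3$2 * A$4$1))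
    - A$1$4 * (A$2$1 * (A$3$2 * A$4$3 - A$3$3 * A$4$2) - A$2$2 * (A$3$1 * A$4$3 - A$3$3 * A$4$1) + A$2$3 * (A$3$1 * A$4$2 - A$3$2 * A$4$1))"
proof -
  have f1: "finite {2::4, 3, 4}" "1 \<notin> {2::4, 3, 4}"
    and f2: "finite {3::4, 4}" "2 \<notin> {3::4, 4}"
    and f3: "finite {4::4}" "3 \<notin> {4::4}" by auto
  show ?thesis
    unfolding det_def UNIV_4
    unfolding sum_over_permutations_insert[OF f1] sum_over_permutations_insert[OF f2]
      sum_over_permutations_insert[OF f3] permutes_sing
    by (simp add: sign_swap_id permutation_swap_id sign_compose sign_id swap_id_eq permutation_compose)
      (simp add: algebra_simps)
qed

lemma lc_values [simp]:
  "lc 1 2 3 4 = 1" "lc 1 2 4 3 = -1" "lc 1 3 2 4 = -1" "lc 1 3 4 2 = 1"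
  "lc 1 4 2 3 = 1" "lc 1 4 3 2 = -1" "lc 2 1 3 4 = -1" "lc 2 1 4 3 = 1"
  "lc 2 3 1 4 = 1" "lc 2 3 4 1 = -1" "lc 2 4 1 3 = -1" "lc 2 4 3 1 = 1"
  "lc 3 1 2 4 = 1" "lc 3 1 4 2 = -1" "lc 3 2 1 4 = -1" "lc 3 2 4 1 = 1"
  "lc 3 4 1 2 = 1" "lc 3 4 2 1 = -1" "lc 4 1 2 3 = -1" "lc 4 1 3 2 = 1"
  "lc 4 2 1 3 = 1" "lc 4 2 3 1 = -1" "lc 4 3 1 2 = -1" "lc 4 3 2 1 = 1"
  by (simp_all add: lc_def det_4 axis_def)

lemma lc_repeated [simp]:
  "lc i i k l = 0" "lc i j i l = 0" "lc i j k i = 0" "lc i j j l = 0" "lc i j k j = 0" "lc i j k k = 0"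
  using exhaust_4[of i] exhaust_4[of j] exhaust_4[of k] exhaust_4[of l]
  by (auto simp: lc_def det_4 axis_def)

text \<open>Right multiplication by \<open>transpose g\<close> has determinant 1, turns rows of g
  into axis vectors and axis vectors into columns of g. Both determinants are 2x2 minors of g up to
  sign, on complementary row indices.\<close>

lemma complementary_minors:
  fixes g :: "real^4^4"
  assumes "orthogonal_matrix g" "det g = 1"
  shows "det (vector [row i g, row j g, axis k 1, axis l 1] :: real^4^4)
       = det (vector [axis i 1, axis j 1, column k g, column l g] :: real^4^4)"
proof -
  let ?M = "vector [row i g, row j g, axis k 1, axis l 1] :: real^4^4"
  have gg: "(\<Sum>r\<in>UNIV. g $ m $ r * g $ n $ r) = (if m = n then 1 else 0)" for m n
  proof -
    have "(g ** transpose g) $ m $ n = (mat 1 :: real^4^4) $ m $ n"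
      using assms(1) by (simp add: orthogonal_matrix_def)
    then show ?thesis by (simp add: matrix_matrix_mult_def transpose_def mat_def)
  qed
  have rows: "(?M ** transpose g) $ r $ n = (\<Sum>m\<in>UNIV. ?M $ r $ m * g $ n $ m)" for r n
    by (simp add: matrix_matrix_mult_def transpose_def)
  have "(?M ** transpose g) $ r $ n = (vector [axis i 1, axis j 1, column k g, column l g] :: real^4^4) $ r $ n" for r n
  proof -
    have ax: "(\<Sum>m\<in>UNIV. axis k 1 $ m * g $ n $ m) = g $ n $ k" for k
      by (simp add: axis_def if_distrib[of "\<lambda>x. x * _"] cong: if_cong)
    have rw: "(\<Sum>m\<in>UNIV. row k g $ m * g $ n $ m) = axis k 1 $ n" for k
      unfolding row_def vec_lambda_beta vec_nth_inverse gg by (simp add: axis_def)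
    show ?thesis
      unfolding rows using exhaust_4[of r] by (elim disjE) (simp_all only: vector_4 ax rw column_def vec_lambda_beta)
  qed
  then have "?M ** transpose g = vector [axis i 1, axis j 1, column k g, column l g]"
    by (intro vec_eq_iff[THEN iffD2] allI)
  moreover have "det (?M ** transpose g) = det ?M"
    by (simp add: det_mul assms(2))
  ultimately show ?thesis by simp
qed

lemma det_two_axes:
  fixes u v :: "real^4"
  shows "det (vector [u, v, axis 1 1, axis 2 1] :: real^4^4) = (u$3 * v$4 - u$4 * v$3)"
    "det (vector [axis 3 1, axis 4 1, u, v] :: real^4^4) = (u$1 * v$2 - v$1 * u$2)"
    "det (vector [u, v, axis 1 1, axis 3 1] :: real^4^4) = -(u$2 * v$4 - u$4 * v$2)"
    "det (vector [axis 2 1, axis 4 1, u, v] :: real^4^4) = -(u$1 * v$3 - v$1 * u$3)"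
    "det (vector [u, v, axis 1 1, axis 4 1] :: real^4^4) = (u$2 * v$3 - u$3 * v$2)"
    "det (vector [axis 2 1, axis 3 1, u, v] :: real^4^4) = (u$1 * v$4 - v$1 * u$4)"
    "det (vector [u, v, axis 2 1, axis 3 1] :: real^4^4) = (u$1 * v$4 - u$4 * v$1)"
    "det (vector [axis 1 1, axis 4 1, u, v] :: real^4^4) = (u$2 * v$3 - v$2 * u$3)"
    "det (vector [u, v, axis 2 1, axis 4 1] :: real^4^4) = -(u$1 * v$3 - u$3 * v$1)"
    "det (vector [axis 1 1, axis 3 1, u, v] :: real^4^4) = -(u$2 * v$4 - v$2 * u$4)"
    "det (vector [u, v, axis 3 1, axis 4 1] :: real^4^4) = (u$1 * v$2 - u$2 * v$1)"
    "det (vector [axis 1 1, axis 2 1, u, v] :: real^4^4) = (u$3 * v$4 - v$3 * u$4)"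
  by (simp_all add: det_4 axis_def)

text \<open>Complementary 2x2 minors of a matrix in SO(4) agree up to sign, since the inverse is the transpose;
  this says that conjugation preserves (anti)selfduality.\<close>
lemma minor_identities:
  fixes g :: "real^4^4"
  assumes "orthogonal_matrix g" "det g = 1"
  defines "M \<equiv> \<lambda>i j k l. g$i$k * g$j$l - g$i$l * g$j$k"
  shows "M 3 4 3 4 = M 1 2 1 2" "M 3 4 1 2 = M 1 2 3 4" "M 3 4 1 3 = - M 1 2 2 4" "M 3 4 2 4 = - M 1 2 1 3"
    "M 3 4 1 4 = M 1 2 2 3" "M 3 4 2 3 = M 1 2 1 4"
    "M 2 4 3 4 = - M 1 3 1 2" "M 2 4 1 2 = - M 1 3 3 4" "M 2 4 1 3 = M 1 3 2 4" "M 2 4 2 4 = M 1 3 1 3"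
    "M 2 4 1 4 = - M 1 3 2 3" "M 2 4 2 3 = - M 1 3 1 4"
    "M 2 3 3 4 = M 1 4 1 2" "M 2 3 1 2 = M 1 4 3 4" "M 2 3 1 3 = - M 1 4 2 4" "M 2 3 2 4 = - M 1 4 1 3"
    "M 2 3 1 4 = M 1 4 2 3" "M 2 3 2 3 = M 1 4 1 4"
proof -
  show "M 3 4 3 4 = M 1 2 1 2"
    using complementary_minors[OF assms(1,2), of 1 2 3 4]
    unfolding det_two_axes row_def column_def M_def vec_lambda_beta vec_nth_inverse by linarith
  show "M 3 4 1 2 = M 1 2 3 4"
    using complementary_minors[OF assms(1,2), of 1 2 1 2]
    unfolding det_two_axes row_def column_def M_def vec_lambda_beta vec_nth_inverse by linarith
  show "M 3 4 1 3 = - M 1 2 2 4"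
    using complementary_minors[OF assms(1,2), of 1 2 1 3]
    unfolding det_two_axes row_def column_def M_def vec_lambda_beta vec_nth_inverse by linarith
  show "M 3 4 2 4 = - M 1 2 1 3"
    using complementary_minors[OF assms(1,2), of 1 2 2 4]
    unfolding det_two_axes row_def column_def M_def vec_lambda_beta vec_nth_inverse by linarith
  show "M 3 4 1 4 = M 1 2 2 3"
    using complementary_minors[OF assms(1,2), of 1 2 1 4]
    unfolding det_two_axes row_def column_def M_def vec_lambda_beta vec_nth_inverse by linarith
  show "M 3 4 2 3 = M 1 2 1 4"
    using complementary_minors[OF assms(1,2), of 1 2 2 3]
    unfolding det_two_axes row_def column_def M_def vec_lambda_beta vec_nth_inverse by linarith
  show "M 2 4 3 4 = - M 1 3 1 2"
    using complementary_minors[OF assms(1,2), of 1 3 3 4]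
    unfolding det_two_axes row_def column_def M_def vec_lambda_beta vec_nth_inverse by linarith
  show "M 2 4 1 2 = - M 1 3 3 4"
    using complementary_minors[OF assms(1,2), of 1 3 1 2]
    unfolding det_two_axes row_def column_def M_def vec_lambda_beta vec_nth_inverse by linarith
  show "M 2 4 1 3 = M 1 3 2 4"
    using complementary_minors[OF assms(1,2), of 1 3 1 3]
    unfolding det_two_axes row_def column_def M_def vec_lambda_beta vec_nth_inverse by linarith
  show "M 2 4 2 4 = M 1 3 1 3"
    using complementary_minors[OF assms(1,2), of 1 3 2 4]
    unfolding det_two_axes row_def column_def M_def vec_lambda_beta vec_nth_inverse by linarith
  show "M 2 4 1 4 = - M 1 3 2 3"
    using complementary_minors[OF assms(1,2), of 1 3 1 4]
    unfolding det_two_axes row_def column_def M_def vec_lambda_beta vec_nth_inverse by linarith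
  show "M 2 4 2 3 = - M 1 3 1 4"
    using complementary_minors[OF assms(1,2), of 1 3 2 3]
    unfolding det_two_axes row_def column_def M_def vec_lambda_beta vec_nth_inverse by linarith
  show "M 2 3 3 4 = M 1 4 1 2"
    using complementary_minors[OF assms(1,2), of 1 4 3 4]
    unfolding det_two_axes row_def column_def M_def vec_lambda_beta vec_nth_inverse by linarith
  show "M 2 3 1 2 = M 1 4 3 4"
    using complementary_minors[OF assms(1,2), of 1 4 1 2]
    unfolding det_two_axes row_def column_def M_def vec_lambda_beta vec_nth_inverse by linarith
  show "M 2 3 1 3 = - M 1 4 2 4"
    using complementary_minors[OF assms(1,2), of 1 4 1 3]
    unfolding det_two_axes row_def column_def M_def vec_lambda_beta vec_nth_inverse by linarith
  show "M 2 3 2 4 = - M 1 4 1 3"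
    using complementary_minors[OF assms(1,2), of 1 4 2 4]
    unfolding det_two_axes row_def column_def M_def vec_lambda_beta vec_nth_inverse by linarith
  show "M 2 3 1 4 = M 1 4 2 3"
    using complementary_minors[OF assms(1,2), of 1 4 1 4]
    unfolding det_two_axes row_def column_def M_def vec_lambda_beta vec_nth_inverse by linarith
  show "M 2 3 2 3 = M 1 4 1 4"
    using complementary_minors[OF assms(1,2), of 1 4 2 3]
    unfolding det_two_axes row_def column_def M_def vec_lambda_beta vec_nth_inverse by linarith
qed

text \<open>Conjugation by g on the span of the JM s a, which is \<Lambda>^+ or \<Lambda>^- as a representation of SO(4).\<close>
definition RR :: "real \<Rightarrow> real^4^4 \<Rightarrow> real^3^3" where
  "RR s g = (\<chi> b a. (1/4) * (\<Sum>i\<in>UNIV. \<Sum>j\<in>UNIV. JM s b $ i $ j * (g ** JM s a ** transpose g) $ i $ j))"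

lemma conj_JM_entry:
  "(g ** JM s 1 ** transpose g) $ i $ j = (g$i$1 * g$j$2 - g$i$2 * g$j$1) + s * (g$i$3 * g$j$4 - g$i$4 * g$j$3)"
  "(g ** JM s 2 ** transpose g) $ i $ j = (g$i$1 * g$j$3 - g$i$3 * g$j$1) - s * (g$i$2 * g$j$4 - g$i$4 * g$j$2)"
  "(g ** JM s 3 ** transpose g) $ i $ j = (g$i$1 * g$j$4 - g$i$4 * g$j$1) + s * (g$i$2 * g$j$3 - g$i$3 * g$j$2)"
  by (simp_all add: matrix_matrix_mult_def transpose_def sum_4 algebra_simps)

lemma tr_L2_symmetric: "tr_L2 g = (1/2) * (\<Sum>i\<in>UNIV. \<Sum>j\<in>UNIV. g$i$i * g$j$j - g$i$j * g$j$i)"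
proof -
  let ?m = "\<lambda>i j. g$i$i * g$j$j - g$i$j * g$j$i"
  have "(\<Sum>i\<in>UNIV. \<Sum>j\<in>UNIV. ?m i j)
      = (\<Sum>i\<in>UNIV. \<Sum>j\<in>UNIV. (if i < j then ?m i j else 0) + (if j < i then ?m j i else 0))"
    by (intro sum.cong refl) (auto simp: not_less_iff_gr_or_eq mult.commute)
  also have "\<dots> = tr_L2 g + (\<Sum>i\<in>UNIV. \<Sum>j\<in>UNIV. if j < i then ?m j i else 0)"
    by (simp add: sum.distrib tr_L2_def)
  also have "(\<Sum>i\<in>UNIV. \<Sum>j\<in>UNIV. if j < i then ?m j i else 0) = tr_L2 g"
    unfolding tr_L2_def by (rule sum.swap)
  finally show ?thesis by simp
qed

lemma lc_sum3:
  fixes f :: "4 \<Rightarrow> 4 \<Rightarrow> 4 \<Rightarrow> real"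
  shows "(\<Sum>b\<in>UNIV. \<Sum>c\<in>UNIV. \<Sum>d\<in>UNIV. lc b 1 c d * f b c d) = f 2 4 3 + f 3 2 4 + f 4 3 2 - f 2 3 4 - f 3 4 2 - f 4 2 3"
    "(\<Sum>b\<in>UNIV. \<Sum>c\<in>UNIV. \<Sum>d\<in>UNIV. lc b 2 c d * f b c d) = f 1 3 4 + f 3 4 1 + f 4 1 3 - f 1 4 3 - f 3 1 4 - f 4 3 1"
    "(\<Sum>b\<in>UNIV. \<Sum>c\<in>UNIV. \<Sum>d\<in>UNIV. lc b 3 c d * f b c d) = f 1 4 2 + f 2 1 4 + f 4 2 1 - f 1 2 4 - f 2 4 1 - f 4 1 2"
    "(\<Sum>b\<in>UNIV. \<Sum>c\<in>UNIV. \<Sum>d\<in>UNIV. lc b 4 c d * f b c d) = f 1 2 3 + f 2 3 1 + f 3 1 2 - f 1 3 2 - f 2 1 3 - f 3 2 1"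
  by (simp_all add: sum_4)

lemma tr_L2_star_minors:
  "tr_L2_star g = (g$1$3 * g$2$4 - g$1$4 * g$2$3) + (g$3$1 * g$4$2 - g$3$2 * g$4$1)
    - (g$1$2 * g$3$4 - g$1$4 * g$3$2) - (g$2$1 * g$4$3 - g$2$3 * g$4$1)
    + (g$1$2 * g$4$3 - g$1$3 * g$4$2) + (g$2$1 * g$3$4 - g$2$4 * g$3$1)"
proof -
  have "(\<Sum>i\<in>UNIV. \<Sum>j\<in>UNIV. \<Sum>k\<in>UNIV. \<Sum>l\<in>UNIV. lc i j k l * g$i$k * g$j$l)
      = (\<Sum>j\<in>UNIV. \<Sum>i\<in>UNIV. \<Sum>k\<in>UNIV. \<Sum>l\<in>UNIV. lc i j k l * (g$i$k * g$j$l))"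
    by (subst sum.swap) (simp only: mult.assoc)
  also have "\<dots> = (\<Sum>i\<in>UNIV. \<Sum>k\<in>UNIV. \<Sum>l\<in>UNIV. lc i 1 k l * (g$i$k * g$1$l))
      + (\<Sum>i\<in>UNIV. \<Sum>k\<in>UNIV. \<Sum>l\<in>UNIV. lc i 2 k l * (g$i$k * g$2$l))
      + (\<Sum>i\<in>UNIV. \<Sum>k\<in>UNIV. \<Sum>l\<in>UNIV. lc i 3 k l * (g$i$k * g$3$l))
      + (\<Sum>i\<in>UNIV. \<Sum>k\<in>UNIV. \<Sum>l\<in>UNIV. lc i 4 k l * (g$i$k * g$4$l))"
    by (rule sum_4)
  finally show ?thesis
    unfolding tr_L2_star_def lc_sum3 by (simp add: algebra_simps)
qed

lemma tr_L2_minors: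
  "tr_L2 g = (g$1$1 * g$2$2 - g$1$2 * g$2$1) + (g$1$1 * g$3$3 - g$1$3 * g$3$1) + (g$1$1 * g$4$4 - g$1$4 * g$4$1)
    + (g$2$2 * g$3$3 - g$2$3 * g$3$2) + (g$2$2 * g$4$4 - g$2$4 * g$4$2) + (g$3$3 * g$4$4 - g$3$4 * g$4$3)"
  unfolding tr_L2_symmetric by (simp add: sum_4 algebra_simps)

text \<open>Each line collects two complementary principal minors of g, and s times a third of
  \<open>tr_L2_star\<close>. Their sum is \<open>tr_L2 g + s * tr_L2_star g\<close>, which ties s =
  1 to \<open>chi_plus\<close> and s = -1 to \<open>chi_minus\<close>.\<close>

lemma RR_diagonal:
  assumes "s * s = 1"
  shows "2 * RR s g $ 1 $ 1 = (g$1$1 * g$2$2 - g$1$2 * g$2$1) + (g$3$3 * g$4$4 - g$3$4 * g$4$3)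
       + s * ((g$1$3 * g$2$4 - g$1$4 * g$2$3) + (g$3$1 * g$4$2 - g$3$2 * g$4$1))"
    "2 * RR s g $ 2 $ 2 = (g$1$1 * g$3$3 - g$1$3 * g$3$1) + (g$2$2 * g$4$4 - g$2$4 * g$4$2)
       - s * ((g$1$2 * g$3$4 - g$1$4 * g$3$2) + (g$2$1 * g$4$3 - g$2$3 * g$4$1))"
    "2 * RR s g $ 3 $ 3 = (g$1$1 * g$4$4 - g$1$4 * g$4$1) + (g$2$2 * g$3$3 - g$2$3 * g$3$2)
       + s * ((g$1$2 * g$4$3 - g$1$3 * g$4$2) + (g$2$1 * g$3$4 - g$2$4 * g$3$1))"
proof -
  have "s = 1 \<or> s = -1" using assms by (metis square_eq_1_iff)
  then show "2 * RR s g $ 1 $ 1 = (g$1$1 * g$2$2 - g$1$2 * g$2$1) + (g$3$3 * g$4$4 - g$3$4 * g$4$3)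
       + s * ((g$1$3 * g$2$4 - g$1$4 * g$2$3) + (g$3$1 * g$4$2 - g$3$2 * g$4$1))"
    "2 * RR s g $ 2 $ 2 = (g$1$1 * g$3$3 - g$1$3 * g$3$1) + (g$2$2 * g$4$4 - g$2$4 * g$4$2)
       - s * ((g$1$2 * g$3$4 - g$1$4 * g$3$2) + (g$2$1 * g$4$3 - g$2$3 * g$4$1))"
    "2 * RR s g $ 3 $ 3 = (g$1$1 * g$4$4 - g$1$4 * g$4$1) + (g$2$2 * g$3$3 - g$2$3 * g$3$2)
       + s * ((g$1$2 * g$4$3 - g$1$3 * g$4$2) + (g$2$1 * g$3$4 - g$2$4 * g$3$1))"
    unfolding RR_def vec_lambda_beta by (auto simp: sum_4 conj_JM_entry)
qed

lemma chi_plus_RR: "chi_plus g = (\<Sum>a\<in>UNIV. RR 1 g $ a $ a)"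
proof -
  have "2 * chi_plus g = 2 * RR 1 g $ 1 $ 1 + 2 * RR 1 g $ 2 $ 2 + 2 * RR 1 g $ 3 $ 3"
    by (simp add: RR_diagonal chi_plus_def tr_L2_minors tr_L2_star_minors)
  then show ?thesis by (simp add: sum_3)
qed

lemma chi_minus_RR: "chi_minus g = (\<Sum>a\<in>UNIV. RR (-1) g $ a $ a)"
proof -
  have "2 * chi_minus g = 2 * RR (-1) g $ 1 $ 1 + 2 * RR (-1) g $ 2 $ 2 + 2 * RR (-1) g $ 3 $ 3"
    by (simp add: RR_diagonal chi_minus_def tr_L2_minors tr_L2_star_minors)
  then show ?thesis by (simp add: sum_3)
qed

lemma orthogonal_matrix_transpose_mv:
  fixes g :: "real^'n^'n"
  shows "orthogonal_matrix g \<Longrightarrow> g *v (transpose g *v x) = x"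
  by (simp only: matrix_vector_mul_assoc orthogonal_matrix_def matrix_vector_mul_lid)

lemma orthogonal_matrix_inner:
  fixes g :: "real^'n^'n"
  assumes "orthogonal_matrix g"
  shows "(g *v x) \<bullet> (g *v y) = x \<bullet> y"
proof -
  have "orthogonal_transformation ((*v) g)"
    using assms by (simp add: orthogonal_transformation_matrix)
  then show ?thesis by (simp add: orthogonal_transformation_def)
qed

lemma orthogonal_matrix_S3 [simp]: "orthogonal_matrix g \<Longrightarrow> g *v p \<in> S3 \<longleftrightarrow> p \<in> S3"
  by (simp add: S3_def norm_eq_sqrt_inner orthogonal_matrix_inner)

section \<open>The three-dimensional representation on the frame\<close>

context frame
begin

abbreviation R :: "real^4^4 \<Rightarrow> real^3^3" where "R \<equiv> RR s"

lemma conj_JM: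
  assumes "orthogonal_matrix g" "det g = 1"
  shows "g ** JM s a ** transpose g = (\<Sum>b\<in>UNIV. (R g $ b $ a) *\<^sub>R JM s b)"
proof -
  note m = minor_identities[OF assms]
  define Q where "Q = g ** JM s a ** transpose g"
  \<comment> \<open>The conjugated matrix is antisymmetric and satisfies the same (anti)selfduality
    relations as the \<open>JM s b\<close>, so its first row determines it and supplies the
    coefficients.\<close>
  have dual: "Q$3$4 = s * Q$1$2" "Q$2$4 = - s * Q$1$3" "Q$2$3 = s * Q$1$4" "\<And>i j. Q$i$j = - Q$j$i"
    unfolding Q_def using exhaust_3[of a]
    by (auto simp: conj_JM_entry m ring_distribs)
  have diag: "Q$i$i = 0" for i using dual(4)[of i i] by simp
  have R: "R g $ 1 $ a = Q$1$2" "R g $ 2 $ a = Q$1$3" "R g $ 3 $ a = Q$1$4"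
    unfolding RR_def vec_lambda_beta Q_def[symmetric]
    using dual(4)[of 2 1] dual(4)[of 3 1] dual(4)[of 4 1] dual(4)[of 3 2] dual(4)[of 4 2] dual(4)[of 4 3]
    by (simp_all add: sum_4 dual(1,2,3) ss)
  show ?thesis unfolding Q_def[symmetric]
    using dual(4)[of 2 1] dual(4)[of 3 1] dual(4)[of 4 1] dual(4)[of 3 2] dual(4)[of 4 2] dual(4)[of 4 3]
    by (simp add: vec_eq_iff forall_4 sum_3 R diag dual(1,2,3))
qed

lemma JM_intertwine:
  assumes "orthogonal_matrix g" "det g = 1"
  shows "g *v (JM s a *v p) = (\<Sum>b\<in>UNIV. (R g $ b $ a) *\<^sub>R (JM s b *v (g *v p)))"
proof -
  have "g ** JM s a ** transpose g ** g = g ** JM s a"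
    using assms(1) by (simp add: orthogonal_matrix_def flip: matrix_mul_assoc)
  then have "g *v (JM s a *v p) = (\<Sum>b\<in>UNIV. (R g $ b $ a) *\<^sub>R JM s b) *v (g *v p)"
    unfolding conj_JM[OF assms] by (simp add: matrix_vector_mul_assoc)
  then show ?thesis
    by (simp add: sum_3 matrix_vector_mult_add_rdistrib scaleR_matrix_vector_assoc)
qed

lemma JM_frame_at_axis: "(\<Sum>b\<in>UNIV. c b *\<^sub>R (JM s b *v axis 1 1)) = vector [0, - c 1, - c 2, - c 3]"
  by (simp add: vec_eq_iff forall_4 sum_3 axis_def)

text \<open>At the point that g sends to \<open>axis 1 1\<close> the transported frame consists of
  minus the other three axis vectors, so the coefficients can be read off as coordinates.\<close>

lemma R_unique:
  assumes "orthogonal_matrix g" "det g = 1"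
    and "\<And>p. g *v (JM s a *v p) = (\<Sum>b\<in>UNIV. c b *\<^sub>R (JM s b *v (g *v p)))"
  shows "c b = R g $ b $ a"
proof -
  have g: "g *v (transpose g *v axis 1 1) = axis 1 1"
    by (rule orthogonal_matrix_transpose_mv[OF assms(1)])
  have "(\<Sum>b\<in>UNIV. c b *\<^sub>R (JM s b *v axis 1 1)) = (\<Sum>b\<in>UNIV. (R g $ b $ a) *\<^sub>R (JM s b *v axis 1 1))"
    using assms(3)[of "transpose g *v axis 1 1"] JM_intertwine[OF assms(1,2), of a "transpose g *v axis 1 1"]
    unfolding g by simp
  then show ?thesis
    unfolding JM_frame_at_axis using exhaust_3[of b] by (auto simp: vec_eq_iff forall_4)
qed

lemma R_mult:
  assumes g: "orthogonal_matrix g" "det g = 1" and h: "orthogonal_matrix h" "det h = 1"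
  shows "R (g ** h) = R g ** R h"
proof -
  have gh: "orthogonal_matrix (g ** h)" "det (g ** h) = 1"
    using g h by (simp_all add: orthogonal_matrix_mul det_mul)
  have "(R g ** R h) $ b $ a = R (g ** h) $ b $ a" for a b
  proof (rule R_unique[OF gh])
    fix p
    have "(g ** h) *v (JM s a *v p) = g *v (\<Sum>b\<in>UNIV. (R h $ b $ a) *\<^sub>R (JM s b *v (h *v p)))"
      by (simp only: JM_intertwine[OF h, of a p] flip: matrix_vector_mul_assoc)
    also have "\<dots> = (\<Sum>b\<in>UNIV. (R h $ b $ a) *\<^sub>R (\<Sum>c\<in>UNIV. (R g $ c $ b) *\<^sub>R (JM s c *v (g *v (h *v p)))))"
      by (simp only: sum_3 matrix_vector_right_distrib matrix_vector_mult_scaleR JM_intertwine[OF g])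
    also have "\<dots> = (\<Sum>c\<in>UNIV. \<Sum>b\<in>UNIV. (R g $ c $ b * R h $ b $ a) *\<^sub>R (JM s c *v (g *v (h *v p))))"
      by (subst sum.swap) (simp add: scaleR_sum_right mult.commute)
    finally show "(g ** h) *v (JM s a *v p) = (\<Sum>c\<in>UNIV. (R g ** R h) $ c $ a *\<^sub>R (JM s c *v ((g ** h) *v p)))"
      by (simp add: matrix_matrix_mult_def matrix_vector_mul_assoc scaleR_sum_left)
  qed
  then show ?thesis by (simp add: vec_eq_iff)
qed

text \<open>The frame is orthonormal at every point of S^3 and g is an isometry, so the matrix
  relating the transported frame to the frame at the image point is orthogonal.\<close>

lemma R_orthogonal:
  assumes g: "orthogonal_matrix g" "det g = 1"
  shows "orthogonal_matrix (R g)"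
proof -
  define p where "p = transpose g *v axis 1 1"
  have gp: "g *v p = axis 1 1"
    unfolding p_def by (rule orthogonal_matrix_transpose_mv[OF g(1)])
  have pp: "p \<bullet> p = 1"
  proof -
    have "(g *v p) \<bullet> (g *v p) = p \<bullet> p" by (rule orthogonal_matrix_inner[OF g(1)])
    then show ?thesis by (simp add: gp inner_axis_axis)
  qed
  have J: "(JM s a *v p) \<bullet> (JM s c *v p) = (if a = c then 1 else 0)" for a c
    using exhaust_3[of a] exhaust_3[of c] pp ss
    by (auto simp: inner_vec_def sum_4 algebra_simps)
  have "(g *v (JM s a *v p)) \<bullet> (g *v (JM s c *v p)) = (if a = c then 1 else 0)" for a c
    by (simp only: orthogonal_matrix_inner[OF g(1)] J)
  then have "(\<Sum>b\<in>UNIV. R g $ b $ a * R g $ b $ c) = (if a = c then 1 else 0)" for a c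
    unfolding JM_intertwine[OF g] gp JM_frame_at_axis by (simp add: inner_vec_def sum_4 sum_3)
  then have "transpose (R g) ** R g = mat 1"
    by (simp add: vec_eq_iff matrix_matrix_mult_def transpose_def mat_def)
  then show ?thesis by (simp add: orthogonal_matrix)
qed

text \<open>Conjugation by g respects the quaternion products J_1 J_2 = -s J_3 and its cyclic
  versions. Hence each column of \<open>R g\<close> is the cross product of the other two in cyclic
  order; orthogonality alone would leave a sign open, and curl is sensitive to it.\<close>

lemma R_cross:
  assumes g: "orthogonal_matrix g" "det g = 1"
  shows "R g $ 3 $ 3 = R g $ 1 $ 1 * R g $ 2 $ 2 - R g $ 2 $ 1 * R g $ 1 $ 2"
    "R g $ 1 $ 3 = R g $ 2 $ 1 * R g $ 3 $ 2 - R g $ 3 $ 1 * R g $ 2 $ 2"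
    "R g $ 2 $ 3 = R g $ 3 $ 1 * R g $ 1 $ 2 - R g $ 1 $ 1 * R g $ 3 $ 2"
    "R g $ 3 $ 1 = R g $ 1 $ 2 * R g $ 2 $ 3 - R g $ 2 $ 2 * R g $ 1 $ 3"
    "R g $ 1 $ 1 = R g $ 2 $ 2 * R g $ 3 $ 3 - R g $ 3 $ 2 * R g $ 2 $ 3"
    "R g $ 2 $ 1 = R g $ 3 $ 2 * R g $ 1 $ 3 - R g $ 1 $ 2 * R g $ 3 $ 3"
    "R g $ 3 $ 2 = R g $ 1 $ 3 * R g $ 2 $ 1 - R g $ 2 $ 3 * R g $ 1 $ 1"
    "R g $ 1 $ 2 = R g $ 2 $ 3 * R g $ 3 $ 1 - R g $ 3 $ 3 * R g $ 2 $ 1"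
    "R g $ 2 $ 2 = R g $ 3 $ 3 * R g $ 1 $ 1 - R g $ 1 $ 3 * R g $ 3 $ 1"
proof -
  define p where "p = transpose g *v axis 1 1"
  have gp: "g *v p = axis 1 1"
    unfolding p_def by (rule orthogonal_matrix_transpose_mv[OF g(1)])
  have J: "JM s 1 *v (JM s 2 *v p) = (-s) *\<^sub>R (JM s 3 *v p)" "JM s 2 *v (JM s 3 *v p) = (-s) *\<^sub>R (JM s 1 *v p)"
      "JM s 3 *v (JM s 1 *v p) = (-s) *\<^sub>R (JM s 2 *v p)"
    by (auto simp: vec_eq_iff forall_4 ss)
  \<comment> \<open>Evaluation at the preimage of \<open>axis 1 1\<close> turns the quaternion
    relations into equations between explicit coordinate vectors.\<close>
  have e: "g *v (JM s a *v (JM s c *v p)) = vector [- (\<Sum>b\<in>UNIV. R g $ b $ a * R g $ b $ c),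
        s * (R g $ 2 $ a * R g $ 3 $ c - R g $ 3 $ a * R g $ 2 $ c),
        s * (R g $ 3 $ a * R g $ 1 $ c - R g $ 1 $ a * R g $ 3 $ c),
        s * (R g $ 1 $ a * R g $ 2 $ c - R g $ 2 $ a * R g $ 1 $ c)]" for a c
    unfolding JM_intertwine[OF g, of a] unfolding JM_intertwine[OF g, of c] gp
    by (simp add: vec_eq_iff forall_4 sum_3 axis_def algebra_simps)
  have e1: "g *v ((-s) *\<^sub>R (JM s c *v p)) = vector [0, s * R g $ 1 $ c, s * R g $ 2 $ c, s * R g $ 3 $ c]" for c
    unfolding matrix_vector_mult_scaleR JM_intertwine[OF g, of c] gp JM_frame_at_axis
    by (simp add: vec_eq_iff forall_4)
  have s0: "s \<noteq> 0" using ss by auto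
  show "R g $ 3 $ 3 = R g $ 1 $ 1 * R g $ 2 $ 2 - R g $ 2 $ 1 * R g $ 1 $ 2"
    "R g $ 1 $ 3 = R g $ 2 $ 1 * R g $ 3 $ 2 - R g $ 3 $ 1 * R g $ 2 $ 2"
    "R g $ 2 $ 3 = R g $ 3 $ 1 * R g $ 1 $ 2 - R g $ 1 $ 1 * R g $ 3 $ 2"
    using e[of 1 2] s0 unfolding J e1 by (simp_all add: vec_eq_iff forall_4)
  show "R g $ 3 $ 1 = R g $ 1 $ 2 * R g $ 2 $ 3 - R g $ 2 $ 2 * R g $ 1 $ 3"
    "R g $ 1 $ 1 = R g $ 2 $ 2 * R g $ 3 $ 3 - R g $ 3 $ 2 * R g $ 2 $ 3"
    "R g $ 2 $ 1 = R g $ 3 $ 2 * R g $ 1 $ 3 - R g $ 1 $ 2 * R g $ 3 $ 3"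
    using e[of 2 3] s0 unfolding J e1 by (simp_all add: vec_eq_iff forall_4)
  show "R g $ 3 $ 2 = R g $ 1 $ 3 * R g $ 2 $ 1 - R g $ 2 $ 3 * R g $ 1 $ 1"
    "R g $ 1 $ 2 = R g $ 2 $ 3 * R g $ 3 $ 1 - R g $ 3 $ 3 * R g $ 2 $ 1"
    "R g $ 2 $ 2 = R g $ 3 $ 3 * R g $ 1 $ 1 - R g $ 1 $ 3 * R g $ 3 $ 1"
    using e[of 3 1] s0 unfolding J e1 by (simp_all add: vec_eq_iff forall_4)
qed

end

section \<open>Curl in the frame\<close>

lemma lc_sum3_complex:
  fixes f :: "4 \<Rightarrow> 4 \<Rightarrow> 4 \<Rightarrow> complex"
  shows "(\<Sum>b\<in>UNIV. \<Sum>c\<in>UNIV. \<Sum>d\<in>UNIV. of_real (lc b 1 c d) * f b c d) = f 2 4 3 + f 3 2 4 + f 4 3 2 - f 2 3 4 - f 3 4 2 - f 4 2 3"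
    "(\<Sum>b\<in>UNIV. \<Sum>c\<in>UNIV. \<Sum>d\<in>UNIV. of_real (lc b 2 c d) * f b c d) = f 1 3 4 + f 3 4 1 + f 4 1 3 - f 1 4 3 - f 3 1 4 - f 4 3 1"
    "(\<Sum>b\<in>UNIV. \<Sum>c\<in>UNIV. \<Sum>d\<in>UNIV. of_real (lc b 3 c d) * f b c d) = f 1 4 2 + f 2 1 4 + f 4 2 1 - f 1 2 4 - f 2 4 1 - f 4 1 2"
    "(\<Sum>b\<in>UNIV. \<Sum>c\<in>UNIV. \<Sum>d\<in>UNIV. of_real (lc b 4 c d) * f b c d) = f 1 2 3 + f 2 3 1 + f 3 1 2 - f 1 3 2 - f 2 1 3 - f 3 2 1"
  by (simp_all add: sum_4)

definition emb :: "real^4 \<Rightarrow> complex^4" where "emb v = (\<chi> i. of_real (v $ i))"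

lemma emb_nth [simp]: "emb v $ i = of_real (v $ i)" by (simp add: emb_def)

text \<open>The vector product of T_p S^3 in ambient coordinates, for p on S^3: its inner product
  with a tangent vector e is det(p, e, v, w), matching the orientation with the outward normal
  first.\<close>

definition cross4 :: "real^4 \<Rightarrow> real^4 \<Rightarrow> complex^4 \<Rightarrow> complex^4" where
  "cross4 p v w = (\<chi> a. \<Sum>b\<in>UNIV. \<Sum>c\<in>UNIV. \<Sum>d\<in>UNIV. of_real (lc b a c d) * (of_real (p$b) * of_real (v$c) * w$d))"

lemma cross4_nth:
  "cross4 p v w $ 1 = of_real (p$2) * of_real (v$4) * w$3 + of_real (p$3) * of_real (v$2) * w$4 + of_real (p$4) * of_real (v$3) * w$2 - of_real (p$2) * of_real (v$3) * w$4 - of_real (p$3) * of_real (v$4) * w$2 - of_real (p$4) * of_real (v$2) * w$3"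
  "cross4 p v w $ 2 = of_real (p$1) * of_real (v$3) * w$4 + of_real (p$3) * of_real (v$4) * w$1 + of_real (p$4) * of_real (v$1) * w$3 - of_real (p$1) * of_real (v$4) * w$3 - of_real (p$3) * of_real (v$1) * w$4 - of_real (p$4) * of_real (v$3) * w$1"
  "cross4 p v w $ 3 = of_real (p$1) * of_real (v$4) * w$2 + of_real (p$2) * of_real (v$1) * w$4 + of_real (p$4) * of_real (v$2) * w$1 - of_real (p$1) * of_real (v$2) * w$4 - of_real (p$2) * of_real (v$4) * w$1 - of_real (p$4) * of_real (v$1) * w$2"
  "cross4 p v w $ 4 = of_real (p$1) * of_real (v$2) * w$3 + of_real (p$2) * of_real (v$3) * w$1 + of_real (p$3) * of_real (v$1) * w$2 - of_real (p$1) * of_real (v$3) * w$2 - of_real (p$2) * of_real (v$1) * w$3 - of_real (p$3) * of_real (v$2) * w$1"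
  by (simp_all only: cross4_def vec_lambda_beta lc_sum3_complex)

lemma cross4_add: "cross4 p v (w + w') = cross4 p v w + cross4 p v w'"
  by (simp add: cross4_def vec_eq_iff sum.distrib ring_distribs)

lemma cross4_smult: "cross4 p v (c *s w) = c *s cross4 p v w"
  by (simp add: cross4_def vec_eq_iff sum_distrib_left mult_ac)

lemma cross4_self: "cross4 p v (emb p) = 0" "cross4 p v (emb v) = 0" "cross4 p v (emb (- p)) = 0"
  by (simp_all add: vec_eq_iff forall_4 cross4_nth)

definition cp :: "'d \<Rightarrow> (real^4 \<Rightarrow> complex^'d) \<Rightarrow> real^4 \<Rightarrow> complex" where
  "cp a u = (\<lambda>p. u p $ a)"

lemma cp_apply [simp]: "cp a u p = u p $ a" by (simp add: cp_def)

definition VF :: "(real^4 \<Rightarrow> complex^'d) set" where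
  "VF = {u. \<forall>a. cp a u \<in> SF}"

definition EQ :: "(real^4^4) set \<Rightarrow> (real^4^4 \<Rightarrow> complex^'d^'d) \<Rightarrow> (real^4 \<Rightarrow> complex^'d) set" where
  "EQ G \<rho> = {u. \<forall>g\<in>G. \<forall>p\<in>S3. u (g *v p) = \<rho> g *v u p}"

lemma VF_outside: "u \<in> VF \<Longrightarrow> p \<notin> S3 \<Longrightarrow> u p = 0"
  unfolding VF_def vec_eq_iff using SF_outside[of "cp _ u" p] by auto

lemma smooth_vec:
  fixes Y :: "real^4 \<Rightarrow> complex^'n"
  assumes "\<And>i. smooth (\<lambda>p. Y p $ i)"
  shows "smooth Y"
proof -
  have "linear (\<lambda>c::complex. (\<chi> j. if j = i then c else 0) :: complex^'n)" for i
    by (auto simp: linear_iff vec_eq_iff)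
  then have "bounded_linear (\<lambda>c::complex. (\<chi> j. if j = i then c else 0) :: complex^'n)" for i
    by (simp add: linear_conv_bounded_linear)
  then have "smooth (\<lambda>p. \<Sum>i\<in>UNIV. (\<chi> j. if j = i then Y p $ i else 0))"
    by (intro smooth_sum finite smooth_bounded_linear[OF _ assms])
  moreover have "(\<lambda>p. \<Sum>i\<in>UNIV. (\<chi> j. if j = i then Y p $ i else 0)) = Y"
    by (auto simp: fun_eq_iff vec_eq_iff)
  ultimately show ?thesis by simp
qed

lemma smooth_nth: "smooth Y \<Longrightarrow> smooth (\<lambda>p. Y p $ i)"
  by (rule smooth_bounded_linear[OF bounded_linear_vec_nth])

context frame
begin

text \<open>Completeness of the orthonormal basis p, J_1 p, J_2 p, J_3 p of R^4.\<close>

lemma axis_frame: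
  assumes "p \<in> S3"
  shows "axis c 1 = (p $ c) *\<^sub>R p + (\<Sum>b\<in>UNIV. ((JM s b *v p) $ c) *\<^sub>R (JM s b *v p))"
proof -
  have "p$1 * p$1 + p$2 * p$2 + p$3 * p$3 + p$4 * p$4 = 1" using assms by (simp add: S3_iff)
  then show ?thesis
    using exhaust_4[of c] by (auto simp: vec_eq_iff forall_4 sum_3 axis_def algebra_simps)
qed

text \<open>The coordinate sum over derivative directions is rewritten in the orthonormal basis of p
  and the frame. The radial term drops out since \<open>cross4 p p\<close> vanishes, so only
  tangential derivatives of the extension Y remain.\<close>

lemma curl_S3_frame:
  assumes A: "(Y has_derivative A) (at p)" and p: "p \<in> S3"
  shows "curl_S3 Y p = (\<Sum>b\<in>UNIV. cross4 p (JM s b *v p) (A (JM s b *v p)))"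
proof -
  interpret A: bounded_linear A using A by (rule has_derivative_bounded_linear)
  have "A (axis c 1) = p$c *\<^sub>R A p + (\<Sum>b\<in>UNIV. ((JM s b *v p) $ c) *\<^sub>R A (JM s b *v p))" for c
    unfolding axis_frame[OF p, of c] by (simp only: A.add A.scaleR A.sum)
  then have A_axis: "A (axis c 1) $ k = of_real (p$c) * A p $ k + (\<Sum>b\<in>UNIV. of_real ((JM s b *v p) $ c) * A (JM s b *v p) $ k)" for c k
    by (simp only: vector_add_component vector_scaleR_component sum_component) (simp add: scaleR_conv_of_real)
  then have "curl_S3 Y p = cross4 p p (A p) + (\<Sum>b\<in>UNIV. cross4 p (JM s b *v p) (A (JM s b *v p)))"
    unfolding curl_S3_def frechet_derivative_at[OF A, symmetric] cross4_def
    by (simp add: vec_eq_iff sum_3 sum.distrib ring_distribs mult_ac)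
  moreover have "cross4 p p (A p) = 0"
    by (simp add: vec_eq_iff forall_4 cross4_nth)
  ultimately show ?thesis by simp
qed

text \<open>At \<open>axis 1 1\<close> the frame is minus the other axes whatever s is, so it is
  negatively oriented for both signs. This is the origin of the minus sign before the derivatives in
  \<open>CC\<close>.\<close>

lemma cross4_frame:
  assumes "p \<in> S3"
  shows "cross4 p (JM s 1 *v p) (emb (JM s 2 *v p)) = - emb (JM s 3 *v p)"
    "cross4 p (JM s 2 *v p) (emb (JM s 3 *v p)) = - emb (JM s 1 *v p)"
    "cross4 p (JM s 3 *v p) (emb (JM s 1 *v p)) = - emb (JM s 2 *v p)"
    "cross4 p (JM s 2 *v p) (emb (JM s 1 *v p)) = emb (JM s 3 *v p)"
    "cross4 p (JM s 3 *v p) (emb (JM s 2 *v p)) = emb (JM s 1 *v p)"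
    "cross4 p (JM s 1 *v p) (emb (JM s 3 *v p)) = emb (JM s 2 *v p)"
proof -
  have s: "s = 1 \<or> s = -1" using ss square_eq_1_iff by blast
  have "p$1 * p$1 + p$2 * p$2 + p$3 * p$3 + p$4 * p$4 = 1" using assms by (simp add: S3_iff)
  \<comment> \<open>Eliminating the square of the first coordinate brings polynomials in p to a
    normal form on the sphere.\<close>
  then have "p$1 * p$1 = 1 - p$2 * p$2 - p$3 * p$3 - p$4 * p$4" by linarith
  then have p: "complex_of_real (p$1) * p$1 = 1 - p$2 * p$2 - p$3 * p$3 - p$4 * p$4"
    by (metis of_real_1 of_real_diff of_real_mult)
  have p': "complex_of_real (p$1) * (p$1 * x) = (1 - p$2 * p$2 - p$3 * p$3 - p$4 * p$4) * x" for x :: complex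
    unfolding p[symmetric] by (simp only: mult.assoc)
  show "cross4 p (JM s 1 *v p) (emb (JM s 2 *v p)) = - emb (JM s 3 *v p)"
    "cross4 p (JM s 2 *v p) (emb (JM s 3 *v p)) = - emb (JM s 1 *v p)"
    "cross4 p (JM s 3 *v p) (emb (JM s 1 *v p)) = - emb (JM s 2 *v p)"
    "cross4 p (JM s 2 *v p) (emb (JM s 1 *v p)) = emb (JM s 3 *v p)"
    "cross4 p (JM s 3 *v p) (emb (JM s 2 *v p)) = emb (JM s 1 *v p)"
    "cross4 p (JM s 1 *v p) (emb (JM s 3 *v p)) = emb (JM s 2 *v p)"
    using s by (auto simp: vec_eq_iff forall_4 cross4_nth algebra_simps p p')
qed

section \<open>Fields in terms of their frame coefficients\<close>

definition toX :: "(real^4 \<Rightarrow> complex^3) \<Rightarrow> real^4 \<Rightarrow> complex^4" where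
  "toX u = (\<lambda>p. \<Sum>a\<in>UNIV. (u p $ a) *s emb (JM s a *v p))"

text \<open>Curl on the coefficients of a field in the frame JM s 1 p, JM s 2 p, JM s 3 p.\<close>
definition CC :: "(real^4 \<Rightarrow> complex^3) \<Rightarrow> real^4 \<Rightarrow> complex^3" where
  "CC u = (\<lambda>p. vector
     [of_real (2 * s) * u p $ 1 - (d 2 (cp 3 u) p - d 3 (cp 2 u) p),
      of_real (2 * s) * u p $ 2 - (d 3 (cp 1 u) p - d 1 (cp 3 u) p),
      of_real (2 * s) * u p $ 3 - (d 1 (cp 2 u) p - d 2 (cp 1 u) p)])"

lemma rot_vector_derivative_emb:
  "((\<lambda>t. emb (JM s a *v rot b t p) $ i) has_vector_derivative emb (JM s a *v (JM s b *v p)) $ i) (at 0)"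
proof -
  have "((\<lambda>p. complex_of_real ((JM s a *v p) $ i)) has_derivative (\<lambda>p. complex_of_real ((JM s a *v p) $ i))) (at (rot b 0 p))"
    by (rule bounded_linear_imp_has_derivative bounded_linear_compose[OF bounded_linear_of_real bounded_linear_JM_nth])+
  from rot_chain[OF this] show ?thesis by simp
qed

text \<open>The flow of J_b stays on S^3, where Y is the frame combination with coefficients u. Its
  derivative along the flow therefore follows from the Leibniz rule for that combination, although Y
  is otherwise an arbitrary extension.\<close>

lemma derivative_toX:
  assumes u: "u \<in> VF" and p: "p \<in> S3" and Y: "\<And>p. p \<in> S3 \<Longrightarrow> Y p = toX u p" and A: "(Y has_derivative A) (at p)"
  shows "A (JM s b *v p) = (\<Sum>a\<in>UNIV. d b (cp a u) p *s emb (JM s a *v p) + (u p $ a) *s emb (JM s a *v (JM s b *v p)))"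
proof -
  have c: "cp a u \<in> SF" for a using u by (simp add: VF_def)
  have "((\<lambda>t. Y (rot b t p) $ i) has_vector_derivative A (JM s b *v p) $ i) (at 0)" for i
    using rot_chain[of Y A b 0 p] A bounded_linear.has_vector_derivative[OF bounded_linear_vec_nth] by fastforce
  moreover have "((\<lambda>t. \<Sum>a\<in>UNIV. cp a u (rot b t p) * emb (JM s a *v rot b t p) $ i) has_vector_derivative
      (\<Sum>a\<in>UNIV. cp a u (rot b 0 p) * emb (JM s a *v (JM s b *v p)) $ i + d b (cp a u) p * emb (JM s a *v rot b 0 p) $ i)) (at 0)" for i
    by (intro has_vector_derivative_sum has_vector_derivative_mult d_has_vector_derivative_0 rot_vector_derivative_emb c)
  moreover have "Y (rot b t p) $ i = (\<Sum>a\<in>UNIV. cp a u (rot b t p) * emb (JM s a *v rot b t p) $ i)" for t i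
    using p by (simp add: Y toX_def)
  ultimately have "A (JM s b *v p) $ i = (\<Sum>a\<in>UNIV. cp a u (rot b 0 p) * emb (JM s a *v (JM s b *v p)) $ i + d b (cp a u) p * emb (JM s a *v rot b 0 p) $ i)" for i
    using vector_derivative_unique_at by fastforce
  then show ?thesis by (simp add: vec_eq_iff add.commute)
qed

lemma emb_scale: "emb (c *\<^sub>R v) = of_real c *s emb v" by (simp add: vec_eq_iff)
lemma emb_sum: "emb (sum f I) = (\<Sum>i\<in>I. emb (f i))" by (simp add: vec_eq_iff)

lemma JM_products:
  "JM s 1 *v (JM s 2 *v p) = (-s) *\<^sub>R (JM s 3 *v p)" "JM s 2 *v (JM s 3 *v p) = (-s) *\<^sub>R (JM s 1 *v p)"
  "JM s 3 *v (JM s 1 *v p) = (-s) *\<^sub>R (JM s 2 *v p)" "JM s 2 *v (JM s 1 *v p) = s *\<^sub>R (JM s 3 *v p)"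
  "JM s 3 *v (JM s 2 *v p) = s *\<^sub>R (JM s 1 *v p)" "JM s 1 *v (JM s 3 *v p) = s *\<^sub>R (JM s 2 *v p)"
  by (auto simp: vec_eq_iff forall_4 ss)

text \<open>Differentiating the coefficients gives the first-order part of \<open>CC\<close>.
  Differentiating the frame fields gives the term 2 s u: for each of them two of the three vector
  products contribute s, so every frame field is itself an eigenfield for 2 s.\<close>

lemma curl_toX:
  assumes u: "u \<in> VF" and p: "p \<in> S3" and Y: "\<And>p. p \<in> S3 \<Longrightarrow> Y p = toX u p" and sm: "smooth Y"
  shows "curl_S3 Y p = toX (CC u) p"
proof -
  note A = smooth_has_derivative[OF sm, of p]
  have D: "frechet_derivative Y (at p) (JM s b *v p)
      = (\<Sum>a\<in>UNIV. d b (cp a u) p *s emb (JM s a *v p) + (u p $ a) *s emb (JM s a *v (JM s b *v p)))" for b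
    by (rule derivative_toX[OF u p _ A]) (rule Y)
  show ?thesis
    unfolding curl_S3_frame[OF A p] D sum_3 JM_products JM_sq emb_scale
      cross4_add cross4_smult cross4_frame[OF p] cross4_self toX_def CC_def vector_3 vec_eq_iff
      vector_add_component vector_smult_component vector_uminus_component zero_index of_real_minus
    by (intro allI) (simp add: ring_distribs mult_ac)
qed

lemma frame_orthonormal:
  assumes "p \<in> S3"
  shows "(\<Sum>i\<in>UNIV. (\<Sum>a\<in>UNIV. c a *s emb (JM s a *v p)) $ i * of_real ((JM s b *v p) $ i)) = c b"
    "(\<Sum>i\<in>UNIV. (\<Sum>a\<in>UNIV. c a *s emb (JM s a *v p)) $ i * of_real (p $ i)) = 0"
proof -
  have ip: "(\<Sum>i\<in>UNIV. v $ i * w $ i) = v \<bullet> w" for v w :: "real^4" by (simp add: inner_vec_def)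
  have S: "p$1 * p$1 + p$2 * p$2 + p$3 * p$3 + p$4 * p$4 = 1" using assms by (simp add: S3_iff)
  have J: "(JM s a *v p) \<bullet> (JM s b *v p) = (if a = b then 1 else 0)" "(JM s a *v p) \<bullet> p = 0" for a b
    using exhaust_3[of a] exhaust_3[of b] ss S by (auto simp: inner_vec_def sum_4 algebra_simps)
  have e: "(\<Sum>i\<in>UNIV. (\<Sum>a\<in>UNIV. c a *s emb (JM s a *v p)) $ i * of_real (w $ i)) = (\<Sum>a\<in>UNIV. c a * of_real ((JM s a *v p) \<bullet> w))" for w
    unfolding ip[symmetric] by (simp add: sum_distrib_left sum_distrib_right mult.assoc) (rule sum.swap)
  show "(\<Sum>i\<in>UNIV. (\<Sum>a\<in>UNIV. c a *s emb (JM s a *v p)) $ i * of_real ((JM s b *v p) $ i)) = c b"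
    unfolding e J by (simp add: if_distrib[of "\<lambda>x. _ * x"] if_distrib[of of_real] cong: if_cong)
  show "(\<Sum>i\<in>UNIV. (\<Sum>a\<in>UNIV. c a *s emb (JM s a *v p)) $ i * of_real (p $ i)) = 0"
    unfolding e J by simp
qed

lemma toX_coefficient:
  assumes "p \<in> S3"
  shows "(\<Sum>i\<in>UNIV. toX u p $ i * of_real ((JM s b *v p) $ i)) = u p $ b"
  unfolding toX_def by (rule frame_orthonormal(1)[OF assms])

lemma toX_eq_iff: "p \<in> S3 \<Longrightarrow> toX u p = toX v p \<longleftrightarrow> u p = v p"
proof
  assume "p \<in> S3" "toX u p = toX v p"
  then have "u p $ b = v p $ b" for b using toX_coefficient[of p u b] toX_coefficient[of p v b] by simp
  then show "u p = v p" by (simp add: vec_eq_iff)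
qed (simp add: toX_def)

lemma tangent_expansion:
  assumes "p \<in> S3" "(\<Sum>i\<in>UNIV. w $ i * of_real (p $ i)) = 0"
  shows "(\<Sum>a\<in>UNIV. (\<Sum>i\<in>UNIV. w $ i * of_real ((JM s a *v p) $ i)) *s emb (JM s a *v p)) = w"
proof -
  have *: "w $ c = (\<Sum>a\<in>UNIV. of_real ((JM s a *v p) $ c) * (\<Sum>i\<in>UNIV. w $ i * of_real ((JM s a *v p) $ i)))" for c
  proof -
    have "w $ c = (\<Sum>i\<in>UNIV. if i = c then w $ i else 0)" by simp
    also have "\<dots> = (\<Sum>i\<in>UNIV. w $ i * of_real (axis c 1 $ i))"
      by (intro sum.cong refl) (simp add: axis_def)
    also have "\<dots> = (\<Sum>i\<in>UNIV. w $ i * of_real (p$c * p$i + (\<Sum>a\<in>UNIV. (JM s a *v p) $ c * (JM s a *v p) $ i)))"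
      unfolding axis_frame[OF assms(1), of c]
      by (simp only: vector_add_component vector_scaleR_component sum_component real_scaleR_def)
    also have "\<dots> = of_real (p$c) * (\<Sum>i\<in>UNIV. w $ i * of_real (p $ i))
        + (\<Sum>a\<in>UNIV. of_real ((JM s a *v p) $ c) * (\<Sum>i\<in>UNIV. w $ i * of_real ((JM s a *v p) $ i)))"
      unfolding sum_3 of_real_add of_real_mult ring_distribs sum.distrib sum_distrib_left
      by (simp only: mult_ac)
    finally show ?thesis using assms(2) by simp
  qed
  show ?thesis (is "?l = w")
  proof (subst vec_eq_iff, intro allI)
    fix c
    have "?l $ c = (\<Sum>a\<in>UNIV. of_real ((JM s a *v p) $ c) * (\<Sum>i\<in>UNIV. w $ i * of_real ((JM s a *v p) $ i)))"
      by (simp only: sum_component vector_smult_component emb_nth mult.commute)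
    then show "?l $ c = w $ c" by (simp only: *[symmetric])
  qed
qed

definition cR :: "real^4^4 \<Rightarrow> complex^3^3" where
  "cR g = (\<chi> b a. of_real (R g $ b $ a))"

definition EU :: "(real^4^4) set \<Rightarrow> real \<Rightarrow> (real^4 \<Rightarrow> complex^3) set" where
  "EU G lam = {u \<in> VF \<inter> EQ G cR. CC u = (\<lambda>p. of_real lam *s u p)}"

lemma CC_VF: assumes "u \<in> VF" shows "CC u \<in> VF"
proof -
  have c: "cp a u \<in> SF" for a using assms by (simp add: VF_def)
  have "cp 1 (CC u) = K (of_real (2 * s)) * cp 1 u - (d 2 (cp 3 u) - d 3 (cp 2 u))"
    "cp 2 (CC u) = K (of_real (2 * s)) * cp 2 u - (d 3 (cp 1 u) - d 1 (cp 3 u))"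
    "cp 3 (CC u) = K (of_real (2 * s)) * cp 3 u - (d 1 (cp 2 u) - d 2 (cp 1 u))"
    by (simp_all add: fun_eq_iff CC_def)
  then have "cp a (CC u) \<in> SF" for a
    using exhaust_3[of a] by (auto intro!: SF_diff SF_K_mult d_SF c)
  then show ?thesis by (simp add: VF_def)
qed

lemma cmat_toX:
  assumes "orthogonal_matrix g" "det g = 1"
  shows "cmat g *v toX u p = toX (\<lambda>_. cR g *v u p) (g *v p)"
proof -
  have emb: "cmat g *v emb v = emb (g *v v)" for v
    by (simp add: vec_eq_iff cmat_def matrix_vector_mult_def)
  have "cmat g *v toX u p = (\<Sum>a\<in>UNIV. (u p $ a) *s emb (g *v (JM s a *v p)))"
    unfolding toX_def sum_3 by (simp only: matrix_vector_right_distrib vector_scalar_commute emb)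
  also have "\<dots> = (\<Sum>a\<in>UNIV. (u p $ a) *s (\<Sum>b\<in>UNIV. of_real (R g $ b $ a) *s emb (JM s b *v (g *v p))))"
    by (simp only: JM_intertwine[OF assms] emb_sum emb_scale)
  also have "\<dots> = (\<Sum>b\<in>UNIV. (cR g *v u p) $ b *s emb (JM s b *v (g *v p)))"
    by (simp add: vec_eq_iff sum_3 cR_def matrix_vector_mult_def algebra_simps del: JM_mv)
  finally show ?thesis by (simp only: toX_def)
qed

lemma toX_equivariant:
  assumes "orthogonal_matrix g" "det g = 1" "p \<in> S3"
  shows "toX u (g *v p) = cmat g *v toX u p \<longleftrightarrow> u (g *v p) = cR g *v u p"
  unfolding cmat_toX[OF assms(1,2)] using assms by (subst toX_eq_iff) auto

lemma toX_outside: "u \<in> VF \<Longrightarrow> p \<notin> S3 \<Longrightarrow> toX u p = 0"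
  by (simp add: toX_def VF_outside)

text \<open>Smoothness transfers in both directions because the frame fields are linear on R^4: an
  extension of X is contracted with them to extend the coefficients, and extensions of the
  coefficients are combined with them to extend X.\<close>

lemma curl_eigenspace_frame:
  assumes G: "\<And>g. g \<in> G \<Longrightarrow> orthogonal_matrix g \<and> det g = 1"
  shows "curl_eigenspace G lam = toX ` EU G lam"
proof (intro equalityI subsetI)
  fix X assume "X \<in> curl_eigenspace G lam"
  then obtain Y where X0: "\<And>p. p \<notin> S3 \<Longrightarrow> X p = 0" and Y: "smooth Y" "\<And>p. p \<in> S3 \<Longrightarrow> X p = Y p"
      and tan: "\<And>p. p \<in> S3 \<Longrightarrow> (\<Sum>i\<in>UNIV. X p $ i * of_real (p $ i)) = 0"
      and eig: "\<And>p. p \<in> S3 \<Longrightarrow> curl_S3 Y p = of_real lam *s Y p"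
      and inv: "\<And>g p. g \<in> G \<Longrightarrow> p \<in> S3 \<Longrightarrow> X (g *v p) = cmat g *v X p"
    unfolding curl_eigenspace_def by blast
  define u :: "real^4 \<Rightarrow> complex^3" where
    "u = (\<lambda>p. if p \<in> S3 then (\<chi> a. \<Sum>i\<in>UNIV. X p $ i * of_real ((JM s a *v p) $ i)) else 0)"
  have toX: "toX u = X"
    using tangent_expansion[OF _ tan] X0 by (auto simp: fun_eq_iff toX_def u_def)
  have "cp a u = rS (\<lambda>p. \<Sum>i\<in>UNIV. Y p $ i * of_real ((JM s a *v p) $ i))" for a
    by (auto simp: fun_eq_iff u_def rS_def Y(2))
  moreover have "smooth (\<lambda>p. \<Sum>i\<in>UNIV. Y p $ i * complex_of_real ((JM s a *v p) $ i))" for a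
    by (intro smooth_sum finite smooth_mult smooth_nth Y(1) smooth_linear[OF
          bounded_linear_compose[OF bounded_linear_of_real bounded_linear_JM_nth]])
  ultimately have u: "u \<in> VF" by (simp add: VF_def SF_rS)
  have "CC u p = of_real lam *s u p" for p
  proof (cases "p \<in> S3")
    case True
    have "toX (CC u) p = of_real lam *s toX u p"
    proof -
      have "curl_S3 Y p = toX (CC u) p"
        by (rule curl_toX[OF u True _ Y(1)]) (simp add: toX Y(2))
      then show ?thesis using eig[OF True] by (simp add: toX Y(2)[OF True])
    qed
    also have "\<dots> = toX (\<lambda>p. of_real lam *s u p) p"
      by (simp add: toX_def vec_eq_iff sum_distrib_left mult.assoc)
    finally show ?thesis unfolding toX_eq_iff[OF True] .
  next
    case False
    then show ?thesis using VF_outside[OF u] VF_outside[OF CC_VF[OF u]] by simp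
  qed
  moreover have "u \<in> EQ G cR"
    using inv toX_equivariant[of _ _ u] G unfolding EQ_def toX by blast
  ultimately have "u \<in> EU G lam" using u by (auto simp: EU_def)
  then show "X \<in> toX ` EU G lam" using toX by blast
next
  fix X assume "X \<in> toX ` EU G lam"
  then obtain u where X: "X = toX u" and u: "u \<in> VF" "u \<in> EQ G cR" "CC u = (\<lambda>p. of_real lam *s u p)"
    by (auto simp: EU_def)
  have "\<forall>a. \<exists>F. smooth F \<and> cp a u = rS F" using u(1) by (auto simp: VF_def SF_def)
  then obtain F where F: "\<And>a. smooth (F a)" "\<And>a. cp a u = rS (F a)" by metis
  define Y where "Y = (\<lambda>p. \<Sum>a\<in>UNIV. F a p *s emb (JM s a *v p))"
  have "smooth Y"
    unfolding Y_def
    by (rule smooth_vec, simp only: sum_component vector_smult_component emb_nth)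
      (intro smooth_sum finite smooth_mult F smooth_linear[OF
          bounded_linear_compose[OF bounded_linear_of_real bounded_linear_JM_nth]])
  moreover have Y: "Y p = toX u p" if "p \<in> S3" for p
    using that F(2)[unfolded fun_eq_iff, rule_format, of _ p] by (simp add: Y_def toX_def rS_def)
  moreover have "curl_S3 Y p = of_real lam *s Y p" if "p \<in> S3" for p
  proof -
    have "curl_S3 Y p = toX (CC u) p"
      by (rule curl_toX[OF u(1) that _ \<open>smooth Y\<close>]) (rule Y)
    then show ?thesis
      unfolding Y[OF that] u(3) by (simp add: toX_def vec_eq_iff sum_distrib_left mult.assoc)
  qed
  moreover have "(\<Sum>i\<in>UNIV. toX u p $ i * of_real (p $ i)) = 0" if "p \<in> S3" for p
    unfolding toX_def by (rule frame_orthonormal(2)[OF that])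
  moreover have "toX u (g *v p) = cmat g *v toX u p" if "g \<in> G" "p \<in> S3" for g p
    using toX_equivariant[of g p u] G[OF that(1)] that u(2) by (auto simp: EQ_def)
  ultimately show "X \<in> curl_eigenspace G lam"
    unfolding curl_eigenspace_def X using toX_outside[OF u(1)] by (intro CollectI conjI exI[of _ Y]) auto
qed

end

section \<open>Integration over the sphere\<close>

text \<open>Boxes determine Lebesgue measure, and the preimage of a box is its image under the
  inverse isometry, which has the same volume.\<close>

lemma distr_lborel_orthogonal:
  fixes f :: "real^4 \<Rightarrow> real^4"
  assumes f: "orthogonal_transformation f"
  shows "distr lborel borel f = lborel"
proof (rule lborel_eqI[symmetric])
  have lin: "linear f" using f by (rule orthogonal_transformation_linear)
  have meas: "f \<in> borel_measurable borel"
    using lin by (intro borel_measurable_continuous_onI linear_continuous_on) (simp add: linear_conv_bounded_linear)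
  obtain g where g: "orthogonal_transformation g" "\<And>x. g (f x) = x" "\<And>x. f (g x) = x"
  proof -
    have "bij f" using f by (rule orthogonal_transformation_bij)
    then show ?thesis
      using that[of "inv f"] orthogonal_transformation_inv[OF f]
      by (auto simp: bij_is_inj bij_is_surj surj_f_inv_f)
  qed
  fix l u :: "real^4" assume "\<And>b. b \<in> Basis \<Longrightarrow> l \<bullet> b \<le> u \<bullet> b"
  then have *: "emeasure lborel (box l u) = ennreal (\<Prod>b\<in>Basis. (u - l) \<bullet> b)"
    by (simp add: emeasure_lborel_box)
  have img: "f -` box l u = g ` box l u" using g(2,3) by (auto simp: image_iff) metis
  have lm: "box l u \<in> lmeasurable" by simp
  have sets: "g ` box l u \<in> sets borel"
    using measurable_sets[OF meas, of "box l u"] by (simp add: img)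
  have "emeasure (distr lborel borel f) (box l u) = emeasure lborel (g ` box l u)"
    using meas by (simp add: emeasure_distr img)
  also have "\<dots> = emeasure lebesgue (g ` box l u)" using sets by simp
  also have "\<dots> = ennreal (measure lebesgue (g ` box l u))"
    using measurable_orthogonal_image[OF g(1) lm] by (simp add: emeasure_eq_measure2)
  also have "\<dots> = ennreal (measure lebesgue (box l u))"
    by (simp only: measure_orthogonal_image[OF g(1) lm])
  also have "\<dots> = emeasure lebesgue (box l u)" using lm by (simp add: emeasure_eq_measure2)
  also have "\<dots> = emeasure lborel (box l u)" by simp
  finally show "emeasure (distr lborel borel f) (box l u) = (\<Prod>b\<in>Basis. (u - l) \<bullet> b)"
    using * by simp
qed simp

definition nrm :: "real^4 \<Rightarrow> real^4" where "nrm x = inverse (norm x) *\<^sub>R x"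

definition Bl :: "(real^4) set" where "Bl = ball 0 1"

text \<open>Up to a constant factor the integral over S^3, in polar form: f is extended radially to the unit ball.\<close>
definition sint :: "(real^4 \<Rightarrow> complex) \<Rightarrow> complex" where
  "sint f = (LINT x|lborel. indicator Bl x *\<^sub>R f (nrm x))"

lemma nrm_S3: "x \<noteq> 0 \<Longrightarrow> nrm x \<in> S3" by (simp add: nrm_def S3_def)
lemma nrm_0 [simp]: "nrm 0 = 0" by (simp add: nrm_def)
lemma zero_notin_S3 [simp]: "0 \<notin> S3" by (simp add: S3_def)

lemma SF_nrm_measurable:
  assumes "f \<in> SF" shows "(\<lambda>x. f (nrm x)) \<in> borel_measurable lborel"
proof -
  obtain F where F: "smooth F" "f = rS F" using assms by (auto simp: SF_def)
  have "(\<lambda>x. f (nrm x)) = (\<lambda>x. if x = 0 then 0 else F (nrm x))"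
    using nrm_S3 by (auto simp: F rS_def fun_eq_iff)
  moreover have "F \<in> borel_measurable borel"
    by (intro borel_measurable_continuous_onI smooth_continuous F)
  moreover have "nrm \<in> borel_measurable borel" unfolding nrm_def[abs_def] by measurable
  ultimately show ?thesis by simp
qed

lemma Bl_emeasure: "emeasure lborel Bl < \<infinity>" "Bl \<in> sets lborel"
  unfolding Bl_def using emeasure_lborel_ball_finite[of 0 1] by auto

lemma SF_integrable:
  assumes "f \<in> SF" shows "integrable lborel (\<lambda>x. indicator Bl x *\<^sub>R f (nrm x))"
proof -
  obtain B where "\<And>p. norm (f p) \<le> B" using SF_bounded[OF assms] by blast
  then show ?thesis
    by (intro integrableI_bounded_set_indicator[where B = B] Bl_emeasure SF_nrm_measurable assms) auto
qed

lemma sint_add: "f \<in> SF \<Longrightarrow> g \<in> SF \<Longrightarrow> sint (f + g) = sint f + sint g"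
  unfolding sint_def by (simp add: scaleR_add_right SF_integrable)

lemma sint_K: "sint (K c * f) = c * sint f"
  unfolding sint_def by (simp flip: mult_scaleR_right)

lemma sint_0 [simp]: "sint 0 = 0" by (simp add: sint_def)

lemma sint_minus: "sint (- f) = - sint f" by (simp add: sint_def)

lemma sint_diff: "f \<in> SF \<Longrightarrow> g \<in> SF \<Longrightarrow> sint (f - g) = sint f - sint g"
  using sint_add[of f "- g"] SF_minus[of g] by (simp add: sint_minus)

lemma sint_sum: "(\<And>i. i \<in> I \<Longrightarrow> f i \<in> SF) \<Longrightarrow> sint (\<Sum>i\<in>I. f i) = (\<Sum>i\<in>I. sint (f i))"
  by (induction I rule: infinite_finite_induct) (auto simp: sint_add SF_sum)

lemma sint_cnj: "sint (\<lambda>p. cnj (f p)) = cnj (sint f)"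
  unfolding sint_def by (simp flip: Bochner_Integration.integral_cnj)

lemma sint_norm_le:
  assumes "f \<in> SF" "\<And>p. p \<in> S3 \<Longrightarrow> norm (f p) \<le> B" "0 \<le> B"
  shows "norm (sint f) \<le> B * measure lborel Bl"
proof -
  have b: "norm (f p) \<le> B" for p using assms SF_outside[OF assms(1), of p] by (cases "p \<in> S3") auto
  have "norm (sint f) \<le> (LINT x|lborel. norm (indicator Bl x *\<^sub>R f (nrm x)))"
    unfolding sint_def by (rule integral_norm_bound)
  also have "\<dots> \<le> (LINT x|lborel. indicator Bl x *\<^sub>R B)"
    using Bl_emeasure b by (intro integral_mono integrable_norm SF_integrable assms(1)) (auto intro!: mult_left_mono)
  also have "\<dots> = B * measure lborel Bl" using Bl_emeasure by simp
  finally show ?thesis .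
qed

text \<open>If f does not vanish at some point of S^3, its radial extension is nonzero on a nonempty
  open subset of the ball, which is not negligible, whereas a vanishing integral of |f|^2 makes f
  zero almost everywhere.\<close>

lemma SF_eq_0I:
  assumes f: "f \<in> SF" and 0: "sint (f * (\<lambda>p. cnj (f p))) = 0"
  shows "f = 0"
proof (rule ccontr)
  assume "f \<noteq> 0"
  then obtain p where p: "f p \<noteq> 0" by (auto simp: fun_eq_iff)
  then have pS: "p \<in> S3" using SF_outside[OF f] by blast
  obtain F where F: "smooth F" "f = rS F" using f by (auto simp: SF_def)
  let ?h = "\<lambda>x. indicator Bl x *\<^sub>R (norm (f (nrm x)))\<^sup>2"
  have eq: "indicator Bl x *\<^sub>R (f * (\<lambda>p. cnj (f p))) (nrm x) = complex_of_real (?h x)" for x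
    by (simp add: complex_norm_square[symmetric] scaleR_conv_of_real del: of_real_power)
  have "integrable lborel (\<lambda>x. complex_of_real (?h x))"
    using SF_integrable[OF SF_mult[OF f SF_cnj[OF f]]] unfolding eq .
  then have int: "integrable lborel ?h" by (simp only: complex_of_real_integrable_eq)
  have "complex_of_real (LINT x|lborel. ?h x) = 0"
    using 0 unfolding sint_def eq by (simp only: integral_complex_of_real)
  then have ae: "AE x in lborel. ?h x = 0"
    using integral_nonneg_eq_0_iff_AE[OF int] by simp
  define U where "U = {x \<in> Bl - {0}. F (nrm x) \<noteq> 0}"
  have "continuous_on (Bl - {0}) (\<lambda>x. F (nrm x))"
    unfolding nrm_def by (intro continuous_on_compose2[OF smooth_continuous[OF F(1)]] continuous_intros) auto
  moreover have "open (Bl - {0})" unfolding Bl_def by auto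
  moreover have "U = (Bl - {0}) \<inter> (\<lambda>x. F (nrm x)) -` (- {0})" by (auto simp: U_def)
  ultimately have "open U" using open_Compl[of "{0::complex}"] by (simp only: continuous_on_open_vimage Int_commute) simp
  \<comment> \<open>The midpoint of the radius through p lies in the open ball and projects back to
    p.\<close>
  moreover have "(1/2) *\<^sub>R p \<in> U"
  proof -
    have n: "norm p = 1" using pS by (simp add: S3_def)
    then have "p \<noteq> 0" by auto
    with n have "nrm ((1/2) *\<^sub>R p) = p" by (simp add: nrm_def)
    with n p \<open>p \<noteq> 0\<close> pS show ?thesis by (simp add: U_def Bl_def F rS_def)
  qed
  ultimately have "\<not> negligible U" using open_not_negligible by blast
  moreover have "negligible U"
  proof -
    have "AE x in lborel. x \<notin> U"
      using ae
    proof eventually_elim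
      case (elim x)
      then show ?case using nrm_S3[of x] by (cases "x = 0") (auto simp: U_def F rS_def indicator_def)
    qed
    then have "AE x in lebesgue. x \<notin> U" by (rule AE_completion)
    then show ?thesis by (simp add: negligible_iff_null_sets AE_iff_null_sets[symmetric] \<open>open U\<close> borel_open)
  qed
  ultimately show False by blast
qed

section \<open>Rotation invariance and integration by parts\<close>

context frame
begin

lemma rot_orthogonal: "orthogonal_transformation (rot a t)"
proof -
  have "linear (rot a t)"
    by (auto simp: linear_iff rot_def matrix_vector_right_distrib matrix_vector_mult_scaleR algebra_simps)
  moreover have "norm (rot a t p) = norm p" for p
  proof (cases "p = 0")
    case True
    then show ?thesis by (simp add: rot_def)
  next
    case False
    have "rot a t (nrm p) \<in> S3" using nrm_S3[OF False] by simp
    moreover have "rot a t (nrm p) = inverse (norm p) *\<^sub>R rot a t p"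
      by (simp add: rot_def nrm_def matrix_vector_mult_scaleR scaleR_add_right mult.commute)
    ultimately show ?thesis using False by (simp add: S3_def field_simps)
  qed
  ultimately show ?thesis by (simp add: orthogonal_transformation)
qed

lemma norm_rot [simp]: "norm (rot a t p) = norm p"
  using rot_orthogonal by (simp add: orthogonal_transformation)

lemma nrm_rot: "nrm (rot a t p) = rot a t (nrm p)"
  by (simp add: nrm_def) (simp add: rot_def matrix_vector_mult_scaleR scaleR_add_right mult.commute)

lemma rot_measurable: "rot a t \<in> lborel \<rightarrow>\<^sub>M borel"
proof -
  have "linear (rot a t)" using rot_orthogonal by (rule orthogonal_transformation_linear)
  then have "rot a t \<in> borel_measurable borel"
    by (intro borel_measurable_continuous_onI linear_continuous_on) (simp add: linear_conv_bounded_linear)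
  then show ?thesis by simp
qed

lemma Bl_rot: "indicator Bl (rot a t x) *\<^sub>R f (nrm (rot a t x)) = indicator Bl x *\<^sub>R f (rot a t (nrm x))"
  by (simp add: nrm_rot indicator_def Bl_def)

lemma rot_integrable:
  assumes "f \<in> SF" shows "integrable lborel (\<lambda>x. indicator Bl x *\<^sub>R f (rot a t (nrm x)))"
proof -
  have "integrable (distr lborel borel (rot a t)) (\<lambda>x. indicator Bl x *\<^sub>R f (nrm x))"
    unfolding distr_lborel_orthogonal[OF rot_orthogonal] by (rule SF_integrable[OF assms])
  from integrable_distr[OF rot_measurable this] show ?thesis by (simp only: Bl_rot)
qed

lemma sint_rot:
  assumes "f \<in> SF" shows "sint (\<lambda>p. f (rot a t p)) = sint f"
proof -
  have "sint f = (LINT x|distr lborel borel (rot a t). indicator Bl x *\<^sub>R f (nrm x))"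
    unfolding sint_def distr_lborel_orthogonal[OF rot_orthogonal] ..
  also have "\<dots> = (LINT x|lborel. indicator Bl (rot a t x) *\<^sub>R f (nrm (rot a t x)))"
    by (rule integral_distr[OF rot_measurable]) (use borel_measurable_integrable[OF SF_integrable[OF assms]] in simp)
  also have "\<dots> = sint (\<lambda>p. f (rot a t p))"
    unfolding sint_def by (simp only: Bl_rot)
  finally show ?thesis by simp
qed

text \<open>Bounds the difference quotients uniformly in t, as dominated convergence in
  \<open>sint_d\<close> requires.\<close>

lemma rot_difference_bound:
  assumes f: "f \<in> SF" and B: "\<And>p. norm (d a f p) \<le> B"
  shows "norm (f (rot a t p) - f p) \<le> B * \<bar>t\<bar>"
proof -
  have "norm (f (rot a t p) - f (rot a 0 p)) \<le> B * norm (t - 0)"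
  proof (rule differentiable_bound[of UNIV _ "\<lambda>t h. h *\<^sub>R d a f (rot a t p)"])
    show "((\<lambda>t. f (rot a t p)) has_derivative (\<lambda>h. h *\<^sub>R d a f (rot a x p))) (at x within UNIV)" for x
      using d_has_vector_derivative[OF f] by (simp add: has_vector_derivative_def)
    show "onorm (\<lambda>h. h *\<^sub>R d a f (rot a x p)) \<le> B" for x
      by (rule onorm_le) (simp add: mult.commute[of B] mult_left_mono B)
  qed auto
  then show ?thesis by simp
qed

text \<open>The integral of f along the flow is constant in t because the flow consists of
  isometries. Dominated convergence of the difference quotients differentiates under the integral.
  In other words, the frame fields are divergence free.\<close>

lemma sint_d:
  assumes f: "f \<in> SF" shows "sint (d a f) = 0"
proof (rule LIMSEQ_unique)
  define t where "t = (\<lambda>n. inverse (real (Suc n)))"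
  have t: "t n > 0" for n by (simp add: t_def)
  have t0: "t \<longlonglongrightarrow> 0" unfolding t_def by (rule LIMSEQ_inverse_real_of_nat)
  obtain B where B: "\<And>p. norm (d a f p) \<le> B" using SF_bounded[OF d_SF[OF f]] by blast
  have B0: "0 \<le> B" using B[of 0] norm_ge_zero order_trans by blast
  define q where "q = (\<lambda>n p. (1 / t n) *\<^sub>R (f (rot a (t n) p) - f p))"
  have lim: "(\<lambda>n. q n p) \<longlonglongrightarrow> d a f p" for p
  proof -
    have "((\<lambda>u. ((f (rot a u p) - f (rot a 0 p)) - (u - 0) *\<^sub>R d a f p) /\<^sub>R norm (u - 0)) \<longlongrightarrow> 0) (at 0)"
      using d_has_vector_derivative_0[OF f, of a p]
      by (simp add: has_vector_derivative_def has_derivative_at2 diff_diff_add inverse_eq_divide)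
    moreover have "filterlim t (at 0) sequentially"
      using t0 t by (intro filterlim_atI) (auto intro!: always_eventually simp: less_imp_neq[THEN not_sym])
    ultimately have "(\<lambda>n. ((f (rot a (t n) p) - f (rot a 0 p)) - (t n - 0) *\<^sub>R d a f p) /\<^sub>R norm (t n - 0)) \<longlonglongrightarrow> 0"
      by (rule filterlim_compose)
    moreover have "((f (rot a (t n) p) - f (rot a 0 p)) - (t n - 0) *\<^sub>R d a f p) /\<^sub>R norm (t n - 0) = q n p - d a f p" for n
      using t[of n] by (simp add: q_def scaleR_diff_right divide_inverse)
    ultimately show ?thesis by (simp add: LIM_zero_iff)
  qed
  have qeq: "indicator Bl x *\<^sub>R q n (nrm x)
      = (1 / t n) *\<^sub>R (indicator Bl x *\<^sub>R f (rot a (t n) (nrm x)) - indicator Bl x *\<^sub>R f (nrm x))" for n x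
    by (simp add: q_def scaleR_diff_right mult.commute)
  have int: "integrable lborel (\<lambda>x. indicator Bl x *\<^sub>R q n (nrm x))" for n
    unfolding qeq by (intro integrable_scaleR_right impI Bochner_Integration.integrable_diff rot_integrable[OF f] SF_integrable[OF f])
  show "(\<lambda>n. LINT x|lborel. indicator Bl x *\<^sub>R q n (nrm x)) \<longlonglongrightarrow> sint (d a f)"
    unfolding sint_def
  proof (rule integral_dominated_convergence[where w = "\<lambda>x. indicator Bl x *\<^sub>R B"])
    show "integrable lborel (\<lambda>x. indicator Bl x *\<^sub>R B)" using Bl_emeasure by simp
    show "(\<lambda>x. indicator Bl x *\<^sub>R d a f (nrm x)) \<in> borel_measurable lborel"
      by (rule borel_measurable_integrable[OF SF_integrable[OF d_SF[OF f]]])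
    show "AE x in lborel. (\<lambda>n. indicator Bl x *\<^sub>R q n (nrm x)) \<longlonglongrightarrow> indicator Bl x *\<^sub>R d a f (nrm x)"
      by (intro always_eventually allI tendsto_scaleR tendsto_const lim)
    show "AE x in lborel. norm (indicator Bl x *\<^sub>R q n (nrm x)) \<le> indicator Bl x *\<^sub>R B" for n
    proof (intro always_eventually allI)
      fix x
      have "norm (q n (nrm x)) \<le> B"
        using rot_difference_bound[OF f B, of "t n" "nrm x"] t[of n]
        by (simp add: q_def divide_le_eq del: scaleR_right_diff_distrib scaleR_diff_right)
      then show "norm (indicator Bl x *\<^sub>R q n (nrm x)) \<le> indicator Bl x *\<^sub>R B"
        by (simp add: indicator_def)
    qed
    show "(\<lambda>x. indicator Bl x *\<^sub>R q n (nrm x)) \<in> borel_measurable lborel" for n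
      by (rule borel_measurable_integrable[OF int])
  qed
  have "(LINT x|lborel. indicator Bl x *\<^sub>R q n (nrm x)) = (1 / t n) *\<^sub>R (sint (\<lambda>p. f (rot a (t n) p)) - sint f)" for n
    unfolding qeq sint_def by (simp add: rot_integrable[OF f] SF_integrable[OF f])
  then show "(\<lambda>n. LINT x|lborel. indicator Bl x *\<^sub>R q n (nrm x)) \<longlonglongrightarrow> 0"
    by (simp add: sint_rot[OF f])
qed

text \<open>The nonnegative Laplacian of the round sphere: the frame is orthonormal and, by
  \<open>sint_d\<close>, its fields are divergence free, so no first-order terms appear.\<close>

definition Lap :: "(real^4 \<Rightarrow> complex) \<Rightarrow> real^4 \<Rightarrow> complex" where
  "Lap f = - (\<Sum>a\<in>UNIV. d a (d a f))"

text \<open>The carre du champ of - Lap.\<close>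
definition Gam :: "(real^4 \<Rightarrow> complex) \<Rightarrow> (real^4 \<Rightarrow> complex) \<Rightarrow> real^4 \<Rightarrow> complex" where
  "Gam f h = (\<Sum>a\<in>UNIV. d a f * d a h)"

lemma Lap_SF: "f \<in> SF \<Longrightarrow> Lap f \<in> SF"
  unfolding Lap_def by (intro SF_minus SF_sum d_SF)

lemma Lap_add: "f \<in> SF \<Longrightarrow> h \<in> SF \<Longrightarrow> Lap (f + h) = Lap f + Lap h"
  by (simp add: Lap_def d_add d_SF sum.distrib)

lemma Lap_K: "f \<in> SF \<Longrightarrow> Lap (K c * f) = K c * Lap f"
  by (simp add: Lap_def d_K_mult d_SF sum_distrib_left)

lemma Lap_diff: "f \<in> SF \<Longrightarrow> h \<in> SF \<Longrightarrow> Lap (f - h) = Lap f - Lap h"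
  by (simp add: Lap_def d_diff d_SF sum_subtractf)

lemma Lap_mult: "f \<in> SF \<Longrightarrow> h \<in> SF \<Longrightarrow> Lap (f * h) = Lap f * h + f * Lap h - 2 * Gam f h"
  by (simp add: Lap_def Gam_def sum_3 d_mult d_add d_SF SF_mult algebra_simps)

lemma Lap_cnj: "f \<in> SF \<Longrightarrow> Lap (\<lambda>p. cnj (f p)) = (\<lambda>p. cnj (Lap f p))"
  by (simp add: Lap_def fun_eq_iff d_cnj d_SF sum_3)

lemma Gam_add: "f \<in> SF \<Longrightarrow> h \<in> SF \<Longrightarrow> k \<in> SF \<Longrightarrow> Gam k (f + h) = Gam k f + Gam k h"
  by (simp add: Gam_def d_add sum.distrib distrib_left)

lemma Gam_K: "f \<in> SF \<Longrightarrow> Gam k (K c * f) = K c * Gam k f"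
  unfolding Gam_def by (simp only: d_K_mult sum_distrib_left mult.left_commute)

lemma Gam_mult: "f \<in> SF \<Longrightarrow> h \<in> SF \<Longrightarrow> Gam k (f * h) = f * Gam k h + h * Gam k f"
  by (simp add: Gam_def d_mult sum_distrib_left sum.distrib algebra_simps)

lemma sint_by_parts:
  assumes "f \<in> SF" "h \<in> SF" shows "sint (d a f * h) = - sint (f * d a h)"
proof -
  have "sint (f * d a h + d a f * h) = 0"
    using sint_d[OF SF_mult[OF assms], of a] by (simp add: d_mult assms)
  then show ?thesis using assms by (simp add: sint_add SF_mult d_SF eq_neg_iff_add_eq_0 add.commute)
qed

lemma sint_Lap:
  assumes "f \<in> SF" "h \<in> SF" shows "sint (Lap f * h) = sint (Gam f h)"
proof -
  have "sint (Lap f * h) = - (\<Sum>a\<in>UNIV. sint (d a (d a f) * h))"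
    using assms by (simp add: Lap_def sum_distrib_right sint_minus sint_sum SF_mult d_SF)
  also have "\<dots> = (\<Sum>a\<in>UNIV. sint (d a f * d a h))"
    using assms by (simp add: sint_by_parts d_SF sum_negf)
  also have "\<dots> = sint (Gam f h)"
    using assms by (simp add: Gam_def sint_sum SF_mult d_SF)
  finally show ?thesis .
qed

lemma sint_Lap_symmetric:
  assumes "f \<in> SF" "h \<in> SF" shows "sint (Lap f * h) = sint (f * Lap h)"
proof -
  have "Gam f h = Gam h f" by (simp add: Gam_def mult.commute)
  then show ?thesis using sint_Lap[OF assms] sint_Lap[OF assms(2,1)] by (simp add: mult.commute)
qed

end

section \<open>The Laplacian on polynomials\<close>

definition one :: "real^4 \<Rightarrow> complex" where "one = rS (\<lambda>p. 1)"

definition lf :: "complex^4 \<Rightarrow> real^4 \<Rightarrow> complex" where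
  "lf c = rS (\<lambda>p. \<Sum>i\<in>UNIV. c $ i * of_real (p $ i))"

lemma one_SF: "one \<in> SF" unfolding one_def by (rule SF_rS[OF smooth_const])

lemma lf_SF: "lf c \<in> SF"
  unfolding lf_def
  by (intro SF_rS smooth_sum finite smooth_mult smooth_const
      smooth_linear[OF bounded_linear_compose[OF bounded_linear_of_real bounded_linear_vec_nth]])

lemma one_mult: "f \<in> SF \<Longrightarrow> one * f = f"
  using SF_outside[of f] by (auto simp: one_def rS_def fun_eq_iff)

interpretation cs: vector_space "\<lambda>(c::complex) (f::real^4 \<Rightarrow> complex). K c * f"
  by unfold_locales (simp_all add: K_hom algebra_simps)

text \<open>FF n consists of the restrictions to S^3 of the homogeneous polynomials of degree n.\<close>
primrec FF :: "nat \<Rightarrow> (real^4 \<Rightarrow> complex) set" where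
  "FF 0 = cs.span {one}"
| "FF (Suc n) = cs.span {lf c * f |c f. f \<in> FF n}"

text \<open>Polynomials of degree n - k. The value {0} for k > n stands for negative degree, which
  truncated subtraction would turn into the constants.\<close>

definition FFm :: "nat \<Rightarrow> nat \<Rightarrow> (real^4 \<Rightarrow> complex) set" where
  "FFm n k = (if k \<le> n then FF (n - k) else {0})"

lemma SF_subspace: "cs.subspace SF"
  by (intro cs.subspaceI SF_zero SF_add SF_K_mult)

lemma FF_subspace: "cs.subspace (FF n)"
  by (cases n) (auto intro: cs.subspace_span)

lemma FFm_subspace: "cs.subspace (FFm n k)"
  by (auto simp: FFm_def FF_subspace cs.subspace_single_0)

lemma FF_SF: "FF n \<subseteq> SF"
proof (induction n)
  case 0
  show ?case unfolding FF.simps by (rule cs.span_minimal[OF _ SF_subspace]) (simp add: one_SF)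
next
  case (Suc n)
  then have "{lf c * f |c f. f \<in> FF n} \<subseteq> SF" by (auto intro: SF_mult lf_SF)
  then show ?case unfolding FF.simps by (rule cs.span_minimal[OF _ SF_subspace])
qed

lemma FF_lf: "f \<in> FF n \<Longrightarrow> lf c * f \<in> FF (Suc n)"
  unfolding FF.simps by (rule cs.span_base) blast

lemma FFm_lf: "f \<in> FFm n k \<Longrightarrow> lf c * f \<in> FFm (Suc n) k"
  using FF_lf[of f "n - k" c] cs.subspace_0[OF FFm_subspace, of "Suc n" k]
  by (cases "k \<le> n") (auto simp: FFm_def Suc_diff_le)

text \<open>Induction over the span. The predicate is taken inside \<open>SF\<close> because
  linearity of \<open>Lap\<close> and \<open>Gam\<close> is available only for smooth
  functions.\<close>

lemma FF_Suc_induct: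
  assumes "f \<in> FF (Suc n)" "cs.subspace {f \<in> SF. P f}" "\<And>c f. f \<in> FF n \<Longrightarrow> P (lf c * f)"
  shows "P f"
proof -
  have "f \<in> {f \<in> SF. P f}"
    using assms(1)[unfolded FF.simps] assms(2)
    by (rule cs.span_induct[where P = "\<lambda>f. f \<in> {f \<in> SF. P f}", unfolded Collect_mem_eq])
      (use assms(3) FF_SF in \<open>auto intro!: SF_mult lf_SF\<close>)
  then show ?thesis by simp
qed

text \<open>On S^3 multiplication by the squared norm of p is the identity, and it raises the degree
  by two.\<close>

lemma FF_subset_Suc_Suc: "FF n \<subseteq> FF (Suc (Suc n))"
proof
  fix f assume f: "f \<in> FF n"
  have "(\<Sum>i\<in>UNIV. lf (axis i 1) * (lf (axis i 1) * f)) = f"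
  proof
    fix p
    show "(\<Sum>i\<in>UNIV. lf (axis i 1) * (lf (axis i 1) * f)) p = f p"
    proof (cases "p \<in> S3")
      case True
      have "lf (axis i 1) p = of_real (p $ i)" for i
        using True by (simp add: lf_def rS_def axis_def if_distrib[of "\<lambda>x. x * _"] cong: if_cong)
      then have "(\<Sum>i\<in>UNIV. lf (axis i 1) * (lf (axis i 1) * f)) p = of_real (p$1 * p$1 + p$2 * p$2 + p$3 * p$3 + p$4 * p$4) * f p"
        by (simp add: sum_4 algebra_simps)
      then show ?thesis using True by (simp only: S3_iff) simp
    next
      case False
      then have "f p = 0" using SF_outside FF_SF f by blast
      then show ?thesis by (simp add: sum_4)
    qed
  qed
  moreover have "(\<Sum>i\<in>UNIV. lf (axis i 1) * (lf (axis i 1) * f)) \<in> FF (Suc (Suc n))"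
    by (intro cs.subspace_sum[OF FF_subspace] FF_lf f)
  ultimately show "f \<in> FF (Suc (Suc n))" by simp
qed

context frame
begin

text \<open>The Leibniz rule for the idempotent \<open>one\<close>, which acts as a unit on
  \<open>SF\<close>.\<close>

lemma d_one: "d a one = 0"
proof -
  have "d a one = one * d a one + d a one * one"
    using d_mult[OF one_SF one_SF, of a] by (simp only: one_mult[OF one_SF])
  also have "\<dots> = d a one + d a one"
    by (simp only: mult.commute[of "d a one" one] one_mult[OF d_SF[OF one_SF]])
  finally show ?thesis by simp
qed

lemma d_lf:
  "d a (lf c) = rS (\<lambda>p. \<Sum>i\<in>UNIV. c $ i * of_real ((JM s a *v p) $ i))"
proof -
  let ?F = "\<lambda>p::real^4. \<Sum>i\<in>UNIV. c $ i * complex_of_real (p $ i)"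
  have bl: "bounded_linear ?F"
    by (intro bounded_linear_sum bounded_linear_compose[OF bounded_linear_mult_right]
        bounded_linear_compose[OF bounded_linear_of_real bounded_linear_vec_nth])
  have "DJ a ?F = (\<lambda>p. ?F (JM s a *v p))"
    unfolding DJ_def frechet_derivative_at[OF bounded_linear_imp_has_derivative[OF bl], symmetric] ..
  then show ?thesis unfolding lf_def by (simp add: d_rS smooth_linear[OF bl])
qed

lemma d_d_lf: "d a (d a (lf c)) = - lf c"
proof -
  have "d a (lf c) = lf (\<chi> j. \<Sum>i\<in>UNIV. c $ i * of_real (JM s a $ i $ j))"
    unfolding d_lf unfolding lf_def
    by (intro arg_cong[where f = rS] ext) (simp add: matrix_vector_mult_def sum_4 algebra_simps)
  then have "d a (d a (lf c)) = rS (\<lambda>p. \<Sum>i\<in>UNIV. (\<Sum>k\<in>UNIV. c $ k * of_real (JM s a $ k $ i)) * of_real ((JM s a *v p) $ i))"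
    by (simp add: d_lf)
  also have "\<dots> = rS (\<lambda>p. \<Sum>k\<in>UNIV. c $ k * of_real ((JM s a *v (JM s a *v p)) $ k))"
  proof (intro arg_cong[where f = rS] ext)
    fix p
    have e: "(JM s a *v (JM s a *v p)) $ k = (\<Sum>i\<in>UNIV. JM s a $ k $ i * (JM s a *v p) $ i)" for k
      by (simp only: matrix_vector_mult_def[of "JM s a" "JM s a *v p"] vec_lambda_beta)
    show "(\<Sum>i\<in>UNIV. (\<Sum>k\<in>UNIV. c $ k * of_real (JM s a $ k $ i)) * of_real ((JM s a *v p) $ i))
       = (\<Sum>k\<in>UNIV. c $ k * complex_of_real ((JM s a *v (JM s a *v p)) $ k))"
      unfolding e of_real_sum of_real_mult sum_distrib_left sum_distrib_right mult.assoc by (rule sum.swap)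
  qed
  also have "\<dots> = - lf c"
    by (auto simp: JM_sq lf_def rS_def fun_eq_iff sum_negf)
  finally show ?thesis .
qed

lemma Lap_lf: "Lap (lf c) = 3 * lf c"
  by (simp add: Lap_def d_d_lf)

lemma Lap_one: "Lap one = 0"
  by (simp add: Lap_def d_one d_zero)

lemma Gam_one: "Gam f one = 0"
  by (simp add: Gam_def d_one)

text \<open>The ambient gradients of two linear forms have the constant product of c and c'; passing
  to S^3 removes the radial parts, which contribute the product of the forms. Formally this is
  \<open>axis_frame\<close>.\<close>

lemma Gam_lf: "Gam (lf c) (lf c') = K (\<Sum>i\<in>UNIV. c $ i * c' $ i) * one - lf c * lf c'"
proof
  fix p
  show "Gam (lf c) (lf c') p = (K (\<Sum>i\<in>UNIV. c $ i * c' $ i) * one - lf c * lf c') p"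
  proof (cases "p \<in> S3")
    case True
    have fr: "(if i = j then 1 else 0) = complex_of_real (p$i) * of_real (p$j)
        + (\<Sum>a\<in>UNIV. of_real ((JM s a *v p) $ i) * of_real ((JM s a *v p) $ j))" for i j
    proof -
      have "(axis i 1 :: real^4) $ j = p$i * p$j + (\<Sum>a\<in>UNIV. (JM s a *v p) $ i * (JM s a *v p) $ j)"
        unfolding axis_frame[OF True, of i]
        by (simp only: vector_add_component vector_scaleR_component sum_component real_scaleR_def)
      then have "complex_of_real (axis i 1 $ j) = complex_of_real (p$i) * of_real (p$j)
        + (\<Sum>a\<in>UNIV. of_real ((JM s a *v p) $ i) * of_real ((JM s a *v p) $ j))"
        by (simp only: of_real_add of_real_mult of_real_sum)
      moreover have "complex_of_real (axis i 1 $ j) = (if i = j then 1 else 0)" by (simp add: axis_def)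
      ultimately show ?thesis by simp
    qed
    have "(\<Sum>i\<in>UNIV. c $ i * c' $ i) = (\<Sum>i\<in>UNIV. \<Sum>j\<in>UNIV. c $ i * c' $ j * (if i = j then 1 else 0))"
      by (simp add: if_distrib[of "\<lambda>x. _ * x"] cong: if_cong)
    also have "\<dots> = (\<Sum>i\<in>UNIV. \<Sum>j\<in>UNIV. c $ i * c' $ j * (of_real (p$i) * of_real (p$j)))
       + (\<Sum>i\<in>UNIV. \<Sum>j\<in>UNIV. \<Sum>a\<in>UNIV. c $ i * c' $ j * (of_real ((JM s a *v p) $ i) * of_real ((JM s a *v p) $ j)))"
      unfolding fr by (simp only: distrib_left sum.distrib sum_distrib_left)
    also have "(\<Sum>i\<in>UNIV. \<Sum>j\<in>UNIV. c $ i * c' $ j * (of_real (p$i) * of_real (p$j))) = lf c p * lf c' p"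
      using True by (simp only: lf_def rS_def if_True sum_product mult_ac)
    also have "(\<Sum>i\<in>UNIV. \<Sum>j\<in>UNIV. \<Sum>a\<in>UNIV. c $ i * c' $ j * (of_real ((JM s a *v p) $ i) * of_real ((JM s a *v p) $ j)))
       = (\<Sum>a\<in>UNIV. (\<Sum>i\<in>UNIV. c $ i * of_real ((JM s a *v p) $ i)) * (\<Sum>j\<in>UNIV. c' $ j * of_real ((JM s a *v p) $ j)))"
    proof -
      let ?X = "\<lambda>i j a. c $ i * c' $ j * (of_real ((JM s a *v p) $ i) * of_real ((JM s a *v p) $ j))"
      have "(\<Sum>i\<in>UNIV. \<Sum>j\<in>UNIV. \<Sum>a\<in>UNIV. ?X i j a) = (\<Sum>i\<in>UNIV. \<Sum>a\<in>UNIV. \<Sum>j\<in>UNIV. ?X i j a)"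
        by (intro sum.cong refl sum.swap)
      also have "\<dots> = (\<Sum>a\<in>UNIV. \<Sum>i\<in>UNIV. \<Sum>j\<in>UNIV. ?X i j a)" by (rule sum.swap)
      finally show ?thesis by (simp only: sum_product mult_ac)
    qed
    finally show ?thesis using True by (simp add: Gam_def d_lf rS_def one_def sum_3)
  next
    case False
    then have "lf c p = 0" "one p = 0" by (simp_all add: lf_def one_def rS_def)
    with False show ?thesis by (simp add: Gam_def d_lf rS_def sum_3)
  qed
qed

text \<open>For f homogeneous of degree n the ambient product of the gradients has degree n - 1, and
  by Euler's relation the radial part to be removed is n times \<open>lf c * f\<close>.\<close>

lemma Gam_FF: "f \<in> FF n \<Longrightarrow> Gam (lf c) f + K (of_nat n) * (lf c * f) \<in> FFm n 1"
proof (induction n arbitrary: f)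
  case 0
  then obtain k where f: "f = K k * one" unfolding FF.simps cs.span_singleton by blast
  show ?case unfolding f Gam_K[OF one_SF] Gam_one by (simp add: K_hom FFm_def zero_fun_def)
next
  case (Suc n)
  show ?case
  proof (rule FF_Suc_induct[OF Suc.prems])
    show "cs.subspace {f \<in> SF. Gam (lf c) f + K (of_nat (Suc n)) * (lf c * f) \<in> FFm (Suc n) 1}"
    proof (rule cs.subspaceI; clarsimp simp only: mem_Collect_eq)
      show "0 \<in> SF \<and> Gam (lf c) 0 + K (of_nat (Suc n)) * (lf c * 0) \<in> FFm (Suc n) 1"
        using Gam_K[OF SF_zero, of "lf c" 0] cs.subspace_0[OF FFm_subspace] by (simp add: K_hom SF_zero)
    next
      fix f h assume fh: "f \<in> SF" "Gam (lf c) f + K (of_nat (Suc n)) * (lf c * f) \<in> FFm (Suc n) 1"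
         "h \<in> SF" "Gam (lf c) h + K (of_nat (Suc n)) * (lf c * h) \<in> FFm (Suc n) 1"
      have "Gam (lf c) (f + h) + K (of_nat (Suc n)) * (lf c * (f + h))
         = (Gam (lf c) f + K (of_nat (Suc n)) * (lf c * f)) + (Gam (lf c) h + K (of_nat (Suc n)) * (lf c * h))"
        by (simp only: Gam_add[OF fh(1,3) lf_SF] distrib_left) simp
      then show "f + h \<in> SF \<and> Gam (lf c) (f + h) + K (of_nat (Suc n)) * (lf c * (f + h)) \<in> FFm (Suc n) 1"
        using cs.subspace_add[OF FFm_subspace fh(2,4)] by (simp only: SF_add fh simp_thms)
    next
      fix k f assume f: "f \<in> SF" "Gam (lf c) f + K (of_nat (Suc n)) * (lf c * f) \<in> FFm (Suc n) 1"
      have "Gam (lf c) (K k * f) + K (of_nat (Suc n)) * (lf c * (K k * f)) = K k * (Gam (lf c) f + K (of_nat (Suc n)) * (lf c * f))"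
        by (simp only: Gam_K f distrib_left mult.left_commute)
      then show "K k * f \<in> SF \<and> Gam (lf c) (K k * f) + K (of_nat (Suc n)) * (lf c * (K k * f)) \<in> FFm (Suc n) 1"
        using cs.subspace_scale[OF FFm_subspace f(2)] by (simp only: SF_K_mult f simp_thms)
    qed
  next
    fix c' f assume f: "f \<in> FF n"
    then have fS: "f \<in> SF" using FF_SF by blast
    have eq: "Gam (lf c) (lf c' * f) + K (of_nat (Suc n)) * (lf c * (lf c' * f))
        = K (\<Sum>i\<in>UNIV. c $ i * c' $ i) * (one * f) + lf c' * (Gam (lf c) f + K (of_nat n) * (lf c * f))"
      unfolding Gam_mult[OF lf_SF fS] Gam_lf by (simp add: K_hom algebra_simps)
    have "K (\<Sum>i\<in>UNIV. c $ i * c' $ i) * (one * f) \<in> FFm (Suc n) 1"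
      unfolding one_mult[OF fS] using cs.subspace_scale[OF FF_subspace f] by (simp add: FFm_def)
    then show "Gam (lf c) (lf c' * f) + K (of_nat (Suc n)) * (lf c * (lf c' * f)) \<in> FFm (Suc n) 1"
      unfolding eq by (rule cs.subspace_add[OF FFm_subspace _ FFm_lf[OF Suc.IH[OF f]]])
  qed
qed

abbreviation ev :: "nat \<Rightarrow> complex" where "ev n \<equiv> of_nat (n * (n + 2))"

text \<open>On S^3 the Laplacian of a homogeneous polynomial is n (n + 2) times it, plus a term of
  degree n - 2 that comes from the Euclidean Laplacian. In the induction the product rule adds up
  the leading coefficients: 3 + n (n + 2) + 2 n = (n + 1)(n + 3).\<close>

lemma Lap_FF: "f \<in> FF n \<Longrightarrow> Lap f - K (ev n) * f \<in> FFm n 2"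
proof (induction n arbitrary: f)
  case 0
  then obtain k where f: "f = K k * one" unfolding FF.simps cs.span_singleton by blast
  show ?case unfolding f Lap_K[OF one_SF] Lap_one by (simp add: K_hom FFm_def zero_fun_def)
next
  case (Suc n)
  show ?case
  proof (rule FF_Suc_induct[OF Suc.prems])
    show "cs.subspace {f \<in> SF. Lap f - K (ev (Suc n)) * f \<in> FFm (Suc n) 2}"
    proof (rule cs.subspaceI; clarsimp simp only: mem_Collect_eq)
      show "0 \<in> SF \<and> Lap 0 - K (ev (Suc n)) * 0 \<in> FFm (Suc n) 2"
        using Lap_K[OF SF_zero, of 0] cs.subspace_0[OF FFm_subspace] by (simp add: K_hom SF_zero)
    next
      fix f h assume fh: "f \<in> SF" "Lap f - K (ev (Suc n)) * f \<in> FFm (Suc n) 2"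
         "h \<in> SF" "Lap h - K (ev (Suc n)) * h \<in> FFm (Suc n) 2"
      have "Lap (f + h) - K (ev (Suc n)) * (f + h) = (Lap f - K (ev (Suc n)) * f) + (Lap h - K (ev (Suc n)) * h)"
        by (simp only: Lap_add fh distrib_left) simp
      then show "f + h \<in> SF \<and> Lap (f + h) - K (ev (Suc n)) * (f + h) \<in> FFm (Suc n) 2"
        using cs.subspace_add[OF FFm_subspace fh(2,4)] by (simp only: SF_add fh simp_thms)
    next
      fix k f assume f: "f \<in> SF" "Lap f - K (ev (Suc n)) * f \<in> FFm (Suc n) 2"
      have "Lap (K k * f) - K (ev (Suc n)) * (K k * f) = K k * (Lap f - K (ev (Suc n)) * f)"
        by (simp only: Lap_K f right_diff_distrib mult.left_commute)
      then show "K k * f \<in> SF \<and> Lap (K k * f) - K (ev (Suc n)) * (K k * f) \<in> FFm (Suc n) 2"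
        using cs.subspace_scale[OF FFm_subspace f(2)] by (simp only: SF_K_mult f simp_thms)
    qed
  next
    fix c f assume f: "f \<in> FF n"
    then have fS: "f \<in> SF" using FF_SF by blast
    have eq: "Lap (lf c * f) - K (ev (Suc n)) * (lf c * f)
        = lf c * (Lap f - K (ev n) * f) + K (-2) * (Gam (lf c) f + K (of_nat n) * (lf c * f))"
      unfolding Lap_mult[OF lf_SF fS] Lap_lf by (simp add: K_hom algebra_simps)
    have "FFm (Suc n) 2 = FFm n 1" by (simp add: FFm_def numeral_2_eq_2)
    then have "K (-2) * (Gam (lf c) f + K (of_nat n) * (lf c * f)) \<in> FFm (Suc n) 2"
      using cs.subspace_scale[OF FFm_subspace Gam_FF[OF f]] by (simp only:)
    then show "Lap (lf c * f) - K (ev (Suc n)) * (lf c * f) \<in> FFm (Suc n) 2"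
      unfolding eq by (rule cs.subspace_add[OF FFm_subspace FFm_lf[OF Suc.IH[OF f]]])
  qed
qed

end

text \<open>An operator that is triangular with distinct diagonal entries e n: its e n-eigenspace in W n
  complements W (n - 2).\<close>
locale graded_operator = vector_space scale
  for scale :: "'a::field \<Rightarrow> 'b::ab_group_add \<Rightarrow> 'b" (infixr "\<cdot>" 75) +
  fixes W :: "nat \<Rightarrow> 'b set" and U :: "'b set" and L :: "'b \<Rightarrow> 'b" and e :: "nat \<Rightarrow> 'a"
  assumes subspace_W: "subspace (W n)" and W_U: "W n \<subseteq> U"
    and L_add: "x \<in> U \<Longrightarrow> y \<in> U \<Longrightarrow> L (x + y) = L x + L y"
    and L_scale: "x \<in> U \<Longrightarrow> L (c \<cdot> x) = c \<cdot> L x"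
    and step: "x \<in> W n \<Longrightarrow> L x - e n \<cdot> x \<in> (if 2 \<le> n then W (n - 2) else {0})"
    and mono: "W n \<subseteq> W (n + 2)"
    and inj_e: "inj e"
begin

lemma mono': "2 \<le> n \<Longrightarrow> W (n - 2) \<subseteq> W n"
  using mono[of "n - 2"] by (simp only: le_add_diff_inverse2)

text \<open>L - c is triangular with nonzero diagonal entries e j - c: division by the top entry
  solves the equation up to an error two levels lower, which the induction hypothesis
  corrects.\<close>

lemma resolvent_surj:
  assumes "\<And>j. j \<le> m \<Longrightarrow> e j \<noteq> c" "k \<in> W m"
  shows "\<exists>w\<in>W m. L w - c \<cdot> w = k"
  using assms
proof (induction m arbitrary: k rule: less_induct)
  case (less m)
  define \<alpha> where "\<alpha> = inverse (e m - c)"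
  define k' where "k' = L k - e m \<cdot> k"
  have \<alpha>: "\<alpha> * (e m - c) = 1" using less.prems(1)[of m] by (simp add: \<alpha>_def)
  have kU: "k \<in> U" using less.prems W_U by blast
  have "L (\<alpha> \<cdot> k) - c \<cdot> (\<alpha> \<cdot> k) = \<alpha> \<cdot> (k' + (e m - c) \<cdot> k)"
    by (simp add: L_scale kU k'_def scale_right_distrib scale_right_diff_distrib scale_left_diff_distrib mult_ac)
  then have eq: "L (\<alpha> \<cdot> k) - c \<cdot> (\<alpha> \<cdot> k) = k + \<alpha> \<cdot> k'"
    using \<alpha> by (simp add: scale_right_distrib add.commute)
  have \<alpha>k: "\<alpha> \<cdot> k \<in> W m" using less.prems subspace_W subspace_scale by blast
  show ?case
  proof (cases "2 \<le> m")
    case True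
    then have "- (\<alpha> \<cdot> k') \<in> W (m - 2)"
      using step[OF less.prems(2)] subspace_W subspace_scale subspace_neg by (simp add: k'_def)
    moreover have "e j \<noteq> c" if "j \<le> m - 2" for j using that by (intro less.prems(1)) simp
    ultimately obtain w where w: "w \<in> W (m - 2)" "L w - c \<cdot> w = - (\<alpha> \<cdot> k')"
      using less.IH[of "m - 2"] True by fastforce
    have wm: "w \<in> W m" using w mono'[OF True] by blast
    have "L (\<alpha> \<cdot> k + w) - c \<cdot> (\<alpha> \<cdot> k + w) = (L (\<alpha> \<cdot> k) - c \<cdot> (\<alpha> \<cdot> k)) + (L w - c \<cdot> w)"
      using \<alpha>k wm W_U by (subst L_add) (auto simp: scale_right_distrib)
    then have "L (\<alpha> \<cdot> k + w) - c \<cdot> (\<alpha> \<cdot> k + w) = k" unfolding eq w by simp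
    then show ?thesis using \<alpha>k wm subspace_W subspace_add by blast
  next
    case False
    then have "k' = 0" using step[OF less.prems(2)] by (simp add: k'_def)
    then show ?thesis using eq \<alpha>k by (intro bexI[of _ "\<alpha> \<cdot> k"]) simp_all
  qed
qed

text \<open>An eigenvector for c is a multiple of \<open>L w - e m \<cdot> w\<close>, which lies two
  levels lower, so it descends until nothing is left.\<close>

lemma resolvent_inj:
  assumes "\<And>j. j \<le> m \<Longrightarrow> e j \<noteq> c" "w \<in> W m" "L w = c \<cdot> w"
  shows "w = 0"
  using assms
proof (induction m rule: less_induct)
  case (less m)
  have "L w - e m \<cdot> w = (c - e m) \<cdot> w" using less.prems by (simp add: scale_left_diff_distrib)
  moreover have "inverse (c - e m) \<cdot> ((c - e m) \<cdot> w) = w" using less.prems(1)[of m] by simp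
  ultimately have w: "w = inverse (c - e m) \<cdot> (L w - e m \<cdot> w)" by simp
  show ?case
  proof (cases "2 \<le> m")
    case True
    then have "L w - e m \<cdot> w \<in> W (m - 2)" using step[OF less.prems(2)] by simp
    then have "w \<in> W (m - 2)" using w subspace_W subspace_scale by metis
    moreover have "e j \<noteq> c" if "j \<le> m - 2" for j using that by (intro less.prems(1)) simp
    ultimately show ?thesis using less.IH[of "m - 2"] less.prems True by simp
  next
    case False
    then have "L w - e m \<cdot> w = 0" using step[OF less.prems(2)] by simp
    then show ?thesis using w by simp
  qed
qed

text \<open>L - e n maps x to level n - 2, where it is invertible because e n is not among the
  diagonal entries there. Solving for w at that level makes x - w an eigenvector.\<close>

lemma eigen_decomposition:
  assumes "x \<in> W n"
  shows "\<exists>h\<in>W n. \<exists>w\<in>(if 2 \<le> n then W (n - 2) else {0}). L h = e n \<cdot> h \<and> x = h + w"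
proof (cases "2 \<le> n")
  case True
  have "e j \<noteq> e n" if "j \<le> n - 2" for j using that True inj_e by (auto dest: injD)
  moreover have "L x - e n \<cdot> x \<in> W (n - 2)" using step[OF assms] True by simp
  ultimately obtain w where w: "w \<in> W (n - 2)" "L w - e n \<cdot> w = L x - e n \<cdot> x"
    using resolvent_surj by blast
  have wn: "w \<in> W n" using w mono'[OF True] by blast
  have xw: "x - w \<in> W n" using subspace_diff[OF subspace_W assms wn] .
  have "L x = L (x - w) + L w" using L_add[of "x - w" w] xw wn W_U by (simp add: subset_iff)
  then have "L (x - w) = e n \<cdot> (x - w)" using w(2) by (simp add: scale_right_diff_distrib algebra_simps)
  then show ?thesis using xw w(1) True by (intro bexI[of _ "x - w"] bexI[of _ w]) auto
next
  case False
  then have "L x = e n \<cdot> x" using step[OF assms] by simp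
  then show ?thesis using assms False by auto
qed

lemma eigen_inter_lower:
  assumes "x \<in> (if 2 \<le> n then W (n - 2) else {0})" "L x = e n \<cdot> x"
  shows "x = 0"
proof (cases "2 \<le> n")
  case True
  have "e j \<noteq> e n" if "j \<le> n - 2" for j using that True inj_e by (auto dest: injD)
  moreover have "x \<in> W (n - 2)" using assms(1) True by simp
  ultimately show ?thesis using assms(2) by (rule resolvent_inj)
qed (use assms in simp)

end

section \<open>Eigenfunctions are polynomials\<close>

text \<open>The linear forms w are arbitrary so that eigenforms of a group element can be used, on
  whose monomials the element acts diagonally. The factor \<open>one\<close> cuts off outside S^3,
  which is needed when all exponents are 0.\<close>

definition mon :: "(4 \<Rightarrow> complex^4) \<Rightarrow> (4 \<Rightarrow> nat) \<Rightarrow> real^4 \<Rightarrow> complex" where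
  "mon w \<alpha> = one * (\<Prod>i\<in>UNIV. lf (w i) ^ \<alpha> i)"

definition exponents :: "nat \<Rightarrow> (4 \<Rightarrow> nat) set" where "exponents n = {\<alpha>. sum \<alpha> UNIV = n}"

lemma finite_exponents: "finite (exponents n)"
proof -
  have "exponents n \<subseteq> PiE UNIV (\<lambda>_. {..n})"
    using member_le_sum[of _ "UNIV :: 4 set"] by (auto simp: exponents_def PiE_def Pi_def)
  then show ?thesis by (rule finite_subset) (intro finite_PiE; simp)
qed

lemma lf_mon: "lf (w i) * mon w \<alpha> = mon w (\<alpha>(i := Suc (\<alpha> i)))"
proof -
  have "(\<Prod>j\<in>UNIV. lf (w j) ^ (\<alpha>(i := Suc (\<alpha> i))) j) = lf (w i) ^ Suc (\<alpha> i) * (\<Prod>j\<in>UNIV - {i}. lf (w j) ^ \<alpha> j)"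
    by (subst prod.remove[of UNIV i]) (auto intro!: prod.cong arg_cong2[where f = "(*)"])
  moreover have "(\<Prod>j\<in>UNIV. lf (w j) ^ \<alpha> j) = lf (w i) ^ \<alpha> i * (\<Prod>j\<in>UNIV - {i}. lf (w j) ^ \<alpha> j)"
    by (subst prod.remove[of UNIV i]) auto
  ultimately show ?thesis by (simp add: mon_def mult_ac)
qed

lemma exponents_upd: "\<alpha> \<in> exponents n \<Longrightarrow> \<alpha>(i := Suc (\<alpha> i)) \<in> exponents (Suc n)"
proof -
  assume "\<alpha> \<in> exponents n"
  then have "sum \<alpha> UNIV = n" by (simp add: exponents_def)
  moreover have "sum \<alpha> UNIV = \<alpha> i + sum \<alpha> (UNIV - {i})" by (subst sum.remove[of UNIV i]) auto
  moreover have "sum (\<alpha>(i := Suc (\<alpha> i))) UNIV = Suc (\<alpha> i) + sum \<alpha> (UNIV - {i})"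
    by (subst sum.remove[of UNIV i]) (auto intro!: sum.cong)
  ultimately show ?thesis by (simp add: exponents_def)
qed

lemma exponents_Suc: assumes "\<alpha> \<in> exponents (Suc n)" obtains i \<beta> where "\<beta> \<in> exponents n" "\<alpha> = \<beta>(i := Suc (\<beta> i))"
proof -
  have "sum \<alpha> UNIV \<noteq> 0" using assms by (simp add: exponents_def)
  then obtain i where i: "\<alpha> i \<noteq> 0" by (auto simp: sum_eq_0_iff)
  define \<beta> where "\<beta> = \<alpha>(i := \<alpha> i - 1)"
  have eq: "\<alpha> = \<beta>(i := Suc (\<beta> i))" using i by (auto simp: \<beta>_def)
  have "\<beta> \<in> exponents (sum \<beta> UNIV)" by (simp add: exponents_def)
  from exponents_upd[OF this, of i] have "\<alpha> \<in> exponents (Suc (sum \<beta> UNIV))" by (simp only: eq[symmetric])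
  then have "sum \<beta> UNIV = n" using assms by (simp add: exponents_def)
  then show ?thesis using that[of \<beta> i] eq by (simp add: exponents_def)
qed

lemma exponents_0: "exponents 0 = {\<lambda>_. 0}" by (auto simp: exponents_def fun_eq_iff)

lemma mon_FF: "\<alpha> \<in> exponents n \<Longrightarrow> mon w \<alpha> \<in> FF n"
proof (induction n arbitrary: \<alpha>)
  case 0
  then have "mon w \<alpha> = one" by (simp add: exponents_0 mon_def)
  then show ?case unfolding FF.simps by (simp add: cs.span_base)
next
  case (Suc n)
  obtain i \<beta> where b: "\<beta> \<in> exponents n" "\<alpha> = \<beta>(i := Suc (\<beta> i))" using exponents_Suc[OF Suc.prems] by blast
  show ?case unfolding b(2) lf_mon[symmetric] by (rule FF_lf[OF Suc.IH[OF b(1)]])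
qed

lemma lf_linear: "lf (\<Sum>i\<in>UNIV. k i *s w i) = (\<Sum>i\<in>(UNIV::4 set). K (k i) * lf (w i))"
  by (auto simp: lf_def rS_def fun_eq_iff sum_4 algebra_simps)

lemma FF_subset_span_mon:
  fixes w :: "4 \<Rightarrow> complex^4"
  assumes w: "\<And>c. \<exists>k. c = (\<Sum>i\<in>UNIV. k i *s w i)"
  shows "FF n \<subseteq> cs.span (mon w ` exponents n)"
proof (induction n)
  case 0
  have "mon w (\<lambda>_. 0) = one" by (simp add: mon_def)
  then show ?case unfolding FF.simps exponents_0 image_insert image_empty by (simp only: subset_refl)
next
  case (Suc n)
  have mon: "lf (w i) * f \<in> cs.span (mon w ` exponents (Suc n))" if "f \<in> cs.span (mon w ` exponents n)" for f i
    using that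
  proof (rule cs.span_induct)
    show "cs.subspace {f. lf (w i) * f \<in> cs.span (mon w ` exponents (Suc n))}"
    proof (rule cs.subspaceI; simp only: mem_Collect_eq)
      show "lf (w i) * 0 \<in> cs.span (mon w ` exponents (Suc n))" by (simp add: cs.span_zero)
      show "lf (w i) * (x + y) \<in> cs.span (mon w ` exponents (Suc n))"
        if "lf (w i) * x \<in> cs.span (mon w ` exponents (Suc n))" "lf (w i) * y \<in> cs.span (mon w ` exponents (Suc n))" for x y
        using cs.span_add[OF that] by (simp only: distrib_left)
      show "lf (w i) * (K c * x) \<in> cs.span (mon w ` exponents (Suc n))"
        if "lf (w i) * x \<in> cs.span (mon w ` exponents (Suc n))" for c x
        using cs.span_scale[OF that, of c] by (simp only: mult.left_commute)
    qed
    show "lf (w i) * x \<in> cs.span (mon w ` exponents (Suc n))" if "x \<in> mon w ` exponents n" for x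
      using that exponents_upd by (auto simp: lf_mon intro!: cs.span_base)
  qed
  have "lf c * f \<in> cs.span (mon w ` exponents (Suc n))" if "f \<in> FF n" for c f
  proof -
    obtain k where k: "c = (\<Sum>i\<in>UNIV. k i *s w i)" using w by blast
    have "lf c * f = (\<Sum>i\<in>UNIV. K (k i) * (lf (w i) * f))"
      unfolding k lf_linear by (simp only: sum_distrib_right mult.assoc)
    moreover have "f \<in> cs.span (mon w ` exponents n)" using that Suc.IH by blast
    ultimately show ?thesis by (simp only:) (intro cs.span_sum cs.span_scale mon)
  qed
  then have "{lf c * f |c f. f \<in> FF n} \<subseteq> cs.span (mon w ` exponents (Suc n))" by blast
  then show ?case unfolding FF.simps by (rule cs.span_minimal[OF _ cs.subspace_span])
qed

lemma standard_forms_span: "\<exists>k. c = (\<Sum>i\<in>UNIV. k i *s (axis i 1 :: complex^4))"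
  by (intro exI[of _ "\<lambda>i. c $ i"]) (simp add: vec_eq_iff forall_4 sum_4 axis_def)

text \<open>Induction on q. A real linear functional agrees on S^3 with some \<open>lf c\<close>,
  and off S^3 both products vanish because f does.\<close>

lemma FF_mult_poly:
  assumes "real_polynomial_function q" "f \<in> cs.span (\<Union>n. FF n)"
  shows "(\<lambda>p. of_real (q p)) * f \<in> cs.span (\<Union>n. FF n)"
  using assms
proof (induction q arbitrary: f rule: real_polynomial_function.induct)
  case (linear L)
  let ?c = "\<chi> i. complex_of_real (L (axis i 1))"
  interpret bounded_linear L by fact
  have L: "L p = (\<Sum>i\<in>UNIV. L (axis i 1) * p $ i)" for p
  proof -
    have "p = (\<Sum>i\<in>UNIV. (p $ i) *\<^sub>R axis i 1)"
      by (simp add: vec_eq_iff forall_4 sum_4 axis_def)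
    then have "L p = L (\<Sum>i\<in>UNIV. (p $ i) *\<^sub>R axis i 1)" by simp
    then show ?thesis by (simp add: sum scaleR mult.commute)
  qed
  show ?case using linear.prems
  proof (rule cs.span_induct)
    show "cs.subspace {f. (\<lambda>p. complex_of_real (L p)) * f \<in> cs.span (\<Union>n. FF n)}"
    proof (rule cs.subspaceI; simp only: mem_Collect_eq)
      show "(\<lambda>p. complex_of_real (L p)) * 0 \<in> cs.span (\<Union>n. FF n)" by (simp add: cs.span_zero)
      show "(\<lambda>p. complex_of_real (L p)) * (x + y) \<in> cs.span (\<Union>n. FF n)"
        if "(\<lambda>p. complex_of_real (L p)) * x \<in> cs.span (\<Union>n. FF n)"
          "(\<lambda>p. complex_of_real (L p)) * y \<in> cs.span (\<Union>n. FF n)" for x y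
        using cs.span_add[OF that] by (simp only: distrib_left)
      show "(\<lambda>p. complex_of_real (L p)) * (K c * x) \<in> cs.span (\<Union>n. FF n)"
        if "(\<lambda>p. complex_of_real (L p)) * x \<in> cs.span (\<Union>n. FF n)" for c x
        using cs.span_scale[OF that, of c] by (simp only: mult.left_commute)
    qed
    fix x assume "x \<in> (\<Union>n. FF n)"
    then obtain n where n: "x \<in> FF n" by blast
    have "(\<lambda>p. complex_of_real (L p)) * x = lf ?c * x"
    proof
      fix p
      show "((\<lambda>p. complex_of_real (L p)) * x) p = (lf ?c * x) p"
        using SF_outside[of x p] FF_SF n by (cases "p \<in> S3") (auto simp: lf_def rS_def L[of p])
    qed
    then show "(\<lambda>p. complex_of_real (L p)) * x \<in> cs.span (\<Union>n. FF n)"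
      using FF_lf[OF n, of ?c] by (auto intro!: cs.span_base simp del: FF.simps)
  qed
next
  case (const c)
  have "(\<lambda>p. complex_of_real c) * f = K (of_real c) * f" by (simp add: fun_eq_iff)
  then show ?case using cs.span_scale[OF const.prems] by (simp only:)
next
  case (add q q')
  have "(\<lambda>p. complex_of_real (q p + q' p)) * f = (\<lambda>p. of_real (q p)) * f + (\<lambda>p. of_real (q' p)) * f"
    by (simp add: fun_eq_iff distrib_right)
  then show ?case using cs.span_add[OF add.IH(1)[OF add.prems] add.IH(2)[OF add.prems]] by (simp only:)
next
  case (mult q q')
  have "(\<lambda>p. complex_of_real (q p * q' p)) * f = (\<lambda>p. of_real (q p)) * ((\<lambda>p. of_real (q' p)) * f)"
    by (simp add: fun_eq_iff)
  then show ?case using mult.IH(1)[OF mult.IH(2)[OF mult.prems]] by (simp only:)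
qed

lemma polynomial_function_in_span:
  fixes g :: "real^4 \<Rightarrow> complex"
  assumes "polynomial_function g"
  shows "rS g \<in> cs.span (\<Union>n. FF n)"
proof -
  have R: "real_polynomial_function (\<lambda>p. Re (g p))" "real_polynomial_function (\<lambda>p. Im (g p))"
    using assms bounded_linear_Re bounded_linear_Im unfolding polynomial_function_def o_def by blast+
  have one: "one \<in> cs.span (\<Union>n. FF n)"
    by (intro cs.span_base UN_I[of 0]) (simp_all add: cs.span_base)
  have "rS g = (\<lambda>p. of_real (Re (g p))) * one + K \<i> * ((\<lambda>p. of_real (Im (g p))) * one)"
    by (auto simp: fun_eq_iff rS_def one_def complex_eq[symmetric])
  then show ?thesis
    using cs.span_add[OF FF_mult_poly[OF R(1) one] cs.span_scale[OF FF_mult_poly[OF R(2) one]], of \<i>] by (simp only:)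
qed

section \<open>The inner product on S^3 and orthogonal projection\<close>

definition ip :: "(real^4 \<Rightarrow> complex) \<Rightarrow> (real^4 \<Rightarrow> complex) \<Rightarrow> complex" where
  "ip f h = sint (f * (\<lambda>p. cnj (h p)))"

lemma ip_add: "f \<in> SF \<Longrightarrow> f' \<in> SF \<Longrightarrow> h \<in> SF \<Longrightarrow> ip (f + f') h = ip f h + ip f' h"
  unfolding ip_def distrib_right by (intro sint_add SF_mult SF_cnj)

lemma ip_diff: "f \<in> SF \<Longrightarrow> f' \<in> SF \<Longrightarrow> h \<in> SF \<Longrightarrow> ip (f - f') h = ip f h - ip f' h"
  unfolding ip_def left_diff_distrib by (intro sint_diff SF_mult SF_cnj)

lemma ip_K: "ip (K c * f) h = c * ip f h"
  unfolding ip_def mult.assoc by (rule sint_K)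

lemma ip_cnj: "ip h f = cnj (ip f h)"
  unfolding ip_def sint_cnj[symmetric] by (intro arg_cong[where f = sint]) (simp add: fun_eq_iff mult.commute)

lemma ip_add_right: "f \<in> SF \<Longrightarrow> h \<in> SF \<Longrightarrow> h' \<in> SF \<Longrightarrow> ip f (h + h') = ip f h + ip f h'"
  using ip_add[of h h' f] by (simp add: ip_cnj[of f])

lemma ip_K_right: "ip f (K c * h) = cnj c * ip f h"
  using ip_K[of c h f] by (simp add: ip_cnj[of f])

lemma ip_0_right: "ip f 0 = 0"
  using ip_K_right[of f 0 0] by (simp add: K_hom)

lemma ip_self_0: "f \<in> SF \<Longrightarrow> ip f f = 0 \<Longrightarrow> f = 0"
  unfolding ip_def by (rule SF_eq_0I)

lemma ip_span_0:
  assumes "f \<in> SF" "B \<subseteq> SF" "\<And>b. b \<in> B \<Longrightarrow> ip f b = 0" "h \<in> cs.span B"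
  shows "ip f h = 0"
proof -
  have "h \<in> {h \<in> SF. ip f h = 0}"
  proof (rule cs.span_minimal[THEN subsetD, OF _ _ assms(4)])
    show "cs.subspace {h \<in> SF. ip f h = 0}"
      using assms(1) by (intro cs.subspaceI) (auto simp: SF_zero SF_add SF_K_mult ip_add_right ip_K_right ip_def[of f 0] zero_fun_def[symmetric])
  qed (use assms in auto)
  then show ?thesis by simp
qed

text \<open>A Gram-Schmidt step: the new vector b is replaced by its part r orthogonal to B, and the
  component along r is added to the projection w already found. The set B may be dependent, so r can
  be 0.\<close>

lemma orthogonal_projection:
  assumes "finite B" "B \<subseteq> SF" "f \<in> SF"
  shows "\<exists>w\<in>cs.span B. \<forall>b\<in>B. ip (f - w) b = 0"
  using assms
proof (induction B arbitrary: f rule: finite_induct)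
  case empty
  show ?case using cs.span_zero by blast
next
  case (insert b B)
  have SFB: "cs.span B \<subseteq> SF" using insert.prems by (intro cs.span_minimal SF_subspace) auto
  obtain v where v: "v \<in> cs.span B" "\<forall>c\<in>B. ip (b - v) c = 0" using insert.IH[of b] insert.prems by blast
  obtain w where w: "w \<in> cs.span B" "\<forall>c\<in>B. ip (f - w) c = 0" using insert.IH[of f] insert.prems by blast
  define r where "r = b - v"
  have S: "b \<in> SF" "v \<in> SF" "w \<in> SF" "r \<in> SF" "f - w \<in> SF"
    using insert.prems v w SFB by (auto simp: r_def intro!: SF_diff)
  define k where "k = ip (f - w) r / ip r r"
  have rB: "ip r c = 0" if "c \<in> B" for c using v that by (simp add: r_def)
  \<comment> \<open>If \<open>ip r r\<close> is 0 then r = 0, and the equation holds with the value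
    0 that division by zero gives to k.\<close>
  have kr: "ip (f - w) r - k * ip r r = 0"
    using ip_self_0[OF S(4)] ip_0_right[of "f - w"] by (cases "ip r r = 0") (auto simp: k_def)
  let ?w = "w + K k * r"
  have f: "f - ?w = (f - w) - K k * r" by (simp add: algebra_simps)
  have 0: "ip (f - ?w) c = ip (f - w) c - k * ip r c" if "c \<in> SF" for c
    unfolding f using S that by (simp add: ip_diff SF_K_mult ip_K)
  have B: "ip (f - ?w) c = 0" if "c \<in> B" for c
    using 0[of c] w(2) rB that insert.prems by auto
  have fS: "f - ?w \<in> SF" using S insert.prems by (intro SF_diff SF_add SF_K_mult) auto
  have "ip (f - ?w) v = 0"
    by (rule ip_span_0[OF fS _ B v(1)]) (use insert.prems in auto)
  moreover have "ip (f - ?w) r = 0" using 0[OF S(4)] kr by simp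
  moreover have "ip (f - ?w) b = ip (f - ?w) r + ip (f - ?w) v"
    using ip_add_right[OF fS S(4,2)] by (simp add: r_def)
  ultimately have "ip (f - ?w) b = 0" by simp
  moreover have "?w \<in> cs.span (insert b B)"
    using v(1) w(1) cs.span_mono[of B "insert b B"] unfolding r_def
    by (intro cs.span_add cs.span_scale cs.span_diff) (auto intro: cs.span_base)
  ultimately show ?case using B by blast
qed

context frame
begin

lemma ip_Lap_symmetric: "f \<in> SF \<Longrightarrow> h \<in> SF \<Longrightarrow> ip (Lap f) h = ip f (Lap h)"
  unfolding ip_def by (simp add: sint_Lap_symmetric SF_cnj Lap_cnj)

lemma inj_ev: "inj ev"
proof (rule injI)
  fix m n assume "ev m = ev n"
  then have "m * (m + 2) = n * (n + 2)" by (simp only: of_nat_eq_iff)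
  then have "(m + 1) ^ 2 = (n + 1) ^ 2" by (simp add: power2_eq_square algebra_simps)
  then show "m = n" by (simp add: power2_eq_iff)
qed

lemma graded_FF: "graded_operator (\<lambda>c f. K c * f) FF SF Lap ev"
proof unfold_locales
  show "FF n \<subseteq> FF (n + 2)" for n using FF_subset_Suc_Suc[of n] by simp
  show "Lap x - K (ev n) * x \<in> (if 2 \<le> n then FF (n - 2) else {0})" if "x \<in> FF n" for x n
    using Lap_FF[OF that] unfolding FFm_def .
  show "inj ev" by (rule inj_ev)
qed (simp_all only: FF_subspace FF_SF Lap_add Lap_K)

text \<open>The component of f orthogonal to the eigenfunctions in FF n is orthogonal to all polynomials, which are
  dense by Stone-Weierstrass.\<close>
lemma eigenfunction_FF:
  assumes f: "f \<in> SF" "Lap f = K (ev n) * f"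
  shows "f \<in> FF n"
proof -
  define W where "W = {h \<in> FF n. Lap h = K (ev n) * h}"
  have WSF: "W \<subseteq> SF" using FF_SF by (auto simp: W_def)
  have Wsub: "cs.subspace W"
  proof (rule cs.subspaceI)
    have "Lap 0 = K (ev n) * 0" using Lap_K[OF SF_zero, of 0] by (simp add: K_hom)
    then show "0 \<in> W" using cs.subspace_0[OF FF_subspace] by (simp add: W_def)
  next
    fix x y assume xy: "x \<in> W" "y \<in> W"
    then have S: "x \<in> SF" "y \<in> SF" "Lap x = K (ev n) * x" "Lap y = K (ev n) * y" using WSF by (auto simp: W_def)
    have "Lap (x + y) = K (ev n) * (x + y)"
      unfolding Lap_add[OF S(1,2)] S(3,4) by (rule distrib_left[symmetric])
    then show "x + y \<in> W" using xy cs.subspace_add[OF FF_subspace] by (simp only: W_def mem_Collect_eq)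
  next
    fix c x assume x: "x \<in> W"
    then have S: "x \<in> SF" "Lap x = K (ev n) * x" using WSF by (auto simp: W_def)
    have "Lap (K c * x) = K (ev n) * (K c * x)"
      unfolding Lap_K[OF S(1)] S(2) by (rule mult.left_commute)
    then show "K c * x \<in> W" using x cs.subspace_scale[OF FF_subspace] by (simp only: W_def mem_Collect_eq)
  qed
  obtain B where B: "B \<subseteq> W" "cs.independent B" "W \<subseteq> cs.span B" by (rule cs.basis_exists)
  \<comment> \<open>The eigenfunctions in \<open>FF n\<close> form a finite-dimensional space, so an
    orthogonal projection onto it exists.\<close>
  have "B \<subseteq> cs.span (mon (\<lambda>i. axis i 1) ` exponents n)"
  proof -
    have "W \<subseteq> FF n" unfolding W_def by (rule Collect_restrict)
    then show ?thesis
      using B(1) FF_subset_span_mon[OF standard_forms_span, of n] by (meson subset_trans)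
  qed
  from cs.independent_span_bound[OF finite_imageI[OF finite_exponents] B(2) this]
  have finB: "finite B" by (rule conjunct1)
  obtain w where w: "w \<in> cs.span B" "\<forall>b\<in>B. ip (f - w) b = 0"
    using orthogonal_projection[OF finB subset_trans[OF B(1) WSF] f(1)] by (elim bexE)
  have wW: "w \<in> W" using cs.span_minimal[OF B(1) Wsub] w(1) by (rule subsetD)
  define r where "r = f - w"
  have wS: "w \<in> SF" using wW WSF by blast
  have rS: "r \<in> SF" using f wS by (simp add: r_def SF_diff)
  have Lr: "Lap r = K (ev n) * r"
  proof -
    have "Lap w = K (ev n) * w" using wW by (simp add: W_def)
    then show ?thesis unfolding r_def Lap_diff[OF f(1) wS] f(2) by (simp only: right_diff_distrib)
  qed
  have rW: "ip r h = 0" if "h \<in> W" for h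
  proof (rule ip_span_0[OF rS])
    show "B \<subseteq> SF" using B(1) WSF by (rule subset_trans)
    show "ip r b = 0" if "b \<in> B" for b using w(2) that unfolding r_def by (rule bspec)
    show "h \<in> cs.span B" using B(3) that by (rule subsetD)
  qed
  \<comment> \<open>The same degree is handled by the projection; for different degrees symmetry of
    \<open>Lap\<close> makes eigenfunctions of distinct eigenvalues orthogonal.\<close>
  have reig: "ip r h = 0" if h: "h \<in> FF m" "Lap h = K (ev m) * h" for h m
  proof (cases "m = n")
    case True
    then show ?thesis using rW h by (auto simp: W_def)
  next
    case False
    then have "ev n \<noteq> ev m" using inj_ev by (auto dest: injD)
    moreover have "ev n * ip r h = ev m * ip r h"
    proof -
      have hS: "h \<in> SF" using h(1) FF_SF by blast
      have "ev n * ip r h = ip (Lap r) h" unfolding Lr by (rule ip_K[symmetric])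
      also have "\<dots> = ip r (Lap h)" by (rule ip_Lap_symmetric[OF rS hS])
      also have "\<dots> = cnj (ev m) * ip r h" unfolding h(2) by (rule ip_K_right)
      finally show ?thesis by (simp only: complex_cnj_of_nat)
    qed
    ultimately show ?thesis by simp
  qed
  interpret FF: graded_operator "\<lambda>c f. K c * f" FF SF Lap ev by (rule graded_FF)
  have rFF: "ip r h = 0" if "h \<in> FF m" for h m
    using that
  proof (induction m arbitrary: h rule: less_induct)
    case (less m)
    \<comment> \<open>Splitting off an eigenfunction leaves a remainder of degree m - 2, to which
      the induction hypothesis applies.\<close>
    obtain h0 v where hv: "h0 \<in> FF m" "v \<in> (if 2 \<le> m then FF (m - 2) else {0})" "Lap h0 = K (ev m) * h0" "h = h0 + v"
      using FF.eigen_decomposition[OF less.prems] by blast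
    have "ip r v = 0"
    proof (cases "2 \<le> m")
      case True
      then show ?thesis using less.IH[of "m - 2" v] hv(2) by simp
    next
      case False
      then show ?thesis using hv(2) ip_0_right by simp
    qed
    moreover have "v \<in> SF" using hv(2) FF_SF SF_zero by (auto split: if_splits)
    moreover have "h0 \<in> SF" using hv(1) FF_SF by blast
    ultimately show ?case unfolding hv(4) by (simp only: ip_add_right rS reig[OF hv(1,3)] add_0_left)
  qed
  have rspan: "ip r h = 0" if "h \<in> cs.span (\<Union>n. FF n)" for h
  proof (rule ip_span_0[OF rS _ _ that])
    show "(\<Union>n. FF n) \<subseteq> SF" by (rule UN_least, rule FF_SF)
    show "ip r b = 0" if "b \<in> (\<Union>n. FF n)" for b using that rFF by blast
  qed
  obtain Bd where Bd: "\<And>p. norm (r p) \<le> Bd" using SF_bounded[OF rS] by blast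
  have Bd0: "0 \<le> Bd" using Bd[of 0] norm_ge_zero order_trans by blast
  have small: "norm (ip r r) \<le> e * (Bd * measure lborel Bl)" if "e > 0" for e
  proof -
    have "compact S3" by (simp add: S3_def)
    then obtain g where g: "polynomial_function g" "\<And>p. p \<in> S3 \<Longrightarrow> norm (r p - g p) < e"
      using Stone_Weierstrass_polynomial_function[OF \<open>compact S3\<close> SF_continuous_on[OF rS] \<open>e > 0\<close>] by auto
    have gS: "rS g \<in> SF"
      by (rule subsetD[OF cs.span_minimal[OF _ SF_subspace] polynomial_function_in_span[OF g(1)]])
        (rule UN_least, rule FF_SF)
    \<comment> \<open>The approximating polynomial is orthogonal to r, so only the small difference
      contributes.\<close>
    have "ip r r = ip r (r - rS g)"
      using ip_add_right[OF rS SF_diff[OF rS gS] gS] rspan[OF polynomial_function_in_span[OF g(1)]] by simp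
    moreover have "norm (ip r (r - rS g)) \<le> (Bd * e) * measure lborel Bl"
      unfolding ip_def
    proof (rule sint_norm_le)
      show "r * (\<lambda>p. cnj ((r - rS g) p)) \<in> SF" by (intro SF_mult SF_cnj SF_diff rS gS)
      show "norm ((r * (\<lambda>p. cnj ((r - rS g) p))) p) \<le> Bd * e" if "p \<in> S3" for p
      proof -
        have "norm (r p) * norm (r p - g p) \<le> Bd * e"
          using Bd[of p] g(2)[OF that] Bd0 by (intro mult_mono) auto
        then show ?thesis using that by (simp add: norm_mult rS_def del: complex_cnj_diff)
      qed
      show "0 \<le> Bd * e" using Bd0 \<open>e > 0\<close> by simp
    qed
    ultimately show ?thesis by (simp add: mult_ac)
  qed
  have "ip r r = 0"
  proof (rule ccontr)
    assume ne: "ip r r \<noteq> 0"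
    define M where "M = Bd * measure lborel Bl"
    have M0: "0 \<le> M" unfolding M_def using Bd0 by simp
    \<comment> \<open>With this tolerance the bound becomes strictly smaller than the left-hand
      side; M + 1 keeps the denominator positive when M = 0.\<close>
    have "norm (ip r r) \<le> (norm (ip r r) / (2 * (M + 1))) * M"
      using small[of "norm (ip r r) / (2 * (M + 1))"] ne M0 by (simp add: M_def)
    also have "\<dots> = norm (ip r r) * (M / (2 * (M + 1)))" by simp
    also have "\<dots> < norm (ip r r) * 1"
      using ne M0 by (intro mult_strict_left_mono) auto
    finally show False by simp
  qed
  then have "r = 0" by (rule ip_self_0[OF rS])
  then show ?thesis using wW by (simp add: r_def W_def)
qed

text \<open>By parts, the inner product of \<open>Lap f\<close> with f is the sum of the squared
  norms of the \<open>d a f\<close>. It is used to exclude the curl eigenvalue s, which would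
  produce the Laplace eigenvalue -1.\<close>

lemma Lap_nonneg:
  assumes f: "f \<in> SF" "Lap f = - f"
  shows "f = 0"
proof -
  have "ip (Lap f) f = (\<Sum>a\<in>UNIV. ip (d a f) (d a f))"
    unfolding ip_def using f(1)
    by (simp add: sint_Lap SF_cnj Gam_def sint_sum SF_mult d_SF d_cnj)
  moreover have re: "Re (ip h h) \<ge> 0" for h
  proof -
    have eq: "ip h h = (LINT x|lborel. complex_of_real (indicator Bl x * (norm (h (nrm x)))\<^sup>2))"
      unfolding ip_def sint_def
      by (intro Bochner_Integration.integral_cong refl)
        (simp add: complex_norm_square[symmetric] scaleR_conv_of_real del: of_real_power)
    show ?thesis unfolding eq integral_complex_of_real by simp
  qed
  ultimately have "Re (ip (Lap f) f) \<ge> 0" by (simp add: sum_nonneg)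
  moreover have "ip (Lap f) f = - ip f f" using ip_K[of "-1" f f] f(2) by (simp add: K_hom)
  ultimately have "Re (ip f f) = 0" using re[of f] by simp
  moreover have "Im (ip f f) = 0" using arg_cong[OF ip_cnj[of f f], of Im] by simp
  ultimately have "ip f f = 0" by (simp add: complex_eq_iff)
  then show ?thesis by (rule ip_self_0[OF f(1)])
qed

end

section \<open>Traces and dimensions in abstract vector spaces\<close>

context vector_space begin

lemma finite_independent_iff:
  assumes "finite S"
  shows "independent S \<longleftrightarrow> (\<forall>u. (\<Sum>x\<in>S. scale (u x) x) = 0 \<longrightarrow> (\<forall>x\<in>S. u x = 0))"
  unfolding dependent_finite[OF assms] by blast

text \<open>Independence of an indexed family includes injectivity: two equal members would satisfy
  the relation with coefficients 1 and -1.\<close>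

lemma independent_family:
  assumes "finite I" "\<And>c. (\<Sum>i\<in>I. scale (c i) (v i)) = 0 \<Longrightarrow> \<forall>i\<in>I. c i = 0"
  shows "inj_on v I" "independent (v ` I)"
proof -
  show inj: "inj_on v I"
  proof (rule inj_onI, rule ccontr)
    fix i j assume ij: "i \<in> I" "j \<in> I" "v i = v j" "i \<noteq> j"
    let ?c = "\<lambda>k. if k = i then 1 else if k = j then -1 else (0::'a)"
    have "(\<Sum>k\<in>I. scale (?c k) (v k)) = (\<Sum>k\<in>{i,j}. scale (?c k) (v k))"
      using ij assms(1) by (intro sum.mono_neutral_right) auto
    also have "\<dots> = 0" using ij by simp
    finally have "\<forall>k\<in>I. ?c k = 0" by (rule assms(2))
    then have "?c i = 0" using ij(1) by (rule bspec)
    then show False by simp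
  qed
  have u0: "u x = 0" if u: "(\<Sum>x\<in>v ` I. scale (u x) x) = 0" and x: "x \<in> v ` I" for u x
  proof -
    have "(\<Sum>i\<in>I. scale ((u \<circ> v) i) (v i)) = 0" using u unfolding sum.reindex[OF inj] o_def .
    then have "\<forall>i\<in>I. (u \<circ> v) i = 0" by (rule assms(2))
    with x show ?thesis by auto
  qed
  show "independent (v ` I)"
    unfolding finite_independent_iff[OF finite_imageI[OF assms(1)]] using u0 by (intro allI impI ballI)
qed

lemma independent_familyD:
  assumes "finite I" "inj_on v I" "independent (v ` I)" "(\<Sum>i\<in>I. scale (c i) (v i)) = 0" "i \<in> I"
  shows "c i = 0"
proof -
  have "(\<Sum>x\<in>v ` I. scale (c (the_inv_into I v x)) x) = 0"
    unfolding sum.reindex[OF assms(2)] o_def assms(4)[symmetric]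
    by (intro sum.cong refl) (simp add: the_inv_into_f_f[OF assms(2)])
  with assms(3) have "\<forall>x\<in>v ` I. c (the_inv_into I v x) = 0"
    unfolding finite_independent_iff[OF finite_imageI[OF assms(1)]] by (elim allE impE) assumption
  then have "c (the_inv_into I v (v i)) = 0" using assms(5) by blast
  then show ?thesis by (simp add: the_inv_into_f_f[OF assms(2,5)])
qed

lemma representation_family:
  assumes "finite I" "inj_on v I" "independent (v ` I)" "i \<in> I"
  shows "representation (v ` I) (\<Sum>j\<in>I. scale (c j) (v j)) (v i) = c i"
proof -
  have "representation (v ` I) (\<Sum>j\<in>I. scale (c j) (v j)) (v i) = (\<Sum>j\<in>I. representation (v ` I) (scale (c j) (v j)) (v i))"
    by (simp add: representation_sum[OF assms(3)] span_scale span_base)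
  also have "\<dots> = (\<Sum>j\<in>I. if j = i then c j else 0)"
  proof (intro sum.cong refl)
    fix j assume j: "j \<in> I"
    show "representation (v ` I) (scale (c j) (v j)) (v i) = (if j = i then c j else 0)"
      using inj_onD[OF assms(2) _ assms(4) j] j
      by (simp add: representation_scale[OF assms(3)] span_base representation_basis[OF assms(3)]) blast
  qed
  finally show ?thesis using assms(1,4) by simp
qed

text \<open>The sum of the \<open>representation B (T b) b\<close> is the trace of T on the span.
  Expanding in both bases gives the same double sum in either order.\<close>

lemma tr_basis_change:
  assumes B: "finite B" "independent B" and C: "finite C" "independent C" and sp: "span B = span C"
    and add: "\<And>x y. T (x + y) = T x + T y" and scl: "\<And>c x. T (scale c x) = scale c (T x)"
    and T: "\<And>x. x \<in> span B \<Longrightarrow> T x \<in> span B"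
  shows "(\<Sum>b\<in>B. representation B (T b) b) = (\<Sum>b\<in>C. representation C (T b) b)"
proof -
  have T0: "T 0 = 0" using scl[of 0 0] by simp
  have Tsum: "T (\<Sum>i\<in>I. scale (f i) (g i)) = (\<Sum>i\<in>I. scale (f i) (T (g i)))" if "finite I" for I :: "'b set" and f g
    using that by (induction I rule: finite_induct) (simp_all add: T0 add scl)
  have 1: "representation B (T b) b = (\<Sum>c\<in>C. representation C (T b) c * representation B c b)" if b: "b \<in> B" for b
  proof -
    have Tb: "T b \<in> span B" using T span_base[OF b] by blast
    have "(\<Sum>c\<in>C. scale (representation C (T b) c) c) = T b"
      by (rule sum_representation_eq[OF C(2) _ C(1)]) (use Tb sp in auto)
    then have "representation B (T b) b = representation B (\<Sum>c\<in>C. scale (representation C (T b) c) c) b" by simp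
    also have "\<dots> = (\<Sum>c\<in>C. representation B (scale (representation C (T b) c) c) b)"
      by (subst representation_sum[OF B(2)]) (auto simp: sp intro: span_scale span_base)
    also have "\<dots> = (\<Sum>c\<in>C. representation C (T b) c * representation B c b)"
      by (intro sum.cong refl, subst representation_scale[OF B(2)]) (auto simp: sp intro: span_base)
    finally show ?thesis .
  qed
  have 2: "representation C (T c) c = (\<Sum>b\<in>B. representation B c b * representation C (T b) c)" if c: "c \<in> C" for c
  proof -
    have "(\<Sum>b\<in>B. scale (representation B c b) b) = c"
      by (rule sum_representation_eq[OF B(2) _ B(1)]) (use span_base[OF c] sp in auto)
    then have "T c = (\<Sum>b\<in>B. scale (representation B c b) (T b))"
      using Tsum[OF B(1), of "representation B c" "\<lambda>b. b"] by simp
    then have "representation C (T c) c = representation C (\<Sum>b\<in>B. scale (representation B c b) (T b)) c" by simp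
    also have "\<dots> = (\<Sum>b\<in>B. representation C (scale (representation B c b) (T b)) c)"
      by (subst representation_sum[OF C(2)]) (auto simp: sp[symmetric] intro: span_scale T span_base)
    also have "\<dots> = (\<Sum>b\<in>B. representation B c b * representation C (T b) c)"
      by (intro sum.cong refl, subst representation_scale[OF C(2)]) (auto simp: sp[symmetric] intro: T span_base)
    finally show ?thesis .
  qed
  have "(\<Sum>b\<in>B. representation B (T b) b) = (\<Sum>b\<in>B. \<Sum>c\<in>C. representation C (T b) c * representation B c b)"
    by (intro sum.cong refl 1)
  also have "\<dots> = (\<Sum>c\<in>C. \<Sum>b\<in>B. representation B c b * representation C (T b) c)"
    by (subst sum.swap) (simp only: mult.commute)
  also have "\<dots> = (\<Sum>b\<in>C. representation C (T b) b)" by (intro sum.cong refl 2[symmetric])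
  finally show ?thesis .
qed

text \<open>A projection has trace equal to the dimension of its image. In a basis extending one of
  V, the members in V are fixed and the others are sent into V, so that they contribute no diagonal
  entry.\<close>

lemma tr_projection:
  assumes B: "finite B" "independent B" and V: "subspace V" "V \<subseteq> span B"
    and add: "\<And>x y. P (x + y) = P x + P y" and scl: "\<And>c x. P (scale c x) = scale c (P x)"
    and P: "\<And>x. x \<in> span B \<Longrightarrow> P x \<in> V" and PV: "\<And>x. x \<in> V \<Longrightarrow> P x = x"
  shows "(\<Sum>b\<in>B. representation B (P b) b) = of_nat (dim V)"
proof -
  obtain B0 where B0: "B0 \<subseteq> V" "independent B0" "V \<subseteq> span B0" "card B0 = dim V" by (rule basis_exists)
  have "B0 \<subseteq> span B" using B0(1) V(2) by (rule subset_trans)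
  then obtain C where C: "B0 \<subseteq> C" "C \<subseteq> span B" "independent C" "span B \<subseteq> span C"
    by (rule maximal_independent_subset_extend[OF _ B0(2)])
  have finC: "finite C" using independent_span_bound[OF B(1) C(3,2)] by (rule conjunct1)
  have sp: "span B = span C" using C(4) span_minimal[OF C(2) subspace_span] by blast
  have "(\<Sum>b\<in>B. representation B (P b) b) = (\<Sum>b\<in>C. representation C (P b) b)"
    using P V(2) by (intro tr_basis_change B finC C sp add scl) blast
  also have "\<dots> = (\<Sum>b\<in>C. if b \<in> B0 then 1 else 0)"
  proof (intro sum.cong refl)
    fix b assume b: "b \<in> C"
    then have "P b \<in> V" using P C(2) by blast
    then have Pb: "P b \<in> span B0" using B0(3) by blast
    show "representation C (P b) b = (if b \<in> B0 then 1 else 0)"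
    proof (cases "b \<in> B0")
      case True
      then have "P b = b" using PV B0(1) by blast
      then show ?thesis using True b by (simp add: representation_basis[OF C(3)])
    next
      case False
      then show ?thesis
        using representation_extend[OF C(3) Pb C(1)] representation_ne_zero[of B0 "P b" b] by auto
    qed
  qed
  also have "\<dots> = of_nat (card B0)"
    using C(1) finC by (simp add: sum.If_cases Int_absorb1)
  finally show ?thesis by (simp add: B0(4))
qed

lemma dim_direct_sum:
  assumes A: "subspace A" "A \<subseteq> span F" and B: "subspace B" "B \<subseteq> span F" and F: "finite F"
    and AB: "\<And>x. x \<in> A \<Longrightarrow> x \<in> B \<Longrightarrow> x = 0" and V: "\<And>x. x \<in> V \<longleftrightarrow> (\<exists>a\<in>A. \<exists>b\<in>B. x = a + b)"
  shows "dim V = dim A + dim B"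
proof -
  obtain BA where BA: "BA \<subseteq> A" "independent BA" "A \<subseteq> span BA" "card BA = dim A" by (rule basis_exists)
  obtain BB where BB: "BB \<subseteq> B" "independent BB" "B \<subseteq> span BB" "card BB = dim B" by (rule basis_exists)
  have fin: "finite BA" "finite BB"
    using independent_span_bound[OF F BA(2)] independent_span_bound[OF F BB(2)] BA(1) BB(1) A(2) B(2) by blast+
  have spA: "span BA \<subseteq> A" by (rule span_minimal[OF BA(1) A(1)])
  have spB: "span BB \<subseteq> B" by (rule span_minimal[OF BB(1) B(1)])
  have disj: "BA \<inter> BB = {}"
  proof -
    have "0 \<notin> BA" using BA(2) dependent_zero by blast
    then show ?thesis using AB BA(1) BB(1) by blast
  qed
  have ind: "independent (BA \<union> BB)"
  proof -
    have "u x = 0" if u: "(\<Sum>x\<in>BA \<union> BB. scale (u x) x) = 0" and x: "x \<in> BA \<union> BB" for u x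
    proof -
      have e: "(\<Sum>x\<in>BA. scale (u x) x) = - (\<Sum>x\<in>BB. scale (u x) x)"
        using u by (simp add: sum.union_disjoint[OF fin disj] eq_neg_iff_add_eq_0)
      have a: "(\<Sum>x\<in>BA. scale (u x) x) \<in> A" by (intro subsetD[OF spA] span_sum span_scale; rule span_base)
      have b: "(\<Sum>x\<in>BB. scale (u x) x) \<in> B" by (intro subsetD[OF spB] span_sum span_scale; rule span_base)
      have "(\<Sum>x\<in>BA. scale (u x) x) = 0"
        using AB[OF a] subspace_neg[OF B(1) b] by (simp add: e)
      moreover from this have "(\<Sum>x\<in>BB. scale (u x) x) = 0" using e by simp
      ultimately show ?thesis
        using x BA(2) BB(2) unfolding finite_independent_iff[OF fin(1)] finite_independent_iff[OF fin(2)] by blast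
    qed
    then show ?thesis unfolding finite_independent_iff[OF finite_UnI[OF fin]] by blast
  qed
  have "V = span (BA \<union> BB)"
  proof (intro equalityI subsetI)
    fix x assume "x \<in> V"
    then obtain a b where "a \<in> A" "b \<in> B" "x = a + b" using V by blast
    then show "x \<in> span (BA \<union> BB)"
      using BA(3) BB(3) span_mono[of BA "BA \<union> BB"] span_mono[of BB "BA \<union> BB"] by (blast intro: span_add)
  next
    fix x assume "x \<in> span (BA \<union> BB)"
    then obtain a b where "a \<in> span BA" "b \<in> span BB" "x = a + b" unfolding span_Un by blast
    then show "x \<in> V" using V spA spB by blast
  qed
  then have "dim V = card (BA \<union> BB)" by (simp only: dim_span_eq_card_independent[OF ind])
  then show ?thesis using card_Un_disjoint[OF fin disj] BA(4) BB(4) by simp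
qed

end

section \<open>Molien's formula\<close>

text \<open>Uniqueness of digits in base N; the leading digit d may be arbitrarily large.\<close>

lemma kronecker_code_inj:
  fixes a b c d :: nat
  assumes "a + N * (b + N * (c + N * d)) = a' + N * (b' + N * (c' + N * d'))"
    and "a < N" "b < N" "c < N" "a' < N" "b' < N" "c' < N"
  shows "a = a' \<and> b = b' \<and> c = c' \<and> d = d'"
proof -
  have digit: "x = x' \<and> y = y'" if "x + N * y = x' + N * y'" "x < N" "x' < N" for x x' y y' :: nat
    using arg_cong[OF that(1), of "\<lambda>z. z mod N"] arg_cong[OF that(1), of "\<lambda>z. z div N"] that(2,3) by simp
  have 1: "a = a' \<and> b + N * (b0) = b' + N * b0'" if "b0 = c + N * d" "b0' = c' + N * d'" for b0 b0'
    using digit[OF assms(1) assms(2,5)] that by simp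
  then have 2: "b = b' \<and> c + N * d = c' + N * d'"
    using digit[OF _ assms(3,6)] by blast
  then have "c = c' \<and> d = d'" using digit[OF _ assms(4,7)] by blast
  with 1 2 show ?thesis by blast
qed

text \<open>Since the exponents are distinct, the sum is a polynomial with the c \<alpha> as
  coefficients, and it has infinitely many roots.\<close>

lemma power_sum_zero:
  fixes c :: "'a \<Rightarrow> complex" and k :: "'a \<Rightarrow> nat"
  assumes "finite A" "inj_on k A" "\<And>t::real. t > 0 \<Longrightarrow> (\<Sum>\<alpha>\<in>A. c \<alpha> * of_real t ^ k \<alpha>) = 0" "\<alpha> \<in> A"
  shows "c \<alpha> = 0"
proof -
  define n where "n = Max (k ` A)"
  define c' where "c' = (\<lambda>j. if j \<in> k ` A then c (the_inv_into A k j) else 0)"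
  have kn: "k \<beta> \<le> n" if "\<beta> \<in> A" for \<beta> using assms(1) that by (simp add: n_def)
  have "(\<Sum>j\<le>n. c' j * z ^ j) = (\<Sum>\<alpha>\<in>A. c \<alpha> * z ^ k \<alpha>)" for z
  proof -
    have "(\<Sum>j\<le>n. c' j * z ^ j) = (\<Sum>j\<in>k ` A. c' j * z ^ j)"
      using kn by (intro sum.mono_neutral_right) (auto simp: c'_def)
    also have "\<dots> = (\<Sum>\<alpha>\<in>A. c \<alpha> * z ^ k \<alpha>)"
      by (simp add: sum.reindex[OF assms(2)] c'_def the_inv_into_f_f[OF assms(2)])
    finally show ?thesis .
  qed
  then have "complex_of_real ` {0<..} \<subseteq> {z. (\<Sum>j\<le>n. c' j * z ^ j) = 0}" using assms(3) by auto
  moreover have "infinite (complex_of_real ` {0<..})"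
    using infinite_Ioi[of "0::real"] by (simp add: finite_image_iff inj_on_def)
  ultimately have "infinite {z. (\<Sum>j\<le>n. c' j * z ^ j) = 0}" using finite_subset by blast
  then have "c' j = 0" if "j \<le> n" for j using polyfun_finite_roots[of c' n] that by blast
  from this[of "k \<alpha>"] show ?thesis
    using assms(4) kn by (simp add: c'_def the_inv_into_f_f[OF assms(2)])
qed

lemma sum_apply: "(\<Sum>i\<in>A. f i) x = (\<Sum>i\<in>A. f i x)"
  by (induction A rule: infinite_finite_induct) simp_all

lemma standard_mon: "p \<in> S3 \<Longrightarrow> mon (\<lambda>i. axis i 1) \<alpha> p = (\<Prod>i\<in>UNIV. of_real (p $ i) ^ \<alpha> i)"
proof -
  assume p: "p \<in> S3"
  have "lf (axis i 1) p = of_real (p $ i)" for i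
    using p by (simp add: lf_def rS_def axis_def if_distrib[of "\<lambda>x. x * _"] cong: if_cong)
  moreover have "(f ^ n) p = f p ^ n" for f :: "real^4 \<Rightarrow> complex" and n
    by (induction n) simp_all
  moreover have "(\<Prod>i\<in>I. F i) p = (\<Prod>i\<in>I. F i p)" for F :: "4 \<Rightarrow> real^4 \<Rightarrow> complex" and I
    by (induction I rule: infinite_finite_induct) simp_all
  ultimately show ?thesis using p by (simp add: mon_def one_def rS_def)
qed

lemma prod_4: "prod f (UNIV::4 set) = f 1 * f 2 * f 3 * f 4"
  unfolding UNIV_4 by (simp add: ac_simps)

text \<open>Kronecker substitution: with N = n + 1, monomials of degree n become distinct powers of
  t along (t, t^N, t^(N^2), t^(N^3)). Moving the curve to S^3 only multiplies them by a common
  factor, because they all have the same degree.\<close>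

lemma standard_mon_independent:
  assumes "(\<Sum>\<alpha>\<in>exponents n. K (c \<alpha>) * mon (\<lambda>i. axis i 1) \<alpha>) = 0" "\<alpha> \<in> exponents n"
  shows "c \<alpha> = 0"
proof -
  define N where "N = Suc n"
  define k where "k = (\<lambda>\<alpha>::4 \<Rightarrow> nat. \<alpha> 1 + N * (\<alpha> 2 + N * (\<alpha> 3 + N * \<alpha> 4)))"
  have lt: "\<beta> i < N" if "\<beta> \<in> exponents n" for \<beta> i
    using that member_le_sum[of i UNIV \<beta>] by (simp add: exponents_def N_def)
  have "inj_on k (exponents n)"
  proof (rule inj_onI)
    fix \<alpha> \<beta> assume a: "\<alpha> \<in> exponents n" and b: "\<beta> \<in> exponents n" and eq: "k \<alpha> = k \<beta>"
    from kronecker_code_inj[OF eq[unfolded k_def] lt[OF a] lt[OF a] lt[OF a] lt[OF b] lt[OF b] lt[OF b]]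
    show "\<alpha> = \<beta>" by (simp add: fun_eq_iff forall_4)
  qed
  moreover have "(\<Sum>\<alpha>\<in>exponents n. c \<alpha> * of_real t ^ k \<alpha>) = 0" if t: "t > 0" for t :: real
  proof -
    \<comment> \<open>The exponents 1, N, N^2, N^3 make \<open>k \<alpha>\<close> the number with
      digits \<alpha> in base N; each digit is at most n < N.\<close>
    define q :: "real^4" where "q = vector [t, t ^ N, t ^ (N * N), t ^ (N * N * N)]"
    have qc: "q $ 1 = t ^ 1" "q $ 2 = t ^ N" "q $ 3 = t ^ (N * N)" "q $ 4 = t ^ (N * N * N)"
      by (simp_all add: q_def)
    have "q $ 1 \<noteq> 0" using t by (simp add: qc)
    then have q: "q \<noteq> 0" by auto
    define r where "r = inverse (norm q)"
    have r: "r \<noteq> 0" using q by (simp add: r_def)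
    have S: "nrm q \<in> S3" using nrm_S3[OF q] .
    have nc: "complex_of_real (nrm q $ i) = of_real r * of_real (q $ i)" for i
      by (simp add: nrm_def r_def)
    have m: "mon (\<lambda>i. axis i 1) \<alpha> (nrm q) = of_real r ^ n * of_real t ^ k \<alpha>" if "\<alpha> \<in> exponents n" for \<alpha>
    proof -
      have n: "n = \<alpha> 1 + \<alpha> 2 + \<alpha> 3 + \<alpha> 4" using that by (simp add: exponents_def sum_4)
      have k: "k \<alpha> = 1 * \<alpha> 1 + N * \<alpha> 2 + N * N * \<alpha> 3 + N * N * N * \<alpha> 4" by (simp add: k_def algebra_simps)
      show ?thesis
        unfolding standard_mon[OF S] prod_4 nc qc n k
        by (simp only: of_real_power power_mult_distrib power_mult[symmetric] power_add mult_ac)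
    qed
    have "(\<Sum>\<alpha>\<in>exponents n. K (c \<alpha>) * mon (\<lambda>i. axis i 1) \<alpha>) (nrm q) = (\<Sum>\<alpha>\<in>exponents n. c \<alpha> * mon (\<lambda>i. axis i 1) \<alpha> (nrm q))"
      by (simp only: sum_apply times_fun_apply K_apply)
    also have "\<dots> = (\<Sum>\<alpha>\<in>exponents n. of_real r ^ n * (c \<alpha> * of_real t ^ k \<alpha>))"
      by (intro sum.cong refl) (simp add: m)
    finally have "of_real r ^ n * (\<Sum>\<alpha>\<in>exponents n. c \<alpha> * of_real t ^ k \<alpha>) = 0"
      using assms(1) by (simp add: sum_distrib_left)
    then show ?thesis using r by simp
  qed
  ultimately show ?thesis by (rule power_sum_zero[OF finite_exponents _ _ assms(2)])
qed

lemma dim_FF: "cs.dim (FF n) = card (exponents n)"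
proof -
  let ?v = "mon (\<lambda>i. axis i 1)"
  have f: "inj_on ?v (exponents n)" "cs.independent (?v ` exponents n)"
    by (rule cs.independent_family[OF finite_exponents]; use standard_mon_independent in blast)+
  have "cs.dim (FF n) = card (?v ` exponents n)"
    by (rule cs.dim_unique[OF _ FF_subset_span_mon[OF standard_forms_span] f(2) refl]) (use mon_FF in blast)
  then show ?thesis by (simp only: card_image[OF f(1)])
qed

text \<open>The monomials in any spanning set of forms span \<open>FF n\<close>, and there are no
  more of them than its dimension, so they form a basis without repetitions.\<close>

lemma mon_basis:
  fixes w :: "4 \<Rightarrow> complex^4"
  assumes w: "\<And>c. \<exists>k. c = (\<Sum>i\<in>UNIV. k i *s w i)"
  shows "inj_on (mon w) (exponents n)" "cs.independent (mon w ` exponents n)"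
proof -
  let ?M = "mon w ` exponents n"
  have fin: "finite ?M" by (rule finite_imageI[OF finite_exponents])
  obtain B where B: "B \<subseteq> ?M" "cs.independent B" "?M \<subseteq> cs.span B" by (rule cs.maximal_independent_subset)
  have MF: "?M \<subseteq> FF n" using mon_FF by blast
  have "FF n \<subseteq> cs.span B"
    using FF_subset_span_mon[OF w] cs.span_minimal[OF B(3) cs.subspace_span] by (rule subset_trans)
  then have "card B = card (exponents n)"
    using cs.basis_card_eq_dim[OF subset_trans[OF B(1) MF] _ B(2)] dim_FF[of n] by (simp only:)
  moreover have "card ?M \<le> card (exponents n)" by (rule card_image_le[OF finite_exponents])
  ultimately have BM: "B = ?M" using card_seteq[OF fin B(1)] by (simp only:)
  show "cs.independent ?M" using B(2) unfolding BM .
  show "inj_on (mon w) (exponents n)"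
  proof (rule eq_card_imp_inj_on[OF finite_exponents])
    show "card ?M = card (exponents n)" using \<open>card B = card (exponents n)\<close> unfolding BM .
  qed
qed

lemma (in vector_space) span_family:
  assumes "finite I" "x \<in> span (v ` I)"
  shows "\<exists>c. x = (\<Sum>i\<in>I. scale (c i) (v i))"
  using assms(2)
proof (rule span_induct)
  show "subspace {x. \<exists>c. x = (\<Sum>i\<in>I. scale (c i) (v i))}"
  proof (rule subspaceI; clarify)
    show "\<exists>c. 0 = (\<Sum>i\<in>I. scale (c i) (v i))" by (rule exI[of _ "\<lambda>_. 0"]) simp
    show "\<exists>e. (\<Sum>i\<in>I. scale (c i) (v i)) + (\<Sum>i\<in>I. scale (c' i) (v i)) = (\<Sum>i\<in>I. scale (e i) (v i))" for c c'
      by (rule exI[of _ "\<lambda>i. c i + c' i"]) (simp add: scale_left_distrib sum.distrib)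
    show "\<exists>e. scale k (\<Sum>i\<in>I. scale (c i) (v i)) = (\<Sum>i\<in>I. scale (e i) (v i))" for k c
      by (rule exI[of _ "\<lambda>i. k * c i"]) (simp add: scale_sum_right)
  qed
  show "\<exists>c. x = (\<Sum>i\<in>I. scale (c i) (v i))" if "x \<in> v ` I" for x
  proof -
    obtain i where i: "i \<in> I" "x = v i" using \<open>x \<in> v ` I\<close> by blast
    have "(\<Sum>j\<in>I. scale (if j = i then 1 else 0) (v j)) = (\<Sum>j\<in>I. if j = i then v j else 0)"
      by (intro sum.cong refl) auto
    also have "\<dots> = x" using assms(1) i by simp
    finally show ?thesis by (intro exI[of _ "\<lambda>j. if j = i then 1 else 0"]) simp
  qed
qed

section \<open>Diagonalization of matrices of finite order\<close>

lemma sum_roots_of_unity: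
  assumes "0 < m" "j < m"
  shows "(\<Sum>k<m. inverse (exp (2 * of_real pi * \<i> * of_nat k / of_nat m)) ^ j) = (if j = 0 then of_nat m else 0)"
proof (cases "j = 0")
  case False
  define x where "x = inverse (exp (2 * of_real pi * \<i> * of_nat j / of_nat m))"
  have "inverse (exp (2 * of_real pi * \<i> * of_nat k / of_nat m)) ^ j = x ^ k" for k
  proof -
    have "exp (2 * of_real pi * \<i> * of_nat k / of_nat m) ^ j = exp (2 * of_real pi * \<i> * of_nat j / of_nat m) ^ k"
      unfolding exp_of_nat_mult[symmetric] by (rule arg_cong[where f = exp]) (simp add: mult_ac)
    then show ?thesis unfolding x_def by (simp add: power_inverse)
  qed
  moreover have "x \<noteq> 1"
  proof -
    have "\<not> m dvd j" using False assms by (auto dest: dvd_imp_le)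
    then show ?thesis using complex_root_unity_eq_1[of m j] assms by (simp add: x_def)
  qed
  moreover have "x ^ m = 1"
    unfolding x_def power_inverse using complex_root_unity[of m j] assms by simp
  ultimately show ?thesis using False geometric_sum[of x m] by simp
qed simp

text \<open>f k is the discrete Fourier component of the orbit of v: the average of \<zeta>^(-j) M^j
  v over one period, an eigenvector for the root of unity \<zeta> belonging to k. In the sum over k
  only j = 0 survives, by orthogonality of the roots of unity.\<close>

lemma finite_order_eigen_expansion:
  fixes M :: "complex^4^4"
  assumes m: "0 < m" and M: "((*v) M ^^ m) v = v"
  shows "\<exists>f :: nat \<Rightarrow> complex^4. v = (\<Sum>k<m. f k) \<and> (\<forall>k<m. \<exists>\<mu>. M *v f k = \<mu> *s f k)"
proof -
  define \<zeta> where "\<zeta> = (\<lambda>k. exp (2 * of_real pi * \<i> * of_nat k / of_nat m) :: complex)"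
  define y where "y = (\<lambda>j. ((*v) M ^^ j) v)"
  define f where "f = (\<lambda>k. inverse (of_nat m) *s (\<Sum>j<m. inverse (\<zeta> k) ^ j *s y j))"
  have y: "M *v y j = y (Suc j)" "y m = y 0" for j using M by (simp_all add: y_def)
  have \<zeta>: "\<zeta> k \<noteq> 0" "\<zeta> k ^ m = 1" for k
    using complex_root_unity[of m k] m by (simp_all add: \<zeta>_def)
  \<comment> \<open>The orbit is periodic, so sums over a period may be shifted by one.\<close>
  have shift: "(\<Sum>j<m. h (Suc j)) = (\<Sum>j<m. h j)" if "h m = h 0" for h :: "nat \<Rightarrow> complex^4"
    using sum.lessThan_Suc_shift[of h m] sum.lessThan_Suc[of h m] that by simp
  have eig: "M *v f k = \<zeta> k *s f k" for k
  proof -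
    have "M *v (\<Sum>j<m. inverse (\<zeta> k) ^ j *s y j) = (\<Sum>j<m. inverse (\<zeta> k) ^ j *s y (Suc j))"
      by (simp only: vec.linear_sum[OF matrix_vector_mul_linear_gen] vector_scalar_commute y)
    also have "\<dots> = (\<Sum>j<m. \<zeta> k *s (inverse (\<zeta> k) ^ Suc j *s y (Suc j)))"
      using \<zeta>(1)[of k] by (intro sum.cong refl) (simp add: vector_smult_assoc)
    also have "\<dots> = \<zeta> k *s (\<Sum>j<m. inverse (\<zeta> k) ^ Suc j *s y (Suc j))"
      by (simp only: vec.scale_sum_right)
    also have "(\<Sum>j<m. inverse (\<zeta> k) ^ Suc j *s y (Suc j)) = (\<Sum>j<m. inverse (\<zeta> k) ^ j *s y j)"
      by (rule shift[of "\<lambda>j. inverse (\<zeta> k) ^ j *s y j"]) (simp add: y(2) power_inverse \<zeta>(2))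
    finally show ?thesis
      unfolding f_def vector_scalar_commute by (simp only: vector_smult_assoc mult.commute)
  qed
  have "(\<Sum>k<m. f k) = inverse (of_nat m) *s (\<Sum>j<m. (\<Sum>k<m. inverse (\<zeta> k) ^ j) *s y j)"
    unfolding f_def vec.scale_sum_right[symmetric] vec.scale_sum_left by (subst sum.swap) (rule refl)
  also have "\<dots> = inverse (of_nat m) *s (\<Sum>j<m. if j = 0 then of_nat m *s y j else 0)"
    unfolding \<zeta>_def using sum_roots_of_unity[OF m]
    by (intro arg_cong2[where f = "(*s)"] refl sum.cong) auto
  also have "\<dots> = inverse (of_nat m) *s (of_nat m *s y 0)"
    using m by (simp only: sum.delta finite_lessThan lessThan_iff if_True)
  also have "\<dots> = v" using m by (simp add: vector_smult_assoc y_def)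
  finally show ?thesis using eig by (intro exI[of _ f]) auto
qed

text \<open>Every vector is a sum of eigenvectors, so four of them form a basis. Their eigenvalues
  are m-th roots of unity, hence of modulus 1, and the characteristic determinant is computed in
  this basis.\<close>

lemma finite_order_diagonalization:
  fixes M :: "complex^4^4"
  assumes m: "0 < m" and M: "\<And>v. ((*v) M ^^ m) v = v"
  obtains w :: "4 \<Rightarrow> complex^4" and \<mu> where "\<And>i. M *v w i = \<mu> i *s w i"
    "\<And>c. \<exists>k. c = (\<Sum>i\<in>UNIV. k i *s w i)" "\<And>i. norm (\<mu> i) = 1"
    "\<And>z. det (mat 1 - mat z ** M) = (\<Prod>i\<in>UNIV. 1 - z * \<mu> i)"
proof -
  define E where "E = {v. \<exists>\<mu>. M *v v = \<mu> *s v}"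
  obtain B where B: "B \<subseteq> E" "vec.independent B" "E \<subseteq> vec.span B" by (rule vec.maximal_independent_subset)
  have span: "v \<in> vec.span B" for v
  proof -
    obtain f where f: "v = (\<Sum>k<m. f k)" "\<forall>k<m. \<exists>\<mu>. M *v f k = \<mu> *s f k"
      using finite_order_eigen_expansion[OF m M] by blast
    show ?thesis unfolding f(1) by (rule vec.span_sum) (use f(2) B(3) in \<open>unfold E_def, blast\<close>)
  qed
  have fin: "finite B" using vec.independent_span_bound[OF vec.finite_Basis B(2)] by (simp add: vec.span_Basis)
  have "card B = vec.dim (UNIV :: (complex^4) set)"
    by (rule vec.basis_card_eq_dim) (use span B(2) in auto)
  then have "card B = card (UNIV :: 4 set)" by (simp only: vec_dim_card)
  then obtain w where w: "bij_betw w (UNIV :: 4 set) B"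
    using fin finite_same_card_bij[of "UNIV :: 4 set" B] by auto
  then have wB: "w ` UNIV = B" by (simp add: bij_betw_def)
  have "\<forall>i. \<exists>\<mu>. M *v w i = \<mu> *s w i" using B(1) wB by (auto simp: E_def)
  then obtain \<mu> where \<mu>: "\<And>i. M *v w i = \<mu> i *s w i" by metis
  have spanw: "\<exists>k. c = (\<Sum>i\<in>UNIV. k i *s w i)" for c
    by (rule vec.span_family[OF finite]) (use span wB in simp)
  have w0: "w i \<noteq> 0" for i using B(2) wB vec.dependent_zero[of B] by auto
  have norm: "norm (\<mu> i) = 1" for i
  proof -
    have "((*v) M ^^ j) (w i) = \<mu> i ^ j *s w i" for j
      by (induction j) (simp_all add: vector_scalar_commute \<mu> vector_smult_assoc mult.commute)
    then have "(\<mu> i ^ m - 1) *s w i = 0" using M[of "w i"] by (simp add: vec.scale_left_diff_distrib)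
    then have "\<mu> i ^ m = 1" using w0[of i] by (simp only: vec.scale_eq_0_iff right_minus_eq simp_thms)
    then have "norm (\<mu> i) ^ m = 1" by (simp flip: norm_power)
    then show ?thesis using m power_eq_imp_eq_base[of "norm (\<mu> i)" m 1] by simp
  qed
  \<comment> \<open>The columns of Q are the eigenvectors, so (1 - z M) Q = Q D with D diagonal; det
    Q cancels since the eigenvectors span.\<close>
  define Q :: "complex^4^4" where "Q = (\<chi> r i. w i $ r)"
  have Qk: "Q *v (\<chi> i. k i) = (\<Sum>i\<in>UNIV. k i *s w i)" for k
    by (simp add: Q_def matrix_vector_mult_def vec_eq_iff mult.commute)
  have "surj (\<lambda>x. Q *v x)"
    unfolding surj_def
  proof
    fix c
    obtain k where k: "c = (\<Sum>i\<in>UNIV. k i *s w i)" by (rule exE[OF spanw])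
    show "\<exists>x. c = Q *v x" by (rule exI[of _ "\<chi> i. k i"]) (simp only: Qk k)
  qed
  then obtain Q' where "Q ** Q' = mat 1" using matrix_right_invertible_surjective by blast
  then have "det Q * det Q' = 1" by (simp flip: det_mul)
  then have Q0: "det Q \<noteq> 0" by auto
  have det: "det (mat 1 - mat z ** M) = (\<Prod>i\<in>UNIV. 1 - z * \<mu> i)" for z
  proof -
    define D :: "complex^4^4" where "D = (\<chi> i j. if i = j then 1 - z * \<mu> i else 0)"
    have "M ** Q = (\<chi> r i. \<mu> i * Q $ r $ i)"
      using \<mu> by (simp add: vec_eq_iff Q_def matrix_matrix_mult_def matrix_vector_mult_def)
    then have MQ: "(\<Sum>k\<in>UNIV. M $ r $ k * Q $ k $ i) = \<mu> i * Q $ r $ i" for r i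
      by (simp add: vec_eq_iff matrix_matrix_mult_def)
    have mz: "(mat 1 - mat z ** M) $ r $ k = (if r = k then 1 else 0) - z * M $ r $ k" for r k
      by (simp add: matrix_matrix_mult_def mat_def if_distrib[of "\<lambda>x. x * _"] cong: if_cong)
    have "(mat 1 - mat z ** M) ** Q = Q ** D"
    proof (intro vec_eq_iff[THEN iffD2] allI)
      fix r i
      have "((mat 1 - mat z ** M) ** Q) $ r $ i = (\<Sum>k\<in>UNIV. ((if r = k then 1 else 0) - z * M $ r $ k) * Q $ k $ i)"
        unfolding matrix_matrix_mult_def[of _ Q] vec_lambda_beta mz ..
      also have "\<dots> = (\<Sum>k\<in>UNIV. if r = k then Q $ k $ i else 0) - z * (\<Sum>k\<in>UNIV. M $ r $ k * Q $ k $ i)"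
        by (simp add: left_diff_distrib sum_subtractf sum_distrib_left mult.assoc if_distrib[of "\<lambda>x. x * _"] cong: if_cong)
      also have "\<dots> = Q $ r $ i * (1 - z * \<mu> i)" by (simp add: MQ algebra_simps)
      also have "\<dots> = (\<Sum>k\<in>UNIV. Q $ r $ k * D $ k $ i)"
        by (simp add: D_def if_distrib[of "\<lambda>x. _ * x"] cong: if_cong)
      finally show "((mat 1 - mat z ** M) ** Q) $ r $ i = (Q ** D) $ r $ i"
        by (simp add: matrix_matrix_mult_def)
    qed
    then have "det (mat 1 - mat z ** M) * det Q = det Q * det D" by (simp only: det_mul[symmetric])
    moreover have "det D = (\<Prod>i\<in>UNIV. D $ i $ i)" by (rule det_diagonal) (simp add: D_def)
    ultimately show ?thesis using Q0 by (simp add: D_def)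
  qed
  show ?thesis by (rule that[OF \<mu> spanw norm det])
qed

text \<open>The product of the four geometric series in z \<mu>_i, expanded over all exponents and
  regrouped by total degree; the coefficient of z^n is the complete homogeneous symmetric
  polynomial.\<close>

lemma complete_symmetric_series:
  fixes \<mu> :: "4 \<Rightarrow> complex" and z :: complex
  assumes \<mu>: "\<And>i. norm (\<mu> i) = 1" and z: "norm z < 1"
  shows "summable (\<lambda>n. norm ((\<Sum>\<alpha>\<in>exponents n. \<Prod>i\<in>UNIV. \<mu> i ^ \<alpha> i) * z ^ n))"
    "(\<lambda>n. (\<Sum>\<alpha>\<in>exponents n. \<Prod>i\<in>UNIV. \<mu> i ^ \<alpha> i) * z ^ n) sums (1 / (\<Prod>i\<in>UNIV. 1 - z * \<mu> i))"
proof -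
  define F where "F = (\<lambda>\<alpha>::4 \<Rightarrow> nat. \<Prod>i\<in>UNIV. (z * \<mu> i) ^ \<alpha> i)"
  define S where "S = 1 / (\<Prod>i\<in>UNIV. 1 - z * \<mu> i)"
  have nz: "norm (z * \<mu> i) < 1" for i using \<mu> z by (simp add: norm_mult)
  have geo: "(\<lambda>n. norm (x ^ n)) summable_on UNIV" if "norm x < 1" for x :: complex
    using that by (subst summable_on_UNIV_nonneg_real_iff) (auto simp: norm_power summable_geometric)
  have geor: "(\<lambda>n. norm (x ^ n)) summable_on UNIV" "infsum (\<lambda>n. x ^ n) UNIV = 1 / (1 - x)" if "norm x < 1" for x :: real
  proof -
    show "(\<lambda>n. norm (x ^ n)) summable_on UNIV"
      using that by (subst summable_on_UNIV_nonneg_real_iff) (auto simp: power_abs summable_geometric)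
    then have "((\<lambda>n. x ^ n) has_sum infsum (\<lambda>n. x ^ n) UNIV) UNIV"
      by (intro has_sum_infsum) (rule abs_summable_summable)
    then show "infsum (\<lambda>n. x ^ n) UNIV = 1 / (1 - x)"
      by (rule sums_unique2[OF has_sum_imp_sums geometric_sums[OF that]])
  qed
  have geoc: "infsum (\<lambda>n. x ^ n) UNIV = 1 / (1 - x)" if "norm x < 1" for x :: complex
  proof -
    have "((\<lambda>n. x ^ n) has_sum infsum (\<lambda>n. x ^ n) UNIV) UNIV"
      by (rule has_sum_infsum[OF abs_summable_summable[OF geo[OF that]]])
    then show ?thesis by (rule sums_unique2[OF has_sum_imp_sums geometric_sums[OF that]])
  qed
  have "infsum (\<lambda>\<alpha>. \<Prod>i\<in>UNIV. norm (z * \<mu> i) ^ \<alpha> i) (PiE UNIV (\<lambda>_. UNIV)) = (\<Prod>i\<in>(UNIV::4 set). infsum (\<lambda>n. norm (z * \<mu> i) ^ n) UNIV)"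
    by (rule infsum_prod_PiE_abs[OF finite], rule geor(1)) (use nz in simp)
  also have "\<dots> = (\<Prod>i\<in>(UNIV::4 set). 1 / (1 - norm (z * \<mu> i)))"
    by (intro prod.cong refl geor(2)) (use nz in simp)
  \<comment> \<open>\<open>infsum\<close> has the default value 0 on families that are not summable,
    so a nonzero value establishes absolute summability.\<close>
  also have "\<dots> \<noteq> 0" using nz by (simp add: less_imp_neq)
  finally have "(\<lambda>\<alpha>. \<Prod>i\<in>(UNIV::4 set). norm (z * \<mu> i) ^ \<alpha> i) summable_on UNIV"
    using infsum_not_exists by (auto simp: PiE_UNIV_domain)
  then have absF: "(\<lambda>\<alpha>. norm (F \<alpha>)) summable_on UNIV" unfolding F_def by (simp add: prod_norm[symmetric] norm_power)
  have "infsum F (PiE UNIV (\<lambda>_. UNIV)) = (\<Prod>i\<in>(UNIV::4 set). infsum (\<lambda>n. (z * \<mu> i) ^ n) UNIV)"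
    unfolding F_def by (rule infsum_prod_PiE_abs[OF finite], rule geo, rule nz)
  also have "\<dots> = S" unfolding S_def using nz by (simp add: geoc prod_dividef)
  finally have "(F has_sum S) UNIV"
    using has_sum_infsum[OF abs_summable_summable[OF absF]] by (simp add: PiE_UNIV_domain)
  \<comment> \<open>Each exponent occurs in exactly one total degree, so the sum over all exponents
    is an iterated sum over degrees.\<close>
  moreover have "bij_betw snd (Sigma UNIV exponents) (UNIV :: (4 \<Rightarrow> nat) set)"
    by (rule bij_betwI[where g = "\<lambda>\<alpha>. (sum \<alpha> UNIV, \<alpha>)"]) (auto simp: exponents_def)
  ultimately have "((\<lambda>x. F (snd x)) has_sum S) (Sigma UNIV exponents)"
    by (simp add: has_sum_reindex_bij_betw)
  moreover have "((\<lambda>y. F (snd (n, y))) has_sum (\<Sum>\<alpha>\<in>exponents n. F \<alpha>)) (exponents n)" for n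
    using has_sum_finite[OF finite_exponents, of F n] by simp
  ultimately have hs: "((\<lambda>n. \<Sum>\<alpha>\<in>exponents n. F \<alpha>) has_sum S) UNIV" by (rule has_sum_Sigma')
  have "(\<Sum>\<alpha>\<in>exponents n. F \<alpha>) = (\<Sum>\<alpha>\<in>exponents n. \<Prod>i\<in>UNIV. \<mu> i ^ \<alpha> i) * z ^ n" for n
  proof -
    have "F \<alpha> = (\<Prod>i\<in>UNIV. \<mu> i ^ \<alpha> i) * z ^ n" if "\<alpha> \<in> exponents n" for \<alpha>
    proof -
      have "(\<Prod>i\<in>UNIV. z ^ \<alpha> i) = z ^ n" using that by (simp flip: power_sum add: exponents_def)
      then show ?thesis by (simp add: F_def power_mult_distrib prod.distrib mult.commute)
    qed
    then show ?thesis by (simp add: sum_distrib_right)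
  qed
  with hs have hs': "((\<lambda>n. (\<Sum>\<alpha>\<in>exponents n. \<Prod>i\<in>UNIV. \<mu> i ^ \<alpha> i) * z ^ n) has_sum S) UNIV" by simp
  show "(\<lambda>n. (\<Sum>\<alpha>\<in>exponents n. \<Prod>i\<in>UNIV. \<mu> i ^ \<alpha> i) * z ^ n) sums (1 / (\<Prod>i\<in>UNIV. 1 - z * \<mu> i))"
    using has_sum_imp_sums[OF hs'] by (simp add: S_def)
  have "(\<lambda>n. (\<Sum>\<alpha>\<in>exponents n. \<Prod>i\<in>UNIV. \<mu> i ^ \<alpha> i) * z ^ n) summable_on UNIV"
    using hs' by (auto simp: summable_on_def)
  then show "summable (\<lambda>n. norm ((\<Sum>\<alpha>\<in>exponents n. \<Prod>i\<in>UNIV. \<mu> i ^ \<alpha> i) * z ^ n))"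
    unfolding summable_on_iff_abs_summable_on_complex by (rule summable_on_imp_summable)
qed

declare transpose_matrix_vector [simp del]

section \<open>Vector-valued polynomials and their bases\<close>

interpretation vs: vector_space "(\<lambda>(c::complex) (X::real^4 \<Rightarrow> complex^'d::finite). (\<lambda>p. c *s X p))"
  by unfold_locales (simp_all add: fun_eq_iff vec_eq_iff algebra_simps)

definition FV :: "nat \<Rightarrow> (real^4 \<Rightarrow> complex^'d::finite) set" where
  "FV n = {u. \<forall>a. cp a u \<in> FF n}"

lemma cp_zero: "cp a 0 = 0" by (simp add: fun_eq_iff)
lemma cp_add: "cp a (u + v) = cp a u + cp a v" by (simp add: fun_eq_iff)
lemma cp_scale: "cp a (\<lambda>p. c *s u p) = K c * cp a u" by (simp add: fun_eq_iff)
lemma cp_diff: "cp a (u - v) = cp a u - cp a v" by (simp add: fun_eq_iff)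

lemma cp_eqI: "(\<And>a. cp a u = cp a v) \<Longrightarrow> u = v"
  by (simp add: fun_eq_iff vec_eq_iff)

lemma FV_subspace: "vs.subspace (FV n)"
  by (rule vs.subspaceI; unfold FV_def mem_Collect_eq cp_zero cp_add cp_scale)
    (blast intro: cs.subspace_0 cs.subspace_add cs.subspace_scale FF_subspace)+

lemma FV_VF: "FV n \<subseteq> VF"
  unfolding FV_def VF_def using FF_SF by blast

definition mv :: "(4 \<Rightarrow> complex^4) \<Rightarrow> (4 \<Rightarrow> nat) \<times> 'd \<Rightarrow> real^4 \<Rightarrow> complex^'d::finite" where
  "mv w i = (\<lambda>p. mon w (fst i) p *s axis (snd i) 1)"

lemma cp_mv: "cp b (mv w (\<alpha>, a)) = K (if a = b then 1 else 0) * mon w \<alpha>"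
  by (simp add: fun_eq_iff mv_def axis_def)

lemma cp_sum: "cp b (\<Sum>i\<in>I. (\<lambda>p. c i *s X i p)) = (\<Sum>i\<in>I. K (c i) * cp b (X i))"
  by (simp add: fun_eq_iff sum_apply)

lemma cp_sum_mv:
  "cp b (\<Sum>i\<in>exponents n \<times> UNIV. (\<lambda>p. c i *s mv w i p)) = (\<Sum>\<alpha>\<in>exponents n. K (c (\<alpha>, b)) * mon w \<alpha>)"
proof -
  have "cp b (\<Sum>i\<in>exponents n \<times> UNIV. (\<lambda>p. c i *s mv w i p)) = (\<Sum>i\<in>exponents n \<times> UNIV. K (c i) * cp b (mv w i))"
    by (rule cp_sum)
  also have "\<dots> = (\<Sum>\<alpha>\<in>exponents n. \<Sum>a\<in>UNIV. K (c (\<alpha>, a)) * cp b (mv w (\<alpha>, a)))"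
    unfolding sum.cartesian_product by (rule sum.cong[OF refl]) (simp only: case_prod_beta prod.collapse)
  also have "\<dots> = (\<Sum>\<alpha>\<in>exponents n. K (c (\<alpha>, b)) * mon w \<alpha>)"
  proof (intro sum.cong refl)
    fix \<alpha>
    have "(\<Sum>a\<in>UNIV. K (c (\<alpha>, a)) * cp b (mv w (\<alpha>, a))) = (\<Sum>a\<in>UNIV. if a = b then K (c (\<alpha>, b)) * mon w \<alpha> else 0)"
      by (intro sum.cong refl) (auto simp: cp_mv K_hom)
    then show "(\<Sum>a\<in>UNIV. K (c (\<alpha>, a)) * cp b (mv w (\<alpha>, a))) = K (c (\<alpha>, b)) * mon w \<alpha>" by simp
  qed
  finally show ?thesis .
qed

lemma mv_basis:
  fixes w :: "4 \<Rightarrow> complex^4"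
  assumes w: "\<And>c. \<exists>k. c = (\<Sum>i\<in>UNIV. k i *s w i)"
  shows "inj_on (mv w) (exponents n \<times> (UNIV :: 'd::finite set))" "vs.independent (mv w ` (exponents n \<times> (UNIV :: 'd set)))"
    and "vs.span (mv w ` (exponents n \<times> (UNIV :: 'd set))) = FV n"
proof -
  let ?I = "exponents n \<times> (UNIV :: 'd set)"
  have fin: "finite ?I" by (simp add: finite_exponents)
  note mb = mon_basis[OF w, of n]
  have ind: "\<forall>i\<in>?I. c i = 0" if "(\<Sum>i\<in>?I. (\<lambda>p. c i *s mv w i p)) = 0" for c
  proof
    fix i assume "i \<in> ?I"
    then obtain \<alpha> b where i: "i = (\<alpha>, b)" "\<alpha> \<in> exponents n" by blast
    have "(\<Sum>\<alpha>\<in>exponents n. K (c (\<alpha>, b)) * mon w \<alpha>) = 0"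
      using cp_sum_mv[of b c w n] unfolding that cp_zero by (rule sym)
    then show "c i = 0" unfolding i(1) by (rule cs.independent_familyD[OF finite_exponents mb _ i(2)])
  qed
  show "inj_on (mv w) ?I" "vs.independent (mv w ` ?I)"
    by (rule vs.independent_family[OF fin]; rule ind; assumption)+
  show "vs.span (mv w ` ?I) = FV n"
  proof (rule subset_antisym)
    show "vs.span (mv w ` ?I) \<subseteq> FV n"
    proof (rule vs.span_minimal[OF _ FV_subspace], rule image_subsetI)
      fix i assume "i \<in> ?I"
      then obtain \<alpha> b where i: "i = (\<alpha>, b)" "\<alpha> \<in> exponents n" by blast
      show "mv w i \<in> FV n" unfolding i(1) FV_def mem_Collect_eq cp_mv
        by (intro allI cs.subspace_scale[OF FF_subspace] mon_FF i(2))
    qed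
    show "FV n \<subseteq> vs.span (mv w ` ?I)"
    proof
      fix u :: "real^4 \<Rightarrow> complex^'d" assume u: "u \<in> FV n"
      have "\<forall>a. \<exists>c. cp a u = (\<Sum>\<alpha>\<in>exponents n. K (c \<alpha>) * mon w \<alpha>)"
      proof
        fix a
        have "cp a u \<in> cs.span (mon w ` exponents n)" using u FF_subset_span_mon[OF w, of n] unfolding FV_def by blast
        then show "\<exists>c. cp a u = (\<Sum>\<alpha>\<in>exponents n. K (c \<alpha>) * mon w \<alpha>)" by (rule cs.span_family[OF finite_exponents])
      qed
      then obtain c where c: "\<And>a. cp a u = (\<Sum>\<alpha>\<in>exponents n. K (c a \<alpha>) * mon w \<alpha>)" by metis
      have "u = (\<Sum>i\<in>?I. (\<lambda>p. c (snd i) (fst i) *s mv w i p))"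
        by (rule cp_eqI) (simp only: cp_sum_mv c fst_conv snd_conv)
      moreover have "(\<Sum>i\<in>?I. (\<lambda>p. c (snd i) (fst i) *s mv w i p)) \<in> vs.span (mv w ` ?I)"
        by (rule vs.span_sum, rule vs.span_scale, rule vs.span_base) blast
      ultimately show "u \<in> vs.span (mv w ` ?I)" by (simp only:)
    qed
  qed
qed

lemma FV_finite_span: "\<exists>F. finite F \<and> FV n = vs.span (F :: (real^4 \<Rightarrow> complex^'d::finite) set)"
  using mv_basis(3)[OF standard_forms_span, where 'd = 'd] finite_exponents[of n]
  by (intro exI[of _ "mv (\<lambda>i. axis i 1) ` (exponents n \<times> UNIV)"] conjI finite_imageI finite_cartesian_product finite) auto

lemma power_apply: "(f ^ n) p = f p ^ n" for f :: "real^4 \<Rightarrow> complex"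
  by (induction n) simp_all

lemma prod_apply: "(\<Prod>i\<in>I. F i) p = (\<Prod>i\<in>I. F i p)" for F :: "'i \<Rightarrow> real^4 \<Rightarrow> complex"
  by (induction I rule: infinite_finite_induct) simp_all

lemma mon_apply: "mon w \<alpha> p = one p * (\<Prod>i\<in>UNIV. lf (w i) p ^ \<alpha> i)"
  by (simp only: mon_def times_fun_apply prod_apply power_apply)

lemma orthogonal_transpose: "orthogonal_matrix h \<Longrightarrow> orthogonal_matrix (transpose h :: real^'n^'n)"
  by (simp add: orthogonal_matrix_def)

lemma lf_compose:
  assumes "orthogonal_matrix h"
  shows "lf c (transpose h *v p) = lf (cmat h *v c) p"
proof -
  have "(\<Sum>i\<in>UNIV. c $ i * complex_of_real ((transpose h *v p) $ i)) = (\<Sum>i\<in>UNIV. \<Sum>j\<in>UNIV. c $ i * (of_real (h $ j $ i) * of_real (p $ j)))"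
    by (simp add: matrix_vector_mult_def transpose_def sum_distrib_left)
  also have "\<dots> = (\<Sum>j\<in>UNIV. \<Sum>i\<in>UNIV. c $ i * (of_real (h $ j $ i) * of_real (p $ j)))" by (rule sum.swap)
  also have "\<dots> = (\<Sum>j\<in>UNIV. (cmat h *v c) $ j * of_real (p $ j))"
    by (simp add: matrix_vector_mult_def cmat_def sum_distrib_left sum_distrib_right mult_ac)
  finally show ?thesis
    unfolding lf_def rS_def orthogonal_matrix_S3[OF orthogonal_transpose[OF assms]] by simp
qed

text \<open>On monomials in eigenforms of h the substitution is diagonal, so its trace on
  \<open>FF n\<close> is the complete homogeneous symmetric polynomial in the eigenvalues.\<close>

lemma mon_compose:
  assumes "orthogonal_matrix h" "\<And>i. cmat h *v w i = \<mu> i *s w i"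
  shows "mon w \<alpha> (transpose h *v p) = (\<Prod>i\<in>UNIV. \<mu> i ^ \<alpha> i) * mon w \<alpha> p"
proof -
  have "lf (\<mu> i *s w i) p = \<mu> i * lf (w i) p" for i
    by (simp add: lf_def rS_def sum_distrib_left mult.assoc)
  moreover have "one (transpose h *v p) = one p"
    unfolding one_def rS_def orthogonal_matrix_S3[OF orthogonal_transpose[OF assms(1)]] ..
  ultimately show ?thesis
    by (simp add: mon_apply lf_compose[OF assms(1)] assms(2) power_mult_distrib prod.distrib mult_ac)
qed

section \<open>Averaging over a finite group\<close>

locale fgroup =
  fixes G :: "(real^4^4) set"
  assumes finG: "finite G" and oneG: "mat 1 \<in> G" and mulG: "g \<in> G \<Longrightarrow> h \<in> G \<Longrightarrow> g ** h \<in> G"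
    and orthG: "g \<in> G \<Longrightarrow> orthogonal_matrix g" and detG: "g \<in> G \<Longrightarrow> det g = 1"
begin

lemma cancel: "h \<in> G \<Longrightarrow> transpose h ** (h ** x) = x" "h \<in> G \<Longrightarrow> h ** (transpose h ** x) = x"
  using orthG[of h] by (simp_all add: orthogonal_matrix_def matrix_mul_assoc)

lemma mult_bij: assumes h: "h \<in> G" shows "bij_betw ((**) h) G G"
proof -
  have "inj_on ((**) h) G" by (rule inj_on_inverseI[of _ "(**) (transpose h)"]) (rule cancel(1)[OF h])
  moreover have "(**) h ` G \<subseteq> G" using mulG[OF h] by blast
  ultimately show ?thesis using endo_inj_surj[OF finG] by (simp add: bij_betw_def)
qed

text \<open>Inverses come from finiteness: left multiplication by h is an injective self-map of G,
  hence reaches the identity.\<close>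

lemma transposeG: assumes h: "h \<in> G" shows "transpose h \<in> G"
proof -
  obtain x where x: "x \<in> G" "h ** x = mat 1" using mult_bij[OF h] oneG unfolding bij_betw_def by (metis (no_types) image_iff)
  have "transpose h = x" using cancel(1)[OF h, of x] by (simp add: x(2))
  then show ?thesis using x(1) by simp
qed

text \<open>Two powers of h coincide by the pigeonhole principle, and cancelling the smaller one
  leaves a power equal to the identity.\<close>

lemma finite_order:
  assumes h: "h \<in> G"
  obtains m where "0 < m" "\<And>v. ((*v) (cmat h) ^^ m) v = v"
proof -
  let ?f = "(**) h"
  have "range (\<lambda>i. (?f ^^ i) (mat 1)) \<subseteq> G"
  proof (rule image_subsetI)
    show "(?f ^^ i) (mat 1) \<in> G" for i by (induction i) (simp_all add: oneG mulG h)
  qed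
  then have "finite (range (\<lambda>i. (?f ^^ i) (mat 1)))" using finG finite_subset by blast
  then have "\<not> inj (\<lambda>i. (?f ^^ i) (mat 1))" using finite_imageD infinite_UNIV_nat by blast
  then obtain k l where kl: "k \<noteq> l" "(?f ^^ k) (mat 1) = (?f ^^ l) (mat 1)" unfolding inj_def by blast
  obtain i j where ij: "i < j" "(?f ^^ i) (mat 1) = (?f ^^ j) (mat 1)"
  proof (cases "k < l")
    case True
    then show ?thesis using that kl(2) by blast
  next
    case False
    then have "l < k" using kl(1) by simp
    then show ?thesis using that kl(2)[symmetric] by blast
  qed
  have "inj ?f" by (rule inj_on_inverseI[of _ "(**) (transpose h)"]) (rule cancel(1)[OF h])
  then have "inj (?f ^^ i)" by (rule inj_fn)
  moreover have "(?f ^^ i) ((?f ^^ (j - i)) (mat 1)) = (?f ^^ i) (mat 1)"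
    using ij by (simp flip: funpow_add[unfolded o_def fun_eq_iff, rule_format])
  ultimately have m: "(?f ^^ (j - i)) (mat 1) = mat 1" by (rule injD)
  have "((*v) (cmat h) ^^ k) v = cmat ((?f ^^ k) (mat 1)) *v v" for k v
  proof (induction k)
    case 0
    show ?case by (simp add: cmat_def mat_def matrix_vector_mult_def vec_eq_iff if_distrib[of "\<lambda>x. x * _"]
          if_distrib[of of_real] cong: if_cong)
  next
    case (Suc k)
    have "cmat (h ** x) = cmat h ** cmat x" for x
      by (simp add: cmat_def matrix_matrix_mult_def vec_eq_iff)
    then show ?case by (simp add: Suc matrix_vector_mul_assoc)
  qed
  moreover have "cmat (mat 1) *v v = v" for v
    by (simp add: cmat_def mat_def matrix_vector_mult_def vec_eq_iff if_distrib[of "\<lambda>x. x * _"]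
        if_distrib[of of_real] cong: if_cong)
  ultimately have "((*v) (cmat h) ^^ (j - i)) v = v" for v by (simp add: m)
  then show ?thesis using that[of "j - i"] ij(1) by simp
qed

lemma eigenforms:
  assumes h: "h \<in> G"
  obtains w :: "4 \<Rightarrow> complex^4" and \<mu> where "\<And>i. cmat h *v w i = \<mu> i *s w i"
    "\<And>c. \<exists>k. c = (\<Sum>i\<in>UNIV. k i *s w i)" "\<And>i. norm (\<mu> i) = 1"
    "\<And>z. det (mat 1 - mat z ** cmat h) = (\<Prod>i\<in>UNIV. 1 - z * \<mu> i)"
proof -
  obtain m where m: "0 < m" "\<And>v. ((*v) (cmat h) ^^ m) v = v" by (rule finite_order[OF h]) blast
  show ?thesis by (rule finite_order_diagonalization[OF m]) (rule that)
qed

lemma FF_compose: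
  assumes h: "h \<in> G" and f: "f \<in> FF n"
  shows "(\<lambda>p. f (transpose h *v p)) \<in> FF n"
proof -
  obtain w :: "4 \<Rightarrow> complex^4" and \<mu> where w: "\<And>i. cmat h *v w i = \<mu> i *s w i" "\<And>c. \<exists>k. c = (\<Sum>i\<in>UNIV. k i *s w i)"
    by (rule eigenforms[OF h]) blast
  obtain c where c: "f = (\<Sum>\<alpha>\<in>exponents n. K (c \<alpha>) * mon w \<alpha>)"
    using cs.span_family[OF finite_exponents] FF_subset_span_mon[OF w(2)] f by blast
  have "(\<lambda>p. f (transpose h *v p)) = (\<Sum>\<alpha>\<in>exponents n. K (c \<alpha> * (\<Prod>i\<in>UNIV. \<mu> i ^ \<alpha> i)) * mon w \<alpha>)"
    unfolding c by (rule ext) (simp add: sum_apply mon_compose[OF orthG[OF h] w(1)] mult.assoc)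
  moreover have "\<dots> \<in> FF n" by (intro cs.subspace_sum[OF FF_subspace] cs.subspace_scale[OF FF_subspace] mon_FF)
  ultimately show ?thesis by (simp only:)
qed

end

locale grep = fgroup G for G +
  fixes \<rho> :: "real^4^4 \<Rightarrow> complex^'d^'d"
  assumes rho_mult: "g \<in> G \<Longrightarrow> h \<in> G \<Longrightarrow> \<rho> (g ** h) = \<rho> g ** \<rho> h" and rho_one: "\<rho> (mat 1) = mat 1"
begin

text \<open>The action whose fixed points among fields supported on S^3 are the \<rho>-equivariant
  ones; the transpose is the inverse.\<close>

definition act :: "real^4^4 \<Rightarrow> (real^4 \<Rightarrow> complex^'d) \<Rightarrow> real^4 \<Rightarrow> complex^'d" where
  "act h u = (\<lambda>p. \<rho> h *v u (transpose h *v p))"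

lemma act_add: "act h (u + v) = act h u + act h v"
  by (simp add: act_def fun_eq_iff matrix_vector_right_distrib)

lemma act_scale: "act h (\<lambda>p. c *s u p) = (\<lambda>p. c *s act h u p)"
  by (simp add: act_def fun_eq_iff vector_scalar_commute)

lemma cp_act: "cp a (act h u) = (\<Sum>b\<in>UNIV. K (\<rho> h $ a $ b) * (\<lambda>p. cp b u (transpose h *v p)))"
  by (simp add: fun_eq_iff act_def sum_apply matrix_vector_mult_def)

lemma act_FV:
  assumes h: "h \<in> G" and u: "u \<in> FV n" shows "act h u \<in> FV n"
  unfolding FV_def mem_Collect_eq cp_act
  using u unfolding FV_def
  by (intro allI cs.subspace_sum[OF FF_subspace] cs.subspace_scale[OF FF_subspace] FF_compose[OF h]) blast

text \<open>The Reynolds operator, a projection onto the equivariant fields.\<close>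

definition avg :: "(real^4 \<Rightarrow> complex^'d) \<Rightarrow> real^4 \<Rightarrow> complex^'d" where
  "avg u = (\<Sum>h\<in>G. (\<lambda>p. inverse (of_nat (card G)) *s act h u p))"

lemma card_G: "(of_nat (card G) :: complex) \<noteq> 0"
  using finG oneG by auto

lemma avg_add: "avg (u + v) = avg u + avg v"
proof -
  have "(\<lambda>p. k *s act h (u + v) p) = (\<lambda>p. k *s act h u p) + (\<lambda>p. k *s act h v p)" for k h
    by (simp add: act_add fun_eq_iff vector_add_ldistrib)
  then show ?thesis unfolding avg_def by (simp only: sum.distrib)
qed

lemma avg_scale: "avg (\<lambda>p. c *s u p) = (\<lambda>p. c *s avg u p)"
  by (simp add: avg_def act_scale fun_eq_iff sum_apply vec.scale_sum_right vector_smult_assoc mult.commute)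

lemma avg_FV: "u \<in> FV n \<Longrightarrow> avg u \<in> FV n"
  unfolding avg_def by (intro vs.subspace_sum[OF FV_subspace] vs.subspace_scale[OF FV_subspace] act_FV)

lemma avg_EQ: "avg u \<in> EQ G \<rho>"
  unfolding EQ_def
proof (intro CollectI ballI)
  fix k p assume k: "k \<in> G" and "p \<in> S3"
  have "act (k ** x) u (k *v p) = \<rho> k *v act x u p" if x: "x \<in> G" for x
  proof -
    have "transpose (k ** x) *v (k *v p) = transpose x *v p"
      using cancel(1)[OF k, of "mat 1"] by (simp add: matrix_transpose_mul matrix_vector_mul_assoc flip: matrix_mul_assoc)
    then show ?thesis by (simp add: act_def rho_mult[OF k x] matrix_vector_mul_assoc)
  qed
  then have "(\<Sum>x\<in>G. inverse (of_nat (card G)) *s act (k ** x) u (k *v p)) = \<rho> k *v avg u p"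
    by (simp add: avg_def sum_apply vec.linear_sum[OF matrix_vector_mul_linear_gen] vector_scalar_commute)
  moreover have "avg u (k *v p) = (\<Sum>x\<in>G. inverse (of_nat (card G)) *s act (k ** x) u (k *v p))"
    unfolding avg_def sum_apply by (rule sum.reindex_bij_betw[OF mult_bij[OF k], symmetric])
  ultimately show "avg u (k *v p) = \<rho> k *v avg u p" by simp
qed

lemma avg_invariant:
  assumes u: "u \<in> VF" "u \<in> EQ G \<rho>" shows "avg u = u"
proof -
  have "act h u p = u p" if h: "h \<in> G" for h p
  proof (cases "p \<in> S3")
    case True
    have "u (transpose h *v p) = \<rho> (transpose h) *v u p"
      using u(2) transposeG[OF h] True by (auto simp: EQ_def)
    moreover have "\<rho> h ** \<rho> (transpose h) = mat 1"
      using rho_mult[OF h transposeG[OF h]] orthG[OF h] by (simp add: orthogonal_matrix_def rho_one)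
    ultimately show ?thesis by (simp add: act_def matrix_vector_mul_assoc)
  next
    case False
    then have "transpose h *v p \<notin> S3" using orthG[OF h] by (simp add: orthogonal_transpose del: transpose_matrix_vector)
    then show ?thesis using False VF_outside[OF u(1)] by (simp add: act_def del: transpose_matrix_vector)
  qed
  then have "avg u p = (\<Sum>h\<in>G. inverse (of_nat (card G))) *s u p" for p
    unfolding vec.scale_sum_left by (simp only: avg_def sum_apply cong: sum.cong)
  then show ?thesis using card_G by (simp add: fun_eq_iff)
qed

lemma EQ_subspace: "vs.subspace (EQ G \<rho>)"
  by (rule vs.subspaceI)
    (auto simp: EQ_def matrix_vector_right_distrib vector_scalar_commute)

text \<open>The action is the tensor product of the substitution on polynomials, diagonal in the
  chosen monomials, with \<rho> h on the values. Its trace is therefore the product of the two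
  traces.\<close>

lemma trace_act:
  fixes w :: "4 \<Rightarrow> complex^4"
  assumes h: "h \<in> G" and w: "\<And>i. cmat h *v w i = \<mu> i *s w i" "\<And>c. \<exists>k. c = (\<Sum>i\<in>UNIV. k i *s w i)"
  shows "(\<Sum>b\<in>mv w ` (exponents n \<times> UNIV). vs.representation (mv w ` (exponents n \<times> UNIV)) (act h b) b)
     = (\<Sum>\<alpha>\<in>exponents n. \<Prod>i\<in>UNIV. \<mu> i ^ \<alpha> i) * (\<Sum>a\<in>UNIV. \<rho> h $ a $ a)"
proof -
  let ?I = "exponents n \<times> (UNIV :: 'd set)"
  let ?m = "\<lambda>\<alpha>. \<Prod>i\<in>UNIV. \<mu> i ^ \<alpha> i"
  have fin: "finite ?I" by (simp add: finite_exponents)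
  note b = mv_basis[OF w(2), where 'd = 'd and n = n]
  have rep: "vs.representation (mv w ` ?I) (act h (mv w (\<alpha>, a))) (mv w (\<alpha>, a)) = ?m \<alpha> * \<rho> h $ a $ a" if "\<alpha> \<in> exponents n" for \<alpha> a
  proof -
    have "act h (mv w (\<alpha>, a)) = (\<Sum>i\<in>?I. (\<lambda>p. (if fst i = \<alpha> then ?m \<alpha> * \<rho> h $ (snd i) $ a else 0) *s mv w i p))"
    proof (rule cp_eqI)
      fix c
      have "cp c (act h (mv w (\<alpha>, a))) = K (?m \<alpha> * \<rho> h $ c $ a) * mon w \<alpha>"
        unfolding cp_act
        by (rule ext) (simp add: sum_apply cp_mv mon_compose[OF orthG[OF h] w(1)] if_distrib[of "\<lambda>x. _ * x"]
            if_distrib[of "\<lambda>x. x * _"] mult_ac cong: if_cong del: transpose_matrix_vector cp_apply)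
      also have "\<dots> = (\<Sum>\<beta>\<in>exponents n. if \<beta> = \<alpha> then K (?m \<alpha> * \<rho> h $ c $ a) * mon w \<alpha> else 0)"
        using that finite_exponents by simp
      also have "\<dots> = (\<Sum>\<beta>\<in>exponents n. K (if \<beta> = \<alpha> then ?m \<alpha> * \<rho> h $ c $ a else 0) * mon w \<beta>)"
        by (intro sum.cong refl) (auto simp: K_hom)
      finally show "cp c (act h (mv w (\<alpha>, a))) = cp c (\<Sum>i\<in>?I. (\<lambda>p. (if fst i = \<alpha> then ?m \<alpha> * \<rho> h $ (snd i) $ a else 0) *s mv w i p))"
        unfolding cp_sum_mv fst_conv snd_conv .
    qed
    then show ?thesis
      using vs.representation_family[OF fin b(1,2), of "(\<alpha>, a)"] that by simp
  qed
  have "(\<Sum>b\<in>mv w ` ?I. vs.representation (mv w ` ?I) (act h b) b)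
     = (\<Sum>i\<in>?I. vs.representation (mv w ` ?I) (act h (mv w i)) (mv w i))"
    by (subst sum.reindex[OF b(1)]) (simp only: o_def)
  also have "\<dots> = (\<Sum>i\<in>?I. ?m (fst i) * \<rho> h $ (snd i) $ (snd i))"
    by (intro sum.cong refl) (use rep in auto)
  also have "\<dots> = (\<Sum>\<alpha>\<in>exponents n. \<Sum>a\<in>UNIV. ?m \<alpha> * \<rho> h $ a $ a)"
    by (simp add: sum.cartesian_product case_prod_beta)
  finally show ?thesis by (simp add: sum_product)
qed

text \<open>The dimension of the equivariant fields is the trace of the Reynolds operator, that is,
  the average of the traces of the group elements.\<close>

lemma dim_invariants:
  assumes w: "\<And>h i. h \<in> G \<Longrightarrow> cmat h *v w h i = \<mu> h i *s w h i"
    "\<And>h c. h \<in> G \<Longrightarrow> \<exists>k. c = (\<Sum>i\<in>UNIV. k i *s (w h i :: complex^4))"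
  shows "of_nat (vs.dim (FV n \<inter> EQ G \<rho>))
    = inverse (of_nat (card G)) * (\<Sum>h\<in>G. (\<Sum>\<alpha>\<in>exponents n. \<Prod>i\<in>UNIV. \<mu> h i ^ \<alpha> i) * (\<Sum>a\<in>UNIV. \<rho> h $ a $ a))"
proof -
  let ?B = "\<lambda>w. mv w ` (exponents n \<times> (UNIV :: 'd set))"
  define S where "S = ?B (\<lambda>i. axis i 1)"
  have fin: "finite (?B w)" for w by (simp add: finite_exponents)
  note st = mv_basis[OF standard_forms_span, where 'd = 'd and n = n, folded S_def]
  have finS: "finite S" unfolding S_def by (rule fin)
  have "of_nat (vs.dim (FV n \<inter> EQ G \<rho>)) = (\<Sum>b\<in>S. vs.representation S (avg b) b)"
  proof (rule vs.tr_projection[OF finS st(2), symmetric])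
    show "vs.subspace (FV n \<inter> EQ G \<rho>)" by (rule vs.subspace_inter[OF FV_subspace EQ_subspace])
    show "FV n \<inter> EQ G \<rho> \<subseteq> vs.span S" unfolding st(3) by (rule Int_lower1)
    show "avg x \<in> FV n \<inter> EQ G \<rho>" if "x \<in> vs.span S" for x
      using that avg_FV avg_EQ unfolding st(3) by blast
    show "avg x = x" if "x \<in> FV n \<inter> EQ G \<rho>" for x
      using that FV_VF by (intro avg_invariant) blast+
  qed (rule avg_add avg_scale)+
  also have "\<dots> = (\<Sum>b\<in>S. \<Sum>h\<in>G. inverse (of_nat (card G)) * vs.representation S (act h b) b)"
  proof (intro sum.cong refl)
    fix b assume b: "b \<in> S"
    have ab: "act h b \<in> vs.span S" if "h \<in> G" for h
      using act_FV[OF that] vs.span_base[OF b] unfolding st(3) by blast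
    have "vs.representation S (avg b) b = (\<Sum>h\<in>G. vs.representation S (\<lambda>p. inverse (of_nat (card G)) *s act h b p) b)"
      unfolding avg_def by (subst vs.representation_sum[OF st(2)]) (rule vs.span_scale, rule ab, assumption, rule refl)
    also have "\<dots> = (\<Sum>h\<in>G. inverse (of_nat (card G)) * vs.representation S (act h b) b)"
      by (intro sum.cong refl, subst vs.representation_scale[OF st(2) ab]) (assumption, rule refl)
    finally show "vs.representation S (avg b) b = \<dots>" .
  qed
  also have "\<dots> = (\<Sum>h\<in>G. inverse (of_nat (card G)) * (\<Sum>b\<in>S. vs.representation S (act h b) b))"
    by (subst sum.swap) (simp only: sum_distrib_left)
  also have "\<dots> = (\<Sum>h\<in>G. inverse (of_nat (card G)) * ((\<Sum>\<alpha>\<in>exponents n. \<Prod>i\<in>UNIV. \<mu> h i ^ \<alpha> i) * (\<Sum>a\<in>UNIV. \<rho> h $ a $ a)))"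
  proof (intro sum.cong refl arg_cong2[where f = "(*)"])
    fix h assume h: "h \<in> G"
    \<comment> \<open>Different elements need not share eigenforms, so each trace is evaluated in a
      basis adapted to its own h.\<close>
    note wb = mv_basis[OF w(2)[OF h], where 'd = 'd and n = n]
    have "(\<Sum>b\<in>S. vs.representation S (act h b) b) = (\<Sum>b\<in>?B (w h). vs.representation (?B (w h)) (act h b) b)"
    proof (rule vs.tr_basis_change[OF finS st(2) fin wb(2)])
      show "vs.span S = vs.span (?B (w h))" unfolding st(3) wb(3) ..
      show "act h x \<in> vs.span S" if "x \<in> vs.span S" for x using that act_FV[OF h] unfolding st(3) by blast
    qed (rule act_add act_scale)+
    also have "\<dots> = (\<Sum>\<alpha>\<in>exponents n. \<Prod>i\<in>UNIV. \<mu> h i ^ \<alpha> i) * (\<Sum>a\<in>UNIV. \<rho> h $ a $ a)"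
      by (rule trace_act[OF h w(1)[OF h] w(2)[OF h]])
    finally show "(\<Sum>b\<in>S. vs.representation S (act h b) b) = \<dots>" .
  qed
  finally show ?thesis by (simp only: sum_distrib_left)
qed

lemma molien_series:
  assumes z: "norm z < 1"
  shows "summable (\<lambda>n. norm (of_nat (vs.dim (FV n \<inter> EQ G \<rho>)) * z ^ n))"
    "(\<lambda>n. of_nat (vs.dim (FV n \<inter> EQ G \<rho>)) * z ^ n) sums
       (1 / of_nat (card G) * (\<Sum>h\<in>G. (\<Sum>a\<in>UNIV. \<rho> h $ a $ a) / det (mat 1 - mat z ** cmat h)))"
proof -
  let ?P = "\<lambda>h (w :: 4 \<Rightarrow> complex^4) \<mu>. (\<forall>i. cmat h *v w i = \<mu> i *s w i) \<and> (\<forall>c. \<exists>k. c = (\<Sum>i\<in>UNIV. k i *s w i)) \<and>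
      (\<forall>i. norm (\<mu> i) = 1) \<and> (\<forall>z. det (mat 1 - mat z ** cmat h) = (\<Prod>i\<in>UNIV. 1 - z * \<mu> i))"
  have "\<forall>h\<in>G. \<exists>x. ?P h (fst x) (snd x)"
  proof
    fix h assume "h \<in> G"
    then obtain w :: "4 \<Rightarrow> complex^4" and \<mu> where "\<And>i. cmat h *v w i = \<mu> i *s w i"
      "\<And>c. \<exists>k. c = (\<Sum>i\<in>UNIV. k i *s w i)" "\<And>i. norm (\<mu> i) = 1"
      "\<And>z. det (mat 1 - mat z ** cmat h) = (\<Prod>i\<in>UNIV. 1 - z * \<mu> i)"
      by (rule eigenforms) blast
    then show "\<exists>x. ?P h (fst x) (snd x)"
      by (intro exI[of _ "(w, \<mu>)"], unfold fst_conv snd_conv) (intro conjI allI)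
  qed
  from bchoice[OF this] obtain x where x: "\<forall>h\<in>G. ?P h (fst (x h)) (snd (x h))" by (rule exE)
  define w where "w = (\<lambda>h. fst (x h))"
  define \<mu> where "\<mu> = (\<lambda>h. snd (x h))"
  have w: "\<And>h i. h \<in> G \<Longrightarrow> cmat h *v w h i = \<mu> h i *s w h i"
    "\<And>h c. h \<in> G \<Longrightarrow> \<exists>k. c = (\<Sum>i\<in>UNIV. k i *s (w h i :: complex^4))"
    "\<And>h i. h \<in> G \<Longrightarrow> norm (\<mu> h i) = 1"
    "\<And>h z. h \<in> G \<Longrightarrow> det (mat 1 - mat z ** cmat h) = (\<Prod>i\<in>UNIV. 1 - z * \<mu> h i)"
    unfolding w_def \<mu>_def using x by blast+
  define S where "S n h = (\<Sum>\<alpha>\<in>exponents n. \<Prod>i\<in>UNIV. \<mu> h i ^ \<alpha> i)" for n h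
  define T where "T h = (\<Sum>a\<in>UNIV. \<rho> h $ a $ a)" for h
  define k :: complex where "k = inverse (of_nat (card G))"
  note series = complete_symmetric_series[OF _ z, of "\<mu> _", folded S_def]
  have eq: "of_nat (vs.dim (FV n \<inter> EQ G \<rho>)) * z ^ n = (\<Sum>h\<in>G. (k * T h) * (S n h * z ^ n))" for n
  proof -
    have "of_nat (vs.dim (FV n \<inter> EQ G \<rho>)) = k * (\<Sum>h\<in>G. S n h * T h)"
      unfolding S_def T_def k_def by (rule dim_invariants[OF w(1,2)])
    then show ?thesis by (simp only: sum_distrib_left sum_distrib_right mult_ac)
  qed
  have "(\<lambda>n. \<Sum>h\<in>G. (k * T h) * (S n h * z ^ n)) sums (\<Sum>h\<in>G. (k * T h) * (1 / (\<Prod>i\<in>UNIV. 1 - z * \<mu> h i)))"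
    by (intro sums_sum sums_mult series(2) w(3))
  also have "(\<Sum>h\<in>G. (k * T h) * (1 / (\<Prod>i\<in>UNIV. 1 - z * \<mu> h i)))
     = 1 / of_nat (card G) * (\<Sum>h\<in>G. T h / det (mat 1 - mat z ** cmat h))"
    unfolding sum_distrib_left by (intro sum.cong refl) (simp add: w(4) k_def divide_inverse mult_ac)
  finally show "(\<lambda>n. of_nat (vs.dim (FV n \<inter> EQ G \<rho>)) * z ^ n) sums
       (1 / of_nat (card G) * (\<Sum>h\<in>G. (\<Sum>a\<in>UNIV. \<rho> h $ a $ a) / det (mat 1 - mat z ** cmat h)))"
    unfolding eq T_def .
  have "summable (\<lambda>n. \<Sum>h\<in>G. norm (k * T h) * norm (S n h * z ^ n))"
    by (intro summable_sum summable_mult series(1) w(3))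
  then show "summable (\<lambda>n. norm (of_nat (vs.dim (FV n \<inter> EQ G \<rho>)) * z ^ n))"
  proof (rule summable_comparison_test'[where N = 0])
    show "norm (norm (of_nat (vs.dim (FV n \<inter> EQ G \<rho>)) * z ^ n))
      \<le> (\<Sum>h\<in>G. norm (k * T h) * norm (S n h * z ^ n))" for n
      unfolding eq norm_mult[symmetric] real_norm_def abs_norm_cancel by (rule norm_sum)
  qed
qed

end

section \<open>Curl and the Laplacian on equivariant fields\<close>

text \<open>Linearity is asked on V only, which suits operators such as \<open>gradv\<close> whose
  additivity is established for smooth fields.\<close>

lemma dim_injective_image:
  fixes s1 :: "'a::field \<Rightarrow> 'b::ab_group_add \<Rightarrow> 'b" and s2 :: "'a \<Rightarrow> 'c::ab_group_add \<Rightarrow> 'c"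
  assumes "vector_space s1" "vector_space s2"
    and V: "module.subspace s1 V" "finite F" "V \<subseteq> module.span s1 F"
    and add: "\<And>x y. x \<in> V \<Longrightarrow> y \<in> V \<Longrightarrow> f (x + y) = f x + f y"
    and scl: "\<And>c x. x \<in> V \<Longrightarrow> f (s1 c x) = s2 c (f x)"
    and inj: "\<And>x. x \<in> V \<Longrightarrow> f x = 0 \<Longrightarrow> x = 0"
  shows "vector_space.dim s2 (f ` V) = vector_space.dim s1 V"
proof -
  interpret v1: vector_space s1 by fact
  interpret v2: vector_space s2 by fact
  obtain B where B: "B \<subseteq> V" "v1.independent B" "V \<subseteq> v1.span B" "card B = v1.dim V" by (rule v1.basis_exists)
  have fin: "finite B"
    using v1.independent_span_bound[OF V(2) B(2) subset_trans[OF B(1) V(3)]] by (rule conjunct1)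
  have spB: "v1.span B \<subseteq> V" by (rule v1.span_minimal[OF B(1) V(1)])
  have f0: "f 0 = 0" using scl[of 0 0] v1.subspace_0[OF V(1)] by simp
  have fsum: "f (\<Sum>b\<in>S. s1 (c b) b) = (\<Sum>b\<in>S. s2 (c b) (f b))" if "S \<subseteq> B" for S c
    using finite_subset[OF that fin] that
  proof (induction S rule: finite_induct)
    case empty
    show ?case by (simp add: f0)
  next
    case (insert x S)
    have S: "(\<Sum>b\<in>S. s1 (c b) b) \<in> V"
      using insert.prems B(1) by (intro v1.subspace_sum[OF V(1)] v1.subspace_scale[OF V(1)]) blast
    have x: "x \<in> V" using insert.prems B(1) by blast
    show ?case using insert
      by (simp add: add[OF v1.subspace_scale[OF V(1) x] S] scl[OF x])
  qed
  have ind: "\<forall>b\<in>B. c b = 0" if "(\<Sum>b\<in>B. s2 (c b) (f b)) = 0" for c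
  proof -
    have S: "(\<Sum>b\<in>B. s1 (c b) b) \<in> V"
      using B(1) by (intro v1.subspace_sum[OF V(1)] v1.subspace_scale[OF V(1)]) blast
    have "(\<Sum>b\<in>B. s1 (c b) b) = 0" by (rule inj[OF S]) (simp only: fsum[OF subset_refl] that)
    then show ?thesis using B(2) unfolding v1.finite_independent_iff[OF fin] by blast
  qed
  have fB: "inj_on f B" "v2.independent (f ` B)"
    by (rule v2.independent_family[OF fin]; rule ind; assumption)+
  have "f ` V \<subseteq> v2.span (f ` B)"
  proof (rule image_subsetI)
    fix x assume "x \<in> V"
    then have "x \<in> v1.span ((\<lambda>b. b) ` B)" using B(3) by auto
    then obtain c where c: "x = (\<Sum>b\<in>B. s1 (c b) b)" using v1.span_family[OF fin, of x "\<lambda>b. b"] by blast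
    show "f x \<in> v2.span (f ` B)"
      unfolding c fsum[OF subset_refl] by (intro v2.span_sum v2.span_scale v2.span_base imageI)
  qed
  then have "v2.dim (f ` V) = card (f ` B)"
    by (intro v2.dim_unique[OF image_mono[OF B(1)] _ fB(2) refl])
  then show ?thesis by (simp only: card_image[OF fB(1)] B(4))
qed

context frame
begin

text \<open>Chain rule: g carries the direction J_a p to a combination of the J_b at g p with
  coefficients from column a of \<open>R g\<close>, and orthogonality inverts this. The functions f
  i are arbitrary, so that the lemma applies again to first derivatives.\<close>

lemma d_equivariant:
  assumes g: "orthogonal_matrix g" "det g = 1" and h: "h \<in> SF" and f: "\<And>i. i \<in> I \<Longrightarrow> f i \<in> SF"
    and eq: "\<And>q. q \<in> S3 \<Longrightarrow> h (g *v q) = (\<Sum>i\<in>I. c i * f i q)" and p: "p \<in> S3"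
  shows "d b h (g *v p) = (\<Sum>a\<in>UNIV. of_real (R g $ b $ a) * (\<Sum>i\<in>I. c i * d a (f i) p))"
proof -
  obtain F where F: "smooth F" "h = rS F" using h by (auto simp: SF_def)
  define A where "A = frechet_derivative F (at (g *v p))"
  have A: "(F has_derivative A) (at (g *v p))" unfolding A_def by (rule smooth_has_derivative[OF F(1)])
  have l: "linear A" by (rule has_derivative_linear[OF A])
  have gp: "g *v p \<in> S3" using g p by simp
  have dh: "d b h (g *v p) = A (JM s b *v (g *v p))" for b
    using gp unfolding F(2) d_rS[OF F(1)] by (simp add: rS_def DJ_def A_def)
  have *: "(\<Sum>b\<in>UNIV. of_real (R g $ b $ a) * d b h (g *v p)) = (\<Sum>i\<in>I. c i * d a (f i) p)" for a
  proof -
    have "((\<lambda>t. g *v rot a t p) has_vector_derivative g *v (JM s a *v p)) (at 0)"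
      using bounded_linear.has_vector_derivative[OF matrix_vector_mul_bounded_linear[of g] rot_derivative[of a p 0]] by simp
    then have "((\<lambda>t. F (g *v rot a t p)) has_vector_derivative A (g *v (JM s a *v p))) (at 0)"
      using vector_derivative_diff_chain_within[of "\<lambda>t. g *v rot a t p" _ 0 UNIV F A] A
      by (simp add: o_def has_derivative_at_withinI)
    moreover have "F (g *v rot a t p) = (\<Sum>i\<in>I. c i * f i (rot a t p))" for t
      using eq[of "rot a t p"] p g by (simp add: F(2) rS_def)
    moreover have "((\<lambda>t. \<Sum>i\<in>I. c i * f i (rot a t p)) has_vector_derivative (\<Sum>i\<in>I. c i * d a (f i) p)) (at 0)"
      by (intro has_vector_derivative_sum has_vector_derivative_mult_right d_has_vector_derivative_0 f)
    ultimately have "A (g *v (JM s a *v p)) = (\<Sum>i\<in>I. c i * d a (f i) p)"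
      using vector_derivative_unique_at by fastforce
    moreover have "A (g *v (JM s a *v p)) = (\<Sum>b\<in>UNIV. of_real (R g $ b $ a) * d b h (g *v p))"
      unfolding JM_intertwine[OF g] dh linear_sum[OF l] linear_cmul[OF l] by (simp only: scaleR_conv_of_real)
    ultimately show ?thesis by simp
  qed
  have RR: "(\<Sum>a\<in>UNIV. R g $ b $ a * R g $ e $ a) = (if b = e then 1 else 0)" for b e
  proof -
    have "(R g ** transpose (R g)) $ b $ e = (mat 1 :: real^3^3) $ b $ e"
      using R_orthogonal[OF g] by (simp add: orthogonal_matrix_def)
    then show ?thesis by (simp add: matrix_matrix_mult_def transpose_def mat_def)
  qed
  have "(\<Sum>a\<in>UNIV. of_real (R g $ b $ a) * (\<Sum>i\<in>I. c i * d a (f i) p))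
      = (\<Sum>a\<in>UNIV. \<Sum>e\<in>UNIV. of_real (R g $ b $ a) * (of_real (R g $ e $ a) * d e h (g *v p)))"
    unfolding *[symmetric] by (simp only: sum_distrib_left)
  also have "\<dots> = (\<Sum>e\<in>UNIV. \<Sum>a\<in>UNIV. of_real (R g $ b $ a) * (of_real (R g $ e $ a) * d e h (g *v p)))"
    by (rule sum.swap)
  also have "\<dots> = (\<Sum>e\<in>UNIV. of_real (\<Sum>a\<in>UNIV. R g $ b $ a * R g $ e $ a) * d e h (g *v p))"
    by (simp only: of_real_sum of_real_mult sum_distrib_right mult.assoc)
  also have "\<dots> = (\<Sum>e\<in>UNIV. if b = e then d e h (g *v p) else 0)"
    unfolding RR by (intro sum.cong refl) simp
  finally show ?thesis by simp
qed

lemma R_columns: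
  assumes "orthogonal_matrix g" "det g = 1"
  shows "(\<Sum>b\<in>UNIV. R g $ b $ a * R g $ b $ e) = (if a = e then 1 else 0)"
proof -
  have "(transpose (R g) ** R g) $ a $ e = (mat 1 :: real^3^3) $ a $ e"
    using R_orthogonal[OF assms] by (simp add: orthogonal_matrix_def)
  then show ?thesis by (simp add: matrix_matrix_mult_def transpose_def mat_def)
qed

section \<open>Gradient, divergence and curl of equivariant fields\<close>

definition Lapv :: "(real^4 \<Rightarrow> complex^'d) \<Rightarrow> real^4 \<Rightarrow> complex^'d::finite" where
  "Lapv u = (\<lambda>p. \<chi> a. Lap (cp a u) p)"

text \<open>Scalar functions are taken with values in \<open>complex^1\<close>, so that equivariance
  and Molien's formula have one form for the trivial and the three-dimensional
  representation.\<close>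

definition gradv :: "(real^4 \<Rightarrow> complex^1) \<Rightarrow> real^4 \<Rightarrow> complex^3" where
  "gradv v = (\<lambda>p. \<chi> a. d a (cp 1 v) p)"

definition divv :: "(real^4 \<Rightarrow> complex^3) \<Rightarrow> real^4 \<Rightarrow> complex^1" where
  "divv u = (\<lambda>p. \<chi> i. \<Sum>a\<in>UNIV. d a (cp a u) p)"

lemma cp_Lapv [simp]: "cp a (Lapv u) = Lap (cp a u)" by (simp add: Lapv_def cp_def)
lemma cp_gradv [simp]: "cp a (gradv v) = d a (cp 1 v)" by (simp add: gradv_def cp_def)
lemma cp_divv [simp]: "cp i (divv u) = d 1 (cp 1 u) + d 2 (cp 2 u) + d 3 (cp 3 u)"
  by (simp add: divv_def fun_eq_iff sum_3)

lemma cp_CC: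
  "cp 1 (CC u) = K (of_real (2 * s)) * cp 1 u - (d 2 (cp 3 u) - d 3 (cp 2 u))"
  "cp 2 (CC u) = K (of_real (2 * s)) * cp 2 u - (d 3 (cp 1 u) - d 1 (cp 3 u))"
  "cp 3 (CC u) = K (of_real (2 * s)) * cp 3 u - (d 1 (cp 2 u) - d 2 (cp 1 u))"
  by (simp_all add: fun_eq_iff CC_def)

lemma VF_cp: "u \<in> VF \<Longrightarrow> cp a u \<in> SF" by (simp add: VF_def)

lemma gradv_VF: "v \<in> VF \<Longrightarrow> gradv v \<in> VF" by (simp add: VF_def d_SF)
lemma divv_VF: "u \<in> VF \<Longrightarrow> divv u \<in> VF" by (simp add: VF_def d_SF SF_add)

lemma EQ_component:
  "u \<in> EQ G \<rho> \<Longrightarrow> g \<in> G \<Longrightarrow> p \<in> S3 \<Longrightarrow> cp c u (g *v p) = (\<Sum>e\<in>UNIV. \<rho> g $ c $ e * cp e u p)"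
  by (simp add: EQ_def matrix_vector_mult_def)

lemma EQ_I:
  "(\<And>g p c. g \<in> G \<Longrightarrow> p \<in> S3 \<Longrightarrow> cp c u (g *v p) = (\<Sum>e\<in>UNIV. \<rho> g $ c $ e * cp e u p)) \<Longrightarrow> u \<in> EQ G \<rho>"
  by (simp add: EQ_def matrix_vector_mult_def vec_eq_iff)

lemma d_cp_equivariant:
  assumes g': "orthogonal_matrix g" "det g = 1" and u: "u \<in> VF" "u \<in> EQ G \<rho>" and g: "g \<in> G" and p: "p \<in> S3"
  shows "d b (cp c u) (g *v p) = (\<Sum>a\<in>UNIV. of_real (R g $ b $ a) * (\<Sum>e\<in>UNIV. \<rho> g $ c $ e * d a (cp e u) p))"
  by (rule d_equivariant[OF g' VF_cp[OF u(1)] VF_cp[OF u(1)] EQ_component[OF u(2) g] p])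

lemma Lapv_EQ:
  assumes G: "\<And>g. g \<in> G \<Longrightarrow> orthogonal_matrix g \<and> det g = 1" and u: "u \<in> VF" "u \<in> EQ G \<rho>"
  shows "Lapv u \<in> EQ G \<rho>"
proof (rule EQ_I)
  fix g p c assume g: "g \<in> G" and p: "p \<in> S3"
  have g': "orthogonal_matrix g" "det g = 1" using G[OF g] by auto
  have uS: "cp e u \<in> SF" for e by (rule VF_cp[OF u(1)])
  \<comment> \<open>The first derivatives, indexed by direction and component, serve as the
    functions on the right when \<open>d_equivariant\<close> is applied a second time.\<close>
  define f where "f i = d (fst i) (cp (snd i) u)" for i :: "3 \<times> 'a"
  have 1: "d b (cp c u) (g *v q) = (\<Sum>i\<in>UNIV. (of_real (R g $ b $ (fst i)) * \<rho> g $ c $ (snd i)) * f i q)" if "q \<in> S3" for b q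
    unfolding d_cp_equivariant[OF g' u g that] f_def UNIV_Times_UNIV[symmetric]
    by (simp only: sum.cartesian_product' sum_distrib_left fst_conv snd_conv mult.assoc)
  have 2: "d b (d b (cp c u)) (g *v p) = (\<Sum>a'\<in>UNIV. of_real (R g $ b $ a') * (\<Sum>i\<in>UNIV. (of_real (R g $ b $ (fst i)) * \<rho> g $ c $ (snd i)) * d a' (f i) p))" for b
    by (rule d_equivariant[OF g' d_SF[OF uS] _ 1 p]) (simp_all add: f_def d_SF uS)
  have "(\<Sum>b\<in>UNIV. d b (d b (cp c u)) (g *v p))
     = (\<Sum>b\<in>UNIV. \<Sum>a'\<in>UNIV. \<Sum>i\<in>UNIV. of_real (R g $ b $ a' * R g $ b $ (fst i)) * (\<rho> g $ c $ (snd i) * d a' (f i) p))"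
    unfolding 2 by (simp only: sum_distrib_left of_real_mult mult_ac)
  also have "\<dots> = (\<Sum>a'\<in>UNIV. \<Sum>b\<in>UNIV. \<Sum>i\<in>UNIV. of_real (R g $ b $ a' * R g $ b $ (fst i)) * (\<rho> g $ c $ (snd i) * d a' (f i) p))"
    by (rule sum.swap)
  also have "\<dots> = (\<Sum>a'\<in>UNIV. \<Sum>i\<in>UNIV. \<Sum>b\<in>UNIV. of_real (R g $ b $ a' * R g $ b $ (fst i)) * (\<rho> g $ c $ (snd i) * d a' (f i) p))"
    by (intro sum.cong refl sum.swap)
  also have "\<dots> = (\<Sum>a'\<in>UNIV. \<Sum>i\<in>UNIV. of_real (if a' = fst i then 1 else 0) * (\<rho> g $ c $ (snd i) * d a' (f i) p))"
    unfolding sum_distrib_right[symmetric] of_real_sum[symmetric] R_columns[OF g'] ..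
  also have "\<dots> = (\<Sum>a'\<in>UNIV. \<Sum>a\<in>UNIV. \<Sum>e\<in>UNIV. of_real (if a' = a then 1 else 0) * (\<rho> g $ c $ e * d a' (d a (cp e u)) p))"
    unfolding UNIV_Times_UNIV[symmetric] by (simp only: sum.cartesian_product' f_def fst_conv snd_conv)
  also have "\<dots> = (\<Sum>a'\<in>UNIV. \<Sum>a\<in>UNIV. if a' = a then \<Sum>e\<in>UNIV. \<rho> g $ c $ e * d a' (d a (cp e u)) p else 0)"
    by (intro sum.cong refl) auto
  also have "\<dots> = (\<Sum>a\<in>UNIV. \<Sum>e\<in>UNIV. \<rho> g $ c $ e * d a (d a (cp e u)) p)" by simp
  also have "\<dots> = (\<Sum>e\<in>UNIV. \<rho> g $ c $ e * (\<Sum>a\<in>UNIV. d a (d a (cp e u)) p))"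
    by (subst sum.swap) (simp only: sum_distrib_left)
  finally show "cp c (Lapv u) (g *v p) = (\<Sum>e\<in>UNIV. \<rho> g $ c $ e * cp e (Lapv u) p)"
    by (simp add: Lap_def sum_apply sum_negf)
qed

definition triv :: "real^4^4 \<Rightarrow> complex^1^1" where "triv g = mat 1"

lemma gradv_EQ:
  assumes G: "\<And>g. g \<in> G \<Longrightarrow> orthogonal_matrix g \<and> det g = 1" and v: "v \<in> VF" "v \<in> EQ G triv"
  shows "gradv v \<in> EQ G cR"
proof (rule EQ_I)
  fix g p c assume g: "g \<in> G" and p: "p \<in> S3"
  have g': "orthogonal_matrix g" "det g = 1" using G[OF g] by auto
  show "cp c (gradv v) (g *v p) = (\<Sum>e\<in>UNIV. cR g $ c $ e * cp e (gradv v) p)"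
    unfolding cp_gradv d_cp_equivariant[OF g' v g p] by (simp add: triv_def mat_def cR_def)
qed

lemma divv_EQ:
  assumes G: "\<And>g. g \<in> G \<Longrightarrow> orthogonal_matrix g \<and> det g = 1" and u: "u \<in> VF" "u \<in> EQ G cR"
  shows "divv u \<in> EQ G triv"
proof (rule EQ_I)
  fix g p and c :: 1 assume g: "g \<in> G" and p: "p \<in> S3"
  have g': "orthogonal_matrix g" "det g = 1" using G[OF g] by auto
  have "(\<Sum>b\<in>UNIV. d b (cp b u) (g *v p)) = (\<Sum>b\<in>UNIV. \<Sum>a\<in>UNIV. \<Sum>e\<in>UNIV. of_real (R g $ b $ a * R g $ b $ e) * d a (cp e u) p)"
    unfolding d_cp_equivariant[OF g' u g p] by (simp only: cR_def vec_lambda_beta sum_distrib_left of_real_mult mult.assoc)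
  also have "\<dots> = (\<Sum>a\<in>UNIV. \<Sum>b\<in>UNIV. \<Sum>e\<in>UNIV. of_real (R g $ b $ a * R g $ b $ e) * d a (cp e u) p)" by (rule sum.swap)
  also have "\<dots> = (\<Sum>a\<in>UNIV. \<Sum>e\<in>UNIV. \<Sum>b\<in>UNIV. of_real (R g $ b $ a * R g $ b $ e) * d a (cp e u) p)"
    by (intro sum.cong refl sum.swap)
  also have "\<dots> = (\<Sum>a\<in>UNIV. \<Sum>e\<in>UNIV. of_real (if a = e then 1 else 0) * d a (cp e u) p)"
    unfolding sum_distrib_right[symmetric] of_real_sum[symmetric] R_columns[OF g'] ..
  also have "\<dots> = (\<Sum>a\<in>UNIV. d a (cp a u) p)"
  proof (intro sum.cong refl)
    fix a :: 3
    have "(\<Sum>e\<in>UNIV. of_real (if a = e then 1 else 0) * d a (cp e u) p) = (\<Sum>e\<in>UNIV. if a = e then d a (cp e u) p else 0)"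
      by (intro sum.cong refl) simp
    then show "(\<Sum>e\<in>UNIV. of_real (if a = e then 1 else 0) * d a (cp e u) p) = d a (cp a u) p" by simp
  qed
  finally show "cp c (divv u) (g *v p) = (\<Sum>e\<in>UNIV. triv g $ c $ e * cp e (divv u) p)"
    by (simp add: triv_def mat_def sum_3)
qed

text \<open>The antisymmetrized derivatives transform by 2x2 minors of \<open>R g\<close>, which
  \<open>R_cross\<close> identifies with the entries of \<open>R g\<close> itself.\<close>

lemma CC_EQ:
  assumes G: "\<And>g. g \<in> G \<Longrightarrow> orthogonal_matrix g \<and> det g = 1" and u: "u \<in> VF" "u \<in> EQ G cR"
  shows "CC u \<in> EQ G cR"
proof (rule EQ_I)
  fix g p and c :: 3 assume g: "g \<in> G" and p: "p \<in> S3"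
  have g': "orthogonal_matrix g" "det g = 1" using G[OF g] by auto
  have D: "d b (cp c u) (g *v p) = (\<Sum>a\<in>UNIV. of_real (R g $ b $ a) * (\<Sum>e\<in>UNIV. of_real (R g $ c $ e) * d a (cp e u) p))" for b c
    unfolding d_cp_equivariant[OF g' u g p] by (simp only: cR_def vec_lambda_beta)
  have U: "cp c u (g *v p) = (\<Sum>e\<in>UNIV. of_real (R g $ c $ e) * cp e u p)" for c
    unfolding EQ_component[OF u(2) g p] by (simp only: cR_def vec_lambda_beta)
  have X: "complex_of_real (R g $ i $ j) = of_real y" if "R g $ i $ j = y" for i j y using that by simp
  note X = R_cross[OF g', THEN X, unfolded of_real_diff of_real_mult]
  have m: "cp 1 (CC u) q = of_real (2 * s) * cp 1 u q - (d 2 (cp 3 u) q - d 3 (cp 2 u) q)"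
    "cp 2 (CC u) q = of_real (2 * s) * cp 2 u q - (d 3 (cp 1 u) q - d 1 (cp 3 u) q)"
    "cp 3 (CC u) q = of_real (2 * s) * cp 3 u q - (d 1 (cp 2 u) q - d 2 (cp 1 u) q)" for q
    by (simp_all add: cp_CC del: cp_apply)
  have "cp 1 (CC u) (g *v p) = (\<Sum>e\<in>UNIV. cR g $ 1 $ e * cp e (CC u) p)"
    unfolding sum_3 cR_def vec_lambda_beta m D U X(2,5,8) by (simp add: algebra_simps del: cp_apply)
  moreover have "cp 2 (CC u) (g *v p) = (\<Sum>e\<in>UNIV. cR g $ 2 $ e * cp e (CC u) p)"
    unfolding sum_3 cR_def vec_lambda_beta m D U X(3,6,9) by (simp add: algebra_simps del: cp_apply)
  moreover have "cp 3 (CC u) (g *v p) = (\<Sum>e\<in>UNIV. cR g $ 3 $ e * cp e (CC u) p)"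
    unfolding sum_3 cR_def vec_lambda_beta m D U X(1,4,7) by (simp add: algebra_simps del: cp_apply)
  ultimately show "cp c (CC u) (g *v p) = (\<Sum>e\<in>UNIV. cR g $ c $ e * cp e (CC u) p)"
    using exhaust_3[of c] by (elim disjE) (simp_all only:)
qed

end

abbreviation sm :: "complex \<Rightarrow> (real^4 \<Rightarrow> complex^'d) \<Rightarrow> real^4 \<Rightarrow> complex^'d::finite" where
  "sm c u \<equiv> (\<lambda>p. c *s u p)"

lemma VF_subspace: "vs.subspace VF"
  by (rule vs.subspaceI; unfold VF_def mem_Collect_eq cp_zero cp_add cp_scale)
    (blast intro: SF_zero SF_add SF_K_mult)+

lemma VF_diff: "u \<in> VF \<Longrightarrow> v \<in> VF \<Longrightarrow> u - v \<in> VF"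
  by (rule vs.subspace_diff[OF VF_subspace])
lemma VF_add: "u \<in> VF \<Longrightarrow> v \<in> VF \<Longrightarrow> u + v \<in> VF"
  by (rule vs.subspace_add[OF VF_subspace])
lemma VF_sm: "u \<in> VF \<Longrightarrow> sm c u \<in> VF"
  by (rule vs.subspace_scale[OF VF_subspace])

context frame
begin

text \<open>A constant of its own, so that the simplifier does not split the factor 2 s off.\<close>
definition S2 :: "real^4 \<Rightarrow> complex" where "S2 = K (of_real (2 * s))"

lemma S2_SF: "f \<in> SF \<Longrightarrow> S2 * f \<in> SF" unfolding S2_def by (rule SF_K_mult)
lemma d_S2: "f \<in> SF \<Longrightarrow> d a (S2 * f) = S2 * d a f" unfolding S2_def by (rule d_K_mult)

text \<open>The commutators oriented so that rewriting sorts derivatives by increasing index.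
  Identities between differential operators in the frame then follow by comparing normal
  forms.\<close>

lemma normal_order:
  assumes "f \<in> SF"
  shows "d 2 (d 1 f) = d 1 (d 2 f) - S2 * d 3 f" "d 3 (d 2 f) = d 2 (d 3 f) - S2 * d 1 f"
    "d 3 (d 1 f) = d 1 (d 3 f) + S2 * d 2 f"
  using d_commutators[OF assms] unfolding S2_def by simp_all

lemmas SF_intros = SF_add SF_diff S2_SF d_SF SF_minus Lap_SF SF_K_mult
lemmas d_linear = d_add d_diff d_S2 d_minus

text \<open>Up to sign \<open>Lap\<close> is the Casimir element of the Lie algebra spanned by the
  three derivations, hence central.\<close>

lemma Lap_d: assumes f: "f \<in> SF" shows "Lap (d a f) = d a (Lap f)"
  using exhaust_3[of a]
  by (elim disjE) (simp_all add: Lap_def sum_3 d_linear SF_intros f normal_order algebra_simps)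

lemma cp_CC': "cp 1 (CC u) = S2 * cp 1 u - (d 2 (cp 3 u) - d 3 (cp 2 u))"
  "cp 2 (CC u) = S2 * cp 2 u - (d 3 (cp 1 u) - d 1 (cp 3 u))"
  "cp 3 (CC u) = S2 * cp 3 u - (d 1 (cp 2 u) - d 2 (cp 1 u))"
  unfolding S2_def by (rule cp_CC)+

lemma cp_S2: "cp a (sm (of_real (2 * s)) u) = S2 * cp a u"
  unfolding S2_def by (rule cp_scale)

lemma cp_eqI3: "cp 1 u = cp 1 v \<Longrightarrow> cp 2 u = cp 2 v \<Longrightarrow> cp 3 u = cp (3::3) v \<Longrightarrow> u = v"
  by (rule cp_eqI) (metis exhaust_3)

text \<open>The analogue of curl curl = grad div - Laplacian on R^3, with \<open>Lapv\<close> the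
  nonnegative Laplacian. The extra multiple of \<open>CC u\<close> combines the commutators of the
  derivations with the zeroth-order term of \<open>CC\<close>.\<close>

lemma CC_CC:
  assumes u: "u \<in> VF"
  shows "CC (CC u) = sm (of_real (2 * s)) (CC u) + gradv (divv u) + Lapv u"
proof -
  note c = VF_cp[OF u]
  show ?thesis
    by (rule cp_eqI3; unfold cp_add cp_S2 cp_gradv cp_divv cp_Lapv cp_CC' Lap_def sum_3)
      (simp_all add: d_linear SF_intros c normal_order algebra_simps)
qed

lemma divv_CC: assumes u: "u \<in> VF" shows "divv (CC u) = 0"
proof -
  note c = VF_cp[OF u]
  show ?thesis
    by (rule cp_eqI; unfold cp_divv cp_CC' cp_zero) (simp add: d_linear SF_intros c normal_order algebra_simps)
qed

lemma divv_gradv: "divv (gradv v) = - Lapv v"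
proof (rule cp_eqI)
  fix i
  have m: "cp i (- Lapv v) = - cp i (Lapv v)" by (simp add: fun_eq_iff cp_apply del: cp_Lapv)
  have i: "i = 1" by simp
  show "cp i (divv (gradv v)) = cp i (- Lapv v)" unfolding m unfolding i by (simp add: Lap_def sum_3)
qed

lemma Lapv_gradv: "v \<in> VF \<Longrightarrow> Lapv (gradv v) = gradv (Lapv v)"
  by (rule cp_eqI) (simp add: Lap_d VF_cp)

lemma Lapv_divv: assumes u: "u \<in> VF" shows "Lapv (divv u) = divv (Lapv u)"
proof -
  note c = VF_cp[OF u]
  show ?thesis by (rule cp_eqI) (simp add: Lap_add Lap_d SF_intros c)
qed

lemma Lapv_add: "u \<in> VF \<Longrightarrow> v \<in> VF \<Longrightarrow> Lapv (u + v) = Lapv u + Lapv v"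
  by (rule cp_eqI; unfold cp_Lapv cp_add) (rule Lap_add; rule VF_cp)
lemma Lapv_diff: "u \<in> VF \<Longrightarrow> v \<in> VF \<Longrightarrow> Lapv (u - v) = Lapv u - Lapv v"
  by (rule cp_eqI; unfold cp_Lapv cp_diff) (rule Lap_diff; rule VF_cp)
lemma Lapv_sm: "u \<in> VF \<Longrightarrow> Lapv (sm c u) = sm c (Lapv u)"
  by (rule cp_eqI; unfold cp_Lapv cp_scale) (rule Lap_K; rule VF_cp)

lemma gradv_sm: "v \<in> VF \<Longrightarrow> gradv (sm c v) = sm c (gradv v)"
  by (rule cp_eqI; unfold cp_gradv cp_scale) (rule d_K_mult; rule VF_cp)
lemma gradv_add: "v \<in> VF \<Longrightarrow> w \<in> VF \<Longrightarrow> gradv (v + w) = gradv v + gradv w"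
  by (rule cp_eqI; unfold cp_gradv cp_add) (rule d_add; rule VF_cp)

lemma divv_sm: "u \<in> VF \<Longrightarrow> divv (sm c u) = sm c (divv u)"
  by (rule cp_eqI; unfold cp_divv cp_scale) (simp add: d_K_mult VF_cp distrib_left)
lemma divv_add: "u \<in> VF \<Longrightarrow> v \<in> VF \<Longrightarrow> divv (u + v) = divv u + divv v"
  by (rule cp_eqI; unfold cp_divv cp_add) (simp add: d_add VF_cp)
lemma divv_diff: "u \<in> VF \<Longrightarrow> v \<in> VF \<Longrightarrow> divv (u - v) = divv u - divv v"
  by (rule cp_eqI; unfold cp_divv cp_diff) (simp add: d_diff VF_cp)

lemma CC_sm: "u \<in> VF \<Longrightarrow> CC (sm c u) = sm c (CC u)"
  by (rule cp_eqI3; unfold cp_CC' cp_scale) (simp_all add: d_K_mult VF_cp right_diff_distrib mult.left_commute)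
lemma CC_add: "u \<in> VF \<Longrightarrow> v \<in> VF \<Longrightarrow> CC (u + v) = CC u + CC v"
  by (rule cp_eqI3; unfold cp_CC' cp_add) (simp_all add: d_add VF_cp algebra_simps)
lemma CC_diff: "u \<in> VF \<Longrightarrow> v \<in> VF \<Longrightarrow> CC (u - v) = CC u - CC v"
  by (rule cp_eqI3; unfold cp_CC' cp_diff) (simp_all add: d_diff VF_cp algebra_simps)

definition HV :: "(real^4^4) set \<Rightarrow> (real^4^4 \<Rightarrow> complex^'d^'d) \<Rightarrow> nat \<Rightarrow> (real^4 \<Rightarrow> complex^'d::finite) set" where
  "HV G \<rho> n = {u \<in> VF \<inter> EQ G \<rho>. Lapv u = sm (ev n) u}"

lemma HV_FV: "HV G \<rho> n \<subseteq> FV n"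
proof
  fix u assume "u \<in> HV G \<rho> n"
  then have u: "u \<in> VF" "Lapv u = sm (ev n) u" unfolding HV_def by blast+
  have "cp a u \<in> FF n" for a
  proof (rule eigenfunction_FF[OF VF_cp[OF u(1)]])
    show "Lap (cp a u) = K (ev n) * cp a u" unfolding cp_Lapv[symmetric] u(2) by (rule cp_scale)
  qed
  then show "u \<in> FV n" by (simp add: FV_def)
qed

lemma Lapv_FV:
  assumes "u \<in> FV n" shows "Lapv u - sm (ev n) u \<in> (if 2 \<le> n then FV (n - 2) else {0})"
proof -
  have "cp a (Lapv u - sm (ev n) u) \<in> FFm n 2" for a
    unfolding cp_diff cp_scale cp_Lapv using assms by (intro Lap_FF) (simp add: FV_def)
  then have *: "cp a (Lapv u - sm (ev n) u) \<in> (if 2 \<le> n then FF (n - 2) else {0})" for a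
    unfolding FFm_def .
  show ?thesis
  proof (cases "2 \<le> n")
    case True
    then show ?thesis using * by (simp only: FV_def if_True mem_Collect_eq) blast
  next
    case False
    then have "cp a (Lapv u - sm (ev n) u) = cp a 0" for a using *[of a] by (simp only: if_False singleton_iff cp_zero)
    then have "Lapv u - sm (ev n) u = 0" by (rule cp_eqI)
    then show ?thesis using False by (simp only: if_False singleton_iff)
  qed
qed

end

section \<open>Multiplicities\<close>

locale fframe = frame s + fgroup G for s G
begin

lemma G_SO4: "g \<in> G \<Longrightarrow> orthogonal_matrix g \<and> det g = 1"
  using orthG detG by blast

lemma grep_triv: "grep G triv"
  by unfold_locales (simp_all add: triv_def)

lemma R_one: "R (mat 1) = mat 1"
proof -
  have g: "orthogonal_matrix (mat 1 :: real^4^4)" "det (mat 1 :: real^4^4) = 1" using G_SO4[OF oneG] by auto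
  have "R (mat 1) ** R (mat 1) = R (mat 1)" using R_mult[OF g g] by simp
  then have "transpose (R (mat 1)) ** (R (mat 1) ** R (mat 1)) = transpose (R (mat 1)) ** R (mat 1)" by simp
  then show ?thesis using R_orthogonal[OF g] by (simp add: matrix_mul_assoc orthogonal_matrix_def)
qed

lemma grep_cR: "grep G cR"
proof unfold_locales
  show "cR (g ** h) = cR g ** cR h" if "g \<in> G" "h \<in> G" for g h
    using R_mult[of g h] G_SO4 that by (simp add: cR_def matrix_matrix_mult_def vec_eq_iff)
  show "cR (mat 1) = mat 1" unfolding cR_def R_one by (simp add: mat_def vec_eq_iff)
qed

lemma graded_FV:
  assumes "grep G \<rho>"
  shows "graded_operator (\<lambda>c u. sm c u) (\<lambda>n. FV n \<inter> EQ G \<rho>) VF Lapv ev"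
proof -
  interpret grep G \<rho> by fact
  show ?thesis
  proof unfold_locales
    show "vs.subspace (FV n \<inter> EQ G \<rho>)" for n by (rule vs.subspace_inter[OF FV_subspace EQ_subspace])
    show "FV n \<inter> EQ G \<rho> \<subseteq> VF" for n using FV_VF by blast
    show "Lapv (x + y) = Lapv x + Lapv y" if "x \<in> VF" "y \<in> VF" for x y by (rule Lapv_add[OF that])
    show "Lapv (sm c x) = sm c (Lapv x)" if "x \<in> VF" for c x by (rule Lapv_sm[OF that])
    show "FV n \<inter> EQ G \<rho> \<subseteq> FV (n + 2) \<inter> EQ G \<rho>" for n
      using FF_subset_Suc_Suc[of n] unfolding FV_def by (auto simp del: FF.simps)
    show "inj ev" by (rule inj_ev)
    show "Lapv x - sm (ev n) x \<in> (if 2 \<le> n then FV (n - 2) \<inter> EQ G \<rho> else {0})" if x: "x \<in> FV n \<inter> EQ G \<rho>" for x n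
    proof -
      have xV: "x \<in> VF" "x \<in> EQ G \<rho>" using x FV_VF by blast+
      have "Lapv x - sm (ev n) x \<in> EQ G \<rho>"
        by (rule vs.subspace_diff[OF EQ_subspace Lapv_EQ[OF G_SO4 xV] vs.subspace_scale[OF EQ_subspace xV(2)]])
      moreover have "Lapv x - sm (ev n) x \<in> (if 2 \<le> n then FV (n - 2) else {0})"
        by (rule Lapv_FV) (use x in blast)
      ultimately show ?thesis by (cases "2 \<le> n") (simp_all only: if_True if_False Int_iff simp_thms)
    qed
  qed
qed

lemma HV_subspace:
  assumes "grep G \<rho>" shows "vs.subspace (HV G \<rho> n)"
proof -
  interpret grep G \<rho> by fact
  show ?thesis
  proof (rule vs.subspaceI)
    have "Lapv 0 = 0" using Lapv_sm[OF vs.subspace_0[OF VF_subspace], of 0] by (simp only: vs.scale_zero_left)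
    then show "0 \<in> HV G \<rho> n"
      using vs.subspace_0[OF VF_subspace] vs.subspace_0[OF EQ_subspace] unfolding HV_def by (simp add: fun_eq_iff)
  next
    fix x y assume "x \<in> HV G \<rho> n" "y \<in> HV G \<rho> n"
    then have *: "x \<in> VF" "x \<in> EQ G \<rho>" "Lapv x = sm (ev n) x" "y \<in> VF" "y \<in> EQ G \<rho>" "Lapv y = sm (ev n) y"
      by (simp_all add: HV_def)
    have "Lapv (x + y) = sm (ev n) (x + y)"
      unfolding Lapv_add[OF *(1,4)] *(3,6) by (simp add: fun_eq_iff vector_add_ldistrib)
    then show "x + y \<in> HV G \<rho> n"
      unfolding HV_def using VF_add[OF *(1,4)] vs.subspace_add[OF EQ_subspace *(2,5)] by blast
  next
    fix c x assume "x \<in> HV G \<rho> n"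
    then have *: "x \<in> VF" "x \<in> EQ G \<rho>" "Lapv x = sm (ev n) x" by (simp_all add: HV_def)
    have "Lapv (sm c x) = sm (ev n) (sm c x)"
      unfolding Lapv_sm[OF *(1)] *(3) by (simp only: fun_eq_iff vector_smult_assoc mult.commute[of c] simp_thms)
    then show "sm c x \<in> HV G \<rho> n"
      unfolding HV_def using VF_sm[OF *(1)] vs.subspace_scale[OF EQ_subspace *(2)] by blast
  qed
qed

text \<open>Every equivariant polynomial field splits into an eigenfield and one of degree two less.
  Eigenspace dimensions are thereby differences of Molien coefficients.\<close>

lemma dim_FV:
  assumes "grep G \<rho>"
  shows "vs.dim (FV n \<inter> EQ G \<rho>) = vs.dim (HV G \<rho> n) + (if 2 \<le> n then vs.dim (FV (n - 2) \<inter> EQ G \<rho>) else 0)"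
proof -
  interpret rep: grep G \<rho> by fact
  interpret gr: graded_operator "\<lambda>c u. sm c u" "\<lambda>n. FV n \<inter> EQ G \<rho>" VF Lapv ev
    by (rule graded_FV[OF assms])
  let ?L = "if 2 \<le> n then FV (n - 2) \<inter> EQ G \<rho> else {0}"
  obtain F where F: "finite F" "FV n = vs.span (F :: (real^4 \<Rightarrow> complex^'a) set)" using FV_finite_span by blast
  have L: "?L \<subseteq> FV n \<inter> EQ G \<rho>"
  proof (cases "2 \<le> n")
    case True
    then show ?thesis unfolding if_P[OF True] by (rule gr.mono')
  next
    case False
    then show ?thesis unfolding if_not_P[OF False] using vs.subspace_0[OF gr.subspace_W, of n] by blast
  qed
  have Ls: "vs.subspace ?L"
    using gr.subspace_W by (simp add: vs.subspace_single_0)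
  have "vs.dim (FV n \<inter> EQ G \<rho>) = vs.dim (HV G \<rho> n) + vs.dim ?L"
  proof (rule vs.dim_direct_sum[OF HV_subspace[OF assms] _ Ls _ F(1)])
    show "HV G \<rho> n \<subseteq> vs.span F" unfolding F(2)[symmetric] by (rule HV_FV)
    show "?L \<subseteq> vs.span F" unfolding F(2)[symmetric] using L by blast
    show "x = 0" if "x \<in> HV G \<rho> n" "x \<in> ?L" for x
      by (rule gr.eigen_inter_lower[OF that(2)]) (use that(1) in \<open>simp add: HV_def\<close>)
    show "x \<in> FV n \<inter> EQ G \<rho> \<longleftrightarrow> (\<exists>a\<in>HV G \<rho> n. \<exists>b\<in>?L. x = a + b)" for x
    proof
      assume "x \<in> FV n \<inter> EQ G \<rho>"
      from gr.eigen_decomposition[OF this]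
      obtain h w where "h \<in> FV n \<inter> EQ G \<rho>" "w \<in> ?L" "Lapv h = sm (ev n) h" "x = h + w" by blast
      moreover from this have "h \<in> HV G \<rho> n" using FV_VF unfolding HV_def by blast
      ultimately show "\<exists>a\<in>HV G \<rho> n. \<exists>b\<in>?L. x = a + b" by blast
    next
      assume "\<exists>a\<in>HV G \<rho> n. \<exists>b\<in>?L. x = a + b"
      then obtain a b where ab: "a \<in> HV G \<rho> n" "b \<in> ?L" "x = a + b" by blast
      have "a \<in> FV n \<inter> EQ G \<rho>" using ab(1) HV_FV unfolding HV_def by blast
      then show "x \<in> FV n \<inter> EQ G \<rho>" unfolding ab(3) by (rule vs.subspace_add[OF gr.subspace_W _ subsetD[OF L ab(2)]])
    qed
  qed
  moreover have "vs.dim {0 :: real^4 \<Rightarrow> complex^'a} = 0"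
    using vs.dim_span_eq_card_independent[OF vs.independent_empty] by (simp only: vs.span_empty card.empty)
  ultimately show ?thesis by (cases "2 \<le> n") (simp_all only: if_True if_False)
qed

lemma EU_D: "u \<in> EU G lam \<Longrightarrow> u \<in> VF" "u \<in> EU G lam \<Longrightarrow> u \<in> EQ G cR" "u \<in> EU G lam \<Longrightarrow> CC u = sm (of_real lam) u"
  by (simp_all add: EU_def)

lemma EU_divv: assumes u: "u \<in> EU G lam" "lam \<noteq> 0" shows "divv u = 0"
proof -
  have "sm (of_real lam) (divv u) = 0"
    using divv_CC[OF EU_D(1)[OF u(1)]] divv_sm[OF EU_D(1)[OF u(1)], of "of_real lam"] unfolding EU_D(3)[OF u(1)] by simp
  then show ?thesis using u(2) by (simp add: fun_eq_iff)
qed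

text \<open>For lam \<noteq> 0 an eigenfield has no divergence, so \<open>CC_CC\<close> reduces to
  lam^2 = 2 s lam + Laplace eigenvalue.\<close>

lemma EU_Lapv:
  assumes u: "u \<in> EU G lam" "lam \<noteq> 0" shows "Lapv u = sm (of_real (lam * (lam - 2 * s))) u"
proof -
  have 0: "gradv (0 :: real^4 \<Rightarrow> complex^1) = 0"
    by (rule cp_eqI) (simp only: cp_gradv cp_zero d_zero)
  have "CC (CC u) = sm (of_real lam) (sm (of_real lam) u)"
    unfolding EU_D(3)[OF u(1)] CC_sm[OF EU_D(1)[OF u(1)]] EU_D(3)[OF u(1)] ..
  then have "sm (of_real lam) (sm (of_real lam) u) = sm (of_real (2 * s)) (sm (of_real lam) u) + Lapv u"
    using CC_CC[OF EU_D(1)[OF u(1)]] unfolding EU_divv[OF u] 0 EU_D(3)[OF u(1)] by simp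
  then have "Lapv u = sm (of_real lam) (sm (of_real lam) u) - sm (of_real (2 * s)) (sm (of_real lam) u)" by simp
  also have "\<dots> = sm (of_real (lam * (lam - 2 * s))) u"
    by (simp add: fun_eq_iff vec_eq_iff algebra_simps)
  finally show ?thesis .
qed

lemma EU_subspace: "vs.subspace (EU G lam)"
proof -
  interpret grep G cR by (rule grep_cR)
  show ?thesis
  proof (rule vs.subspaceI)
    have "CC 0 = 0" using CC_sm[OF vs.subspace_0[OF VF_subspace], of 0] by (simp only: vs.scale_zero_left)
    then show "0 \<in> EU G lam"
      using vs.subspace_0[OF VF_subspace] vs.subspace_0[OF EQ_subspace] unfolding EU_def by (simp add: fun_eq_iff)
  next
    fix x y assume *: "x \<in> EU G lam" "y \<in> EU G lam"
    have "CC (x + y) = sm (of_real lam) (x + y)"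
      unfolding CC_add[OF *[THEN EU_D(1)]] *[THEN EU_D(3)] by (simp add: fun_eq_iff vector_add_ldistrib)
    then show "x + y \<in> EU G lam"
      unfolding EU_def using VF_add[OF *[THEN EU_D(1)]] vs.subspace_add[OF EQ_subspace *[THEN EU_D(2)]] by blast
  next
    fix c x assume *: "x \<in> EU G lam"
    have "CC (sm c x) = sm (of_real lam) (sm c x)"
      unfolding CC_sm[OF *[THEN EU_D(1)]] *[THEN EU_D(3)] by (simp add: fun_eq_iff vector_smult_assoc mult.commute)
    then show "sm c x \<in> EU G lam"
      unfolding EU_def using VF_sm[OF *[THEN EU_D(1)]] vs.subspace_scale[OF EQ_subspace *[THEN EU_D(2)]] by blast
  qed
qed

lemma s_nonzero: "s \<noteq> 0" using ss by auto

lemma EU_HV: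
  assumes "lam \<noteq> 0" "lam * (lam - 2 * s) = real (n * (n + 2))"
  shows "EU G lam \<subseteq> HV G cR n"
proof
  fix u assume u: "u \<in> EU G lam"
  have "Lapv u = sm (ev n) u" using EU_Lapv[OF u assms(1)] unfolding assms(2) by (simp only: of_real_of_nat_eq)
  then show "u \<in> HV G cR n" using EU_D(1,2)[OF u] by (simp add: HV_def)
qed

text \<open>The two roots of lam^2 - 2 s lam = n (n + 2).\<close>

lemma eigenvalue_identities:
  "s * (real n + 2) * (s * (real n + 2) - 2 * s) = real (n * (n + 2))"
  "(- s * real n) * (- s * real n - 2 * s) = real (n * (n + 2))"
proof -
  have "s * (real n + 2) * (s * (real n + 2) - 2 * s) = (s * s) * real (n * (n + 2))"
    "(- s * real n) * (- s * real n - 2 * s) = (s * s) * real (n * (n + 2))"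
    by (simp_all add: algebra_simps)
  then show "s * (real n + 2) * (s * (real n + 2) - 2 * s) = real (n * (n + 2))"
    "(- s * real n) * (- s * real n - 2 * s) = real (n * (n + 2))"
    by (simp_all only: ss mult_1)
qed

text \<open>For lam = s the Laplace eigenvalue would be -1. Read in the frame of opposite sign, this
  removes the partner eigenvalue at n = 1.\<close>

lemma EU_zero_multiplicity: "EU G s = {0}"
proof (intro equalityI subsetI)
  fix u assume u: "u \<in> EU G s"
  have "s * (s - 2 * s) = -1" using ss by (simp add: algebra_simps)
  then have L: "Lapv u = sm (- 1) u" using EU_Lapv[OF u s_nonzero] by simp
  have "cp a u = cp a 0" for a
    unfolding cp_zero
  proof (rule Lap_nonneg[OF VF_cp[OF EU_D(1)[OF u]]])
    have "Lap (cp a u) = K (- 1) * cp a u" unfolding cp_Lapv[symmetric] L by (rule cp_scale)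
    then show "Lap (cp a u) = - cp a u" by (simp only: K_hom mult_minus_left mult_1)
  qed
  then have "u = 0" by (rule cp_eqI)
  then show "u \<in> {0}" by (simp only: singleton_iff)
next
  fix u assume "u \<in> {0 :: real^4 \<Rightarrow> complex^3}"
  then show "u \<in> EU G s" using vs.subspace_0[OF EU_subspace] by (simp only: singleton_iff)
qed

text \<open>At n = 0 all coefficients are constant on S^3, so \<open>CC\<close> is multiplication by
  2 s. The other root and the gradients degenerate at this level, which therefore stands apart from
  \<open>dim_HV\<close>.\<close>

lemma EU_lowest: "EU G (2 * s) = HV G cR 0"
proof (rule subset_antisym)
  show "EU G (2 * s) \<subseteq> HV G cR 0" by (rule EU_HV) (use s_nonzero in auto)
  show "HV G cR 0 \<subseteq> EU G (2 * s)"
  proof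
    fix u assume u: "u \<in> HV G cR 0"
    have d0: "d b (cp a u) = 0" for a b
    proof -
      have "cp a u \<in> cs.span {one}" using u HV_FV[of G cR 0] unfolding FV_def FF.simps by blast
      then obtain k where k: "cp a u = K k * one" unfolding cs.span_singleton by blast
      show ?thesis unfolding k d_K_mult[OF one_SF] d_one by simp
    qed
    have "CC u = sm (of_real (2 * s)) u"
      by (rule cp_eqI3; unfold cp_CC' cp_S2 d0) simp_all
    then show "u \<in> EU G (2 * s)" using u unfolding EU_def HV_def by blast
  qed
qed

text \<open>Removing a gradient leaves a divergence-free x, on which \<open>CC\<close> satisfies (CC
  - l1)(CC - l2) = 0. The roots are distinct, so x splits into eigenfields.\<close>

lemma HV_split:
  assumes n: "n \<ge> 1" and u: "u \<in> HV G cR n"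
  obtains a b q where "a \<in> EU G (s * (real n + 2))" "b \<in> EU G (- s * real n)" "q \<in> HV G triv n" "u = (a + b) + gradv q"
proof -
  interpret rc: grep G cR by (rule grep_cR)
  interpret rt: grep G triv by (rule grep_triv)
  have u': "u \<in> VF" "u \<in> EQ G cR" "Lapv u = sm (ev n) u" using u by (simp_all add: HV_def)
  define N where "N = ev n"
  have N0: "N \<noteq> 0" using n unfolding N_def by (simp only: of_nat_eq_0_iff) simp
  \<comment> \<open>Chosen to carry the whole divergence of u: \<open>divv (gradv q)\<close> is - N
    q.\<close>
  define q where "q = sm (- 1 / N) (divv u)"
  have dV: "divv u \<in> VF" by (rule divv_VF[OF u'(1)])
  have q: "q \<in> VF" "q \<in> EQ G triv" unfolding q_def
    by (rule VF_sm[OF dV], rule vs.subspace_scale[OF rt.EQ_subspace divv_EQ[OF G_SO4 u'(1,2)]])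
  have Lq: "Lapv q = sm N q"
    unfolding q_def Lapv_sm[OF dV] Lapv_divv[OF u'(1)] u'(3) divv_sm[OF u'(1)] N_def
    by (simp only: vector_smult_assoc mult.commute)
  have qH: "q \<in> HV G triv n" using q Lq by (simp add: HV_def N_def)
  have gV: "gradv q \<in> VF" by (rule gradv_VF[OF q(1)])
  define x where "x = u - gradv q"
  have x: "x \<in> VF" "x \<in> EQ G cR" unfolding x_def
    by (rule VF_diff[OF u'(1) gV], rule vs.subspace_diff[OF rc.EQ_subspace u'(2) gradv_EQ[OF G_SO4 q]])
  have dx: "divv x = 0"
    unfolding x_def divv_diff[OF u'(1) gV] divv_gradv Lq using N0 by (simp add: q_def fun_eq_iff vector_smult_assoc)
  have Lx: "Lapv x = sm N x"
    unfolding x_def Lapv_diff[OF u'(1) gV] Lapv_gradv[OF q(1)] Lq gradv_sm[OF q(1)] u'(3) N_def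
    by (simp add: fun_eq_iff vec_eq_iff algebra_simps)
  define v where "v = CC x"
  have v: "v \<in> VF" "v \<in> EQ G cR" unfolding v_def by (rule CC_VF[OF x(1)], rule CC_EQ[OF G_SO4 x])
  have Cv: "CC v = sm (of_real (2 * s)) v + sm N x"
  proof -
    have 0: "gradv (0 :: real^4 \<Rightarrow> complex^1) = 0" by (rule cp_eqI) (simp only: cp_gradv cp_zero d_zero)
    show ?thesis unfolding v_def CC_CC[OF x(1)] dx 0 Lx by simp
  qed
  define l1 where "l1 = complex_of_real (s * (real n + 2))"
  define l2 where "l2 = complex_of_real (- s * real n)"
  have ls: "l1 + l2 = of_real (2 * s)" "l1 * l2 = - N"
  proof -
    show "l1 + l2 = of_real (2 * s)" by (simp add: l1_def l2_def algebra_simps)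
    have "s * (real n + 2) * (- s * real n) = - ((s * s) * real (n * (n + 2)))" by (simp add: algebra_simps)
    then have "s * (real n + 2) * (- s * real n) = - real (n * (n + 2))" by (simp only: ss mult_1)
    then show "l1 * l2 = - N" unfolding l1_def l2_def N_def of_real_mult[symmetric] by simp
  qed
  have D0: "l1 - l2 \<noteq> 0"
  proof -
    have "s * (real n + 2) - (- s * real n) = s * (2 * (real n + 1))" by (simp add: algebra_simps)
    also have "\<dots> \<noteq> 0" using s_nonzero by simp
    finally show ?thesis unfolding l1_def l2_def of_real_diff[symmetric] of_real_eq_0_iff .
  qed
  define D where "D = inverse (l1 - l2)"
  \<comment> \<open>The Lagrange projections (CC - l2)/(l1 - l2) and (l1 - CC)/(l1 - l2), applied to
    x.\<close>
  define a where "a = sm D (v - sm l2 x)"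
  define b where "b = sm D (sm l1 x - v)"
  have aV: "v - sm l2 x \<in> VF" "sm l1 x - v \<in> VF" by (intro VF_diff VF_sm v x)+
  have aE: "a \<in> EQ G cR" "b \<in> EQ G cR" unfolding a_def b_def
    by (intro vs.subspace_scale[OF rc.EQ_subspace] vs.subspace_diff[OF rc.EQ_subspace] v x)+
  have Nl: "N = - (l1 * l2)" using ls(2) by simp
  have "CC a = sm l1 a"
    unfolding a_def CC_sm[OF aV(1)] CC_diff[OF v(1) VF_sm[OF x(1)]] CC_sm[OF x(1)] Cv v_def[symmetric] ls(1)[symmetric] Nl
    by (simp add: fun_eq_iff vec_eq_iff algebra_simps)
  moreover have "CC b = sm l2 b"
    unfolding b_def CC_sm[OF aV(2)] CC_diff[OF VF_sm[OF x(1)] v(1)] CC_sm[OF x(1)] Cv v_def[symmetric] ls(1)[symmetric] Nl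
    by (simp add: fun_eq_iff vec_eq_iff algebra_simps)
  moreover have "a \<in> VF" "b \<in> VF" unfolding a_def b_def by (intro VF_sm aV)+
  ultimately have ab: "a \<in> EU G (s * (real n + 2))" "b \<in> EU G (- s * real n)"
    using aE unfolding EU_def l1_def l2_def by simp_all
  have "a + b = x"
  proof -
    have "(a + b) p $ i = (D * (l1 - l2)) * x p $ i" for p i
      by (simp add: a_def b_def algebra_simps)
    then show ?thesis using D0 by (simp add: D_def fun_eq_iff vec_eq_iff)
  qed
  then have "u = (a + b) + gradv q" by (simp add: x_def)
  then show ?thesis using that ab qH by blast
qed

lemma gradv_HV: assumes q: "q \<in> HV G triv n" shows "gradv q \<in> HV G cR n"
proof -
  have q': "q \<in> VF" "q \<in> EQ G triv" "Lapv q = sm (ev n) q" using q by (simp_all add: HV_def)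
  have "Lapv (gradv q) = sm (ev n) (gradv q)" unfolding Lapv_gradv[OF q'(1)] q'(3) by (rule gradv_sm[OF q'(1)])
  then show ?thesis using gradv_VF[OF q'(1)] gradv_EQ[OF G_SO4 q'(1,2)] by (simp add: HV_def)
qed

lemma gradv_HV_divv:
  assumes n: "n \<ge> 1" and q: "q \<in> HV G triv n" and 0: "divv (gradv q) = 0" shows "q = 0"
proof -
  have "sm (ev n) q = 0" using 0 q unfolding divv_gradv HV_def by simp
  moreover have "ev n \<noteq> 0" using n by (simp only: of_nat_eq_0_iff) simp
  ultimately show ?thesis by (simp only: vs.scale_eq_0_iff simp_thms)
qed

text \<open>The two curl eigenspaces meet in 0 because their eigenvalues differ. Both are divergence
  free, while for n \<ge> 1 a divergence-free gradient in this space is 0, so the sum with the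
  gradients is direct as well.\<close>

lemma dim_HV:
  assumes n: "n \<ge> 1"
  shows "vs.dim (HV G cR n) = vs.dim (EU G (s * (real n + 2))) + vs.dim (EU G (- s * real n)) + vs.dim (HV G triv n)"
proof -
  let ?l1 = "s * (real n + 2)" and ?l2 = "- s * real n"
  let ?A = "EU G ?l1" and ?B = "EU G ?l2" and ?C = "gradv ` HV G triv n"
  let ?AB = "{x. \<exists>a\<in>?A. \<exists>b\<in>?B. x = a + b}"
  obtain F where F: "finite F" "FV n = vs.span (F :: (real^4 \<Rightarrow> complex^3) set)" using FV_finite_span by blast
  obtain F1 where F1: "finite F1" "FV n = vs.span (F1 :: (real^4 \<Rightarrow> complex^1) set)" using FV_finite_span by blast
  have l0: "?l1 \<noteq> 0" "?l2 \<noteq> 0" using s_nonzero n by (simp_all add: add_nonneg_eq_0_iff)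
  have AH: "?A \<subseteq> HV G cR n" by (rule EU_HV[OF l0(1) eigenvalue_identities(1)])
  have BH: "?B \<subseteq> HV G cR n" by (rule EU_HV[OF l0(2) eigenvalue_identities(2)])
  have CH: "?C \<subseteq> HV G cR n" using gradv_HV by blast
  have HF: "HV G cR n \<subseteq> vs.span F" unfolding F(2)[symmetric] by (rule HV_FV)
  note Hs = HV_subspace[OF grep_cR, of n] HV_subspace[OF grep_triv, of n]
  have HV_VF: "q \<in> VF" if "q \<in> HV G \<rho> n" for q :: "real^4 \<Rightarrow> complex^'d" and \<rho> using that by (simp add: HV_def)
  have ABH: "?AB \<subseteq> HV G cR n"
    using AH BH vs.subspace_add[OF Hs(1)] by blast
  have ABs: "vs.subspace ?AB"
    by (rule vs.subspace_sums[OF EU_subspace EU_subspace, of ?l1 ?l2, THEN back_subst[of vs.subspace]]) blast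
  have dAB: "vs.dim ?AB = vs.dim ?A + vs.dim ?B"
  proof (rule vs.dim_direct_sum[OF EU_subspace subset_trans[OF AH HF] EU_subspace subset_trans[OF BH HF] F(1)])
    fix x assume x: "x \<in> ?A" "x \<in> ?B"
    have "sm (of_real (?l1 - ?l2)) x = sm (of_real ?l1) x - sm (of_real ?l2) x"
      by (simp add: fun_eq_iff vec_eq_iff algebra_simps)
    also have "\<dots> = 0" unfolding EU_D(3)[OF x(1), symmetric] EU_D(3)[OF x(2), symmetric] by simp
    finally have "sm (of_real (?l1 - ?l2)) x = 0" .
    moreover have "complex_of_real (?l1 - ?l2) \<noteq> 0"
    proof -
      have "?l1 - ?l2 = s * (2 * (real n + 1))" by (simp add: algebra_simps)
      then show ?thesis using s_nonzero by (simp only: of_real_eq_0_iff) simp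
    qed
    ultimately show "x = 0" by (simp only: vs.scale_eq_0_iff simp_thms)
  qed blast
  have Cs: "vs.subspace ?C"
  proof (rule vs.subspaceI)
    have "gradv (0 :: real^4 \<Rightarrow> complex^1) = 0" by (rule cp_eqI) (simp only: cp_gradv cp_zero d_zero)
    then show "0 \<in> ?C" using vs.subspace_0[OF Hs(2)] by (metis imageI)
  next
    fix x y assume "x \<in> ?C" "y \<in> ?C"
    then obtain q r where qr: "q \<in> HV G triv n" "x = gradv q" "r \<in> HV G triv n" "y = gradv r" by blast
    then have "x + y = gradv (q + r)" by (simp only: gradv_add HV_VF)
    then show "x + y \<in> ?C" using vs.subspace_add[OF Hs(2) qr(1,3)] by blast
  next
    fix c x assume "x \<in> ?C"
    then obtain q where q: "q \<in> HV G triv n" "x = gradv q" by blast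
    then have "sm c x = gradv (sm c q)" by (simp only: gradv_sm HV_VF)
    then show "sm c x \<in> ?C" using vs.subspace_scale[OF Hs(2) q(1), of c] by blast
  qed
  have ABdiv: "divv x = 0" if "x \<in> ?AB" for x
  proof -
    obtain a b where ab: "a \<in> ?A" "b \<in> ?B" "x = a + b" using \<open>x \<in> ?AB\<close> by blast
    show ?thesis unfolding ab(3) divv_add[OF EU_D(1)[OF ab(1)] EU_D(1)[OF ab(2)]] EU_divv[OF ab(1) l0(1)] EU_divv[OF ab(2) l0(2)] by simp
  qed
  have dC: "vs.dim ?C = vs.dim (HV G triv n)"
  proof (rule dim_injective_image[OF vs.vector_space_axioms vs.vector_space_axioms Hs(2) F1(1)])
    show "HV G triv n \<subseteq> vs.span F1" unfolding F1(2)[symmetric] by (rule HV_FV)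
    show "gradv (x + y) = gradv x + gradv y" if "x \<in> HV G triv n" "y \<in> HV G triv n" for x y
      by (rule gradv_add; rule HV_VF; fact)
    show "gradv (sm c x) = sm c (gradv x)" if "x \<in> HV G triv n" for c x by (rule gradv_sm; rule HV_VF; fact)
    show "x = 0" if x: "x \<in> HV G triv n" "gradv x = 0" for x
    proof (rule gradv_HV_divv[OF n x(1)])
      show "divv (gradv x) = 0" unfolding x(2)
        by (rule cp_eqI) (simp only: cp_divv cp_zero d_zero add_0_left)
    qed
  qed
  have "vs.dim (HV G cR n) = vs.dim ?AB + vs.dim ?C"
  proof (rule vs.dim_direct_sum[OF ABs subset_trans[OF ABH HF] Cs subset_trans[OF CH HF] F(1)])
    fix x assume x: "x \<in> ?AB" "x \<in> ?C"
    then obtain q where q: "q \<in> HV G triv n" "x = gradv q" by blast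
    have "q = 0" by (rule gradv_HV_divv[OF n q(1)]) (use ABdiv[OF x(1)] in \<open>simp only: q(2)\<close>)
    then show "x = 0" unfolding q(2) by (intro cp_eqI) (simp only: cp_gradv cp_zero d_zero)
  next
    fix x
    show "x \<in> HV G cR n \<longleftrightarrow> (\<exists>a\<in>?AB. \<exists>b\<in>?C. x = a + b)"
    proof
      assume "x \<in> HV G cR n"
      then obtain a b q where "a \<in> ?A" "b \<in> ?B" "q \<in> HV G triv n" "x = (a + b) + gradv q" by (rule HV_split[OF n])
      then show "\<exists>a\<in>?AB. \<exists>b\<in>?C. x = a + b" by blast
    next
      assume "\<exists>a\<in>?AB. \<exists>b\<in>?C. x = a + b"
      then show "x \<in> HV G cR n" using ABH CH vs.subspace_add[OF Hs(1)] by blast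
    qed
  qed
  then show ?thesis unfolding dAB dC .
qed

text \<open>The inclusion places \<open>EU G lam\<close> in the finite-dimensional
  \<open>FV n\<close>, where the injective linear map \<open>toX\<close> preserves
  dimensions.\<close>

lemma curl_mult_EU:
  assumes "EU G lam \<subseteq> HV G cR n"
  shows "curl_mult G lam = vs.dim (EU G lam)"
proof -
  obtain F where F: "finite F" "FV n = vs.span (F :: (real^4 \<Rightarrow> complex^3) set)" using FV_finite_span by blast
  have "vs.dim (toX ` EU G lam) = vs.dim (EU G lam)"
  proof (rule dim_injective_image[OF vs.vector_space_axioms vs.vector_space_axioms EU_subspace F(1)])
    show "EU G lam \<subseteq> vs.span F" using subset_trans[OF assms HV_FV] unfolding F(2) .
    show "toX (x + y) = toX x + toX y" for x y
      by (simp add: toX_def fun_eq_iff vec_eq_iff sum.distrib algebra_simps)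
    show "toX (sm c x) = sm c (toX x)" for c x
      by (simp add: toX_def fun_eq_iff vec_eq_iff sum_distrib_left mult.assoc)
    show "x = 0" if x: "x \<in> EU G lam" "toX x = 0" for x
    proof
      fix p
      show "x p = 0 p"
      proof (cases "p \<in> S3")
        case True
        have "toX x p = toX 0 p" unfolding x(2) by (simp add: toX_def)
        then show ?thesis unfolding toX_eq_iff[OF True] .
      next
        case False
        then show ?thesis using VF_outside[OF EU_D(1)[OF x(1)]] by simp
      qed
    qed
  qed
  moreover have "curl_eigenspace G lam = toX ` EU G lam" by (rule curl_eigenspace_frame) (rule G_SO4)
  ultimately show ?thesis unfolding curl_mult_def by (simp only:)
qed

end

section \<open>Multiplicities from Molien coefficients\<close>

context fframe begin

definition mult_FV :: "(real^4^4 \<Rightarrow> complex^'d^'d) \<Rightarrow> nat \<Rightarrow> nat" where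
  "mult_FV \<rho> n = vs.dim (FV n \<inter> EQ G \<rho> :: (real^4 \<Rightarrow> complex^'d::finite) set)"

lemma curl_mult_dim_EU:
  assumes "n \<ge> 1"
  shows "curl_mult G (s * (real n + 2)) = vs.dim (EU G (s * (real n + 2)))"
    and "curl_mult G (- s * real n) = vs.dim (EU G (- s * real n))"
proof -
  have l: "s * (real n + 2) \<noteq> 0" "- s * real n \<noteq> 0" using assms s_nonzero by auto
  show "curl_mult G (s * (real n + 2)) = vs.dim (EU G (s * (real n + 2)))"
    by (rule curl_mult_EU[OF EU_HV[OF l(1) eigenvalue_identities(1)]])
  show "curl_mult G (- s * real n) = vs.dim (EU G (- s * real n))"
    by (rule curl_mult_EU[OF EU_HV[OF l(2) eigenvalue_identities(2)]])
qed

lemma curl_mult_s: "curl_mult G s = 0"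
proof -
  have "EU G s \<subseteq> HV G cR 0"
    unfolding EU_zero_multiplicity using vs.subspace_0[OF HV_subspace[OF grep_cR], of 0] by blast
  then have "curl_mult G s = vs.dim {0 :: real^4 \<Rightarrow> complex^3}"
    using curl_mult_EU[of s 0] unfolding EU_zero_multiplicity by simp
  also have "\<dots> = 0"
    using vs.dim_span_eq_card_independent[OF vs.independent_empty] by (simp only: vs.span_empty card.empty)
  finally show ?thesis .
qed

lemma curl_mult_lowest: "curl_mult G (2 * s) = mult_FV cR 0"
proof -
  have "curl_mult G (2 * s) = vs.dim (HV G cR 0)"
    using curl_mult_EU[of "2 * s" 0] unfolding EU_lowest by simp
  then show ?thesis unfolding mult_FV_def dim_FV[OF grep_cR, of 0] by simp
qed

text \<open>\<open>dim_HV\<close> with its Laplace eigenspaces expressed by \<open>dim_FV\<close>,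
  arranged without subtraction of natural numbers.\<close>

lemma mult_FV_step:
  "mult_FV cR n + (if 2 \<le> n then mult_FV triv (n - 2) else 0)
    = curl_mult G (s * (real n + 2)) + curl_mult G (- s * real n) + mult_FV triv n
      + (if 2 \<le> n then mult_FV cR (n - 2) else 0)" if "n \<ge> 1"
  unfolding mult_FV_def dim_FV[OF grep_cR, of n] dim_FV[OF grep_triv, of n] dim_HV[OF that] curl_mult_dim_EU[OF that]
  by simp

text \<open>Dominates the series of curl multiplicities by a Molien series, from which absolute
  convergence follows.\<close>

lemma curl_mult_le: "curl_mult G (s * (real n + 2)) \<le> mult_FV cR n"
proof (cases "n = 0")
  case True
  then show ?thesis using curl_mult_lowest by (simp add: mult.commute)
next
  case False
  then have n: "n \<ge> 1" by simp
  show ?thesis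
    unfolding mult_FV_def dim_FV[OF grep_cR, of n] dim_HV[OF n] curl_mult_dim_EU[OF n] by simp
qed

lemma mult_FV_series:
  assumes "norm z < 1" "grep G \<rho>"
  shows "summable (\<lambda>n. norm (of_nat (mult_FV \<rho> n) * z ^ n))"
    "(\<lambda>n. of_nat (mult_FV \<rho> n) * z ^ n) sums
      (1 / of_nat (card G) * (\<Sum>h\<in>G. (\<Sum>a\<in>UNIV. \<rho> h $ a $ a) / det (mat 1 - mat z ** cmat h)))"
  unfolding mult_FV_def by (rule grep.molien_series[OF assms(2,1)])+

text \<open>The value of the Molien series at z = 0, where every summand is 1.\<close>

lemma mult_FV_triv_0: "mult_FV triv 0 = 1"
proof -
  have m: "mat (0 :: complex) ** A = 0" for A :: "complex^4^4"
    by (simp add: matrix_matrix_mult_def mat_def vec_eq_iff)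
  have "(\<lambda>n. of_nat (mult_FV triv n) * 0 ^ n) sums
      (1 / of_nat (card G) * (\<Sum>h\<in>G. (\<Sum>a\<in>UNIV. triv h $ a $ a) / det (mat 1 - mat (0::complex) ** cmat h)))"
    by (rule mult_FV_series(2)[OF _ grep_triv]) simp
  also have "(1 / of_nat (card G) * (\<Sum>h\<in>G. (\<Sum>a\<in>UNIV. triv h $ a $ a) / det (mat 1 - mat (0::complex) ** cmat h))) = 1"
    using finG oneG by (auto simp: m triv_def mat_def[of 1, where 'n = 1] card_eq_0_iff)
  finally have "(\<lambda>n. of_nat (mult_FV triv n) * 0 ^ n) sums (1 :: complex)" .
  moreover have "(\<lambda>n. of_nat (mult_FV triv n) * 0 ^ n) sums (of_nat (mult_FV triv 0) :: complex)"
    by (rule powser_sums_zero)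
  ultimately have "of_nat (mult_FV triv 0) = (1 :: complex)" by (rule sums_unique2[symmetric])
  then show ?thesis by (simp only: of_nat_eq_1_iff)
qed

end

section \<open>Generating functions\<close>

text \<open>The coefficient relations become linear equations for the sums A and B; the term for n =
  0 turns into the constant 1 and each shift by two into a factor z^2. Both 1 - z^2 and 1 + z^2 are
  nonzero since |z| < 1.\<close>

lemma coupled_generating_functions:
  fixes z :: complex and a b p q t :: "nat \<Rightarrow> nat"
  assumes z: "norm z < 1"
    and P: "summable (\<lambda>n. norm (of_nat (p n) * z ^ n))" "(\<lambda>n. of_nat (p n) * z ^ n) sums P"
    and Q: "summable (\<lambda>n. norm (of_nat (q n) * z ^ n))" "(\<lambda>n. of_nat (q n) * z ^ n) sums Q"
    and T: "(\<lambda>n. of_nat (t n) * z ^ n) sums T"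
    and le: "\<And>n. a n \<le> p n" "\<And>n. b n \<le> q n"
    and ab: "\<And>n. p n + (if 2 \<le> n then t (n - 2) else 0) + (if n = 0 then 1 else 0)
        = a n + (if 2 \<le> n then b (n - 2) else 0) + t n + (if 2 \<le> n then p (n - 2) else 0)"
    and ba: "\<And>n. q n + (if 2 \<le> n then t (n - 2) else 0) + (if n = 0 then 1 else 0)
        = b n + (if 2 \<le> n then a (n - 2) else 0) + t n + (if 2 \<le> n then q (n - 2) else 0)"
  shows "summable (\<lambda>n. norm (of_nat (a n) * z ^ n))"
    and "(\<lambda>n. of_nat (a n) * z ^ n) sums (1 / (1 + z^2) * (1 + (P - T - z^2 * (Q - T))))"
    and "summable (\<lambda>n. norm (of_nat (b n) * z ^ n))"
    and "(\<lambda>n. of_nat (b n) * z ^ n) sums (1 / (1 + z^2) * (1 + (Q - T - z^2 * (P - T))))"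
proof -
  have mono: "summable (\<lambda>n. norm (of_nat (c n) * z ^ n))"
    if "summable (\<lambda>n. norm (of_nat (r n) * z ^ n))" "\<And>n. c n \<le> r n" for c r :: "nat \<Rightarrow> nat"
    by (rule summable_comparison_test'[OF that(1), of 0])
      (use that(2) in \<open>simp add: norm_mult norm_power mult_right_mono\<close>)
  show sa: "summable (\<lambda>n. norm (of_nat (a n) * z ^ n))" by (rule mono[OF P(1) le(1)])
  show sb: "summable (\<lambda>n. norm (of_nat (b n) * z ^ n))" by (rule mono[OF Q(1) le(2)])
  obtain A B where A: "(\<lambda>n. of_nat (a n) * z ^ n) sums A" and B: "(\<lambda>n. of_nat (b n) * z ^ n) sums B"
    using summable_norm_cancel[OF sa] summable_norm_cancel[OF sb] unfolding summable_def by blast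
  have shift: "(\<lambda>n. of_nat (if 2 \<le> n then f (n - 2) else 0) * z ^ n) sums (z^2 * F)"
    if "(\<lambda>n. of_nat (f n) * z ^ n) sums F" for f :: "nat \<Rightarrow> nat" and F
  proof -
    have e: "(\<lambda>n. of_nat (if 2 \<le> n + 2 then f (n + 2 - 2) else 0) * z ^ (n + 2)) = (\<lambda>n. z^2 * (of_nat (f n) * z ^ n))"
      by (simp add: fun_eq_iff power_add power2_eq_square mult_ac)
    have "(\<lambda>n. of_nat (if 2 \<le> n + 2 then f (n + 2 - 2) else 0) * z ^ (n + 2)) sums (z^2 * F)"
      unfolding e by (rule sums_mult[OF that])
    then show ?thesis by (subst (asm) sums_iff_shift) (simp add: numeral_2_eq_2)
  qed
  have one: "(\<lambda>n. of_nat (if n = 0 then 1 else 0 :: nat) * z ^ n) sums 1"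
    using powser_sums_if[of 0 z] by (simp add: if_distrib cong: if_cong)
  have E: "P' + z^2 * T + 1 = A' + z^2 * B' + T + z^2 * P'"
    if P': "(\<lambda>n. of_nat (p' n) * z ^ n) sums P'" and A': "(\<lambda>n. of_nat (a' n) * z ^ n) sums A'"
      and B': "(\<lambda>n. of_nat (b' n) * z ^ n) sums B'"
      and eq: "\<And>n. p' n + (if 2 \<le> n then t (n - 2) else 0) + (if n = 0 then 1 else 0)
        = a' n + (if 2 \<le> n then b' (n - 2) else 0) + t n + (if 2 \<le> n then p' (n - 2) else 0)"
    for p' a' b' :: "nat \<Rightarrow> nat" and P' A' B'
  proof (rule sums_unique2)
    have n: "(\<lambda>n. of_nat (f n + g n) * z ^ n) sums (F + H)"
      if "(\<lambda>n. of_nat (f n) * z ^ n) sums F" "(\<lambda>n. of_nat (g n) * z ^ n) sums H" for f g :: "nat \<Rightarrow> nat" and F H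
      using sums_add[OF that] by (simp add: distrib_right)
    show "(\<lambda>n. of_nat (p' n + (if 2 \<le> n then t (n - 2) else 0) + (if n = 0 then 1 else 0)) * z ^ n) sums (P' + z^2 * T + 1)"
      by (rule n[OF n[OF P' shift[OF T]] one])
    show "(\<lambda>n. of_nat (p' n + (if 2 \<le> n then t (n - 2) else 0) + (if n = 0 then 1 else 0)) * z ^ n)
        sums (A' + z^2 * B' + T + z^2 * P')"
      unfolding eq by (rule n[OF n[OF n[OF A' shift[OF B']] T] shift[OF P']])
  qed
  note e = E[OF P(2) A B ab] E[OF Q(2) B A ba]
  have "norm (z^2) < 1" using z by (simp add: norm_power power_less_one_iff abs_square_less_1)
  then have "z^2 \<noteq> 1" "z^2 \<noteq> - 1" by auto
  then have nz: "1 - z^2 \<noteq> 0" "1 + z^2 \<noteq> 0" by (auto simp: add_eq_0_iff)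
  define y where "y = z^2"
  \<comment> \<open>One relation minus y times the other; the factor 1 - y is kept on both sides so
    that these are polynomial identities.\<close>
  have "(1 - y) * ((1 + y) * A) = (1 - y) * (1 + (P - T - y * (Q - T)))"
    "(1 - y) * ((1 + y) * B) = (1 - y) * (1 + (Q - T - y * (P - T)))"
    using e unfolding y_def[symmetric] by algebra+
  then have "(1 + y) * A = 1 + (P - T - y * (Q - T))" "(1 + y) * B = 1 + (Q - T - y * (P - T))"
    using nz(1) unfolding y_def by simp_all
  then have "A = 1 / (1 + z^2) * (1 + (P - T - z^2 * (Q - T)))" "B = 1 / (1 + z^2) * (1 + (Q - T - z^2 * (P - T)))"
    using nz(2) unfolding y_def by (simp_all add: field_simps)
  then show "(\<lambda>n. of_nat (a n) * z ^ n) sums (1 / (1 + z^2) * (1 + (P - T - z^2 * (Q - T))))"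
    "(\<lambda>n. of_nat (b n) * z ^ n) sums (1 / (1 + z^2) * (1 + (Q - T - z^2 * (P - T))))"
    using A B by simp_all
qed

theorem mainTheorem17:
  fixes G :: "(real^4^4) set" and z :: complex
  assumes "finite G" and "mat 1 \<in> G" and "\<forall>g\<in>G. \<forall>h\<in>G. g ** h \<in> G"
    and "\<forall>g\<in>G. orthogonal_matrix g \<and> det g = 1"
    and "\<forall>g\<in>G. g \<noteq> mat 1 \<longrightarrow> (\<forall>p\<in>S3. g *v p \<noteq> p)"
    and "norm z < 1"
  shows "summable (\<lambda>k. norm (of_nat (curl_mult G (2 + real k)) * z ^ k))
    \<and> (\<lambda>k. of_nat (curl_mult G (2 + real k)) * z ^ k) sums
        (1 / (1 + z^2) * (1 + 1 / of_nat (card G) *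
          (\<Sum>g\<in>G. (complex_of_real (chi_plus g) - 1 - z^2 * (complex_of_real (chi_minus g) - 1))
                    / det (mat 1 - mat z ** cmat g))))
    \<and> summable (\<lambda>k. norm (of_nat (curl_mult G (- (2 + real k))) * z ^ k))
    \<and> (\<lambda>k. of_nat (curl_mult G (- (2 + real k))) * z ^ k) sums
        (1 / (1 + z^2) * (1 + 1 / of_nat (card G) *
          (\<Sum>g\<in>G. (complex_of_real (chi_minus g) - 1 - z^2 * (complex_of_real (chi_plus g) - 1))
                    / det (mat 1 - mat z ** cmat g))))"
proof -
  have G: "fgroup G" using assms by unfold_locales auto
  \<comment> \<open>The two signs share the curl multiplicities and the trivial representation, and
    differ in the three-dimensional representation: \<Lambda>^+ for A, \<Lambda>^- for B.\<close>
  interpret A: fframe 1 G by (rule fframe.intro[OF _ G]) (unfold_locales, simp)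
  interpret B: fframe "-1" G by (rule fframe.intro[OF _ G]) (unfold_locales, simp)
  let ?M = "\<lambda>\<rho>. 1 / of_nat (card G) * (\<Sum>h\<in>G. \<rho> h / det (mat 1 - mat z ** cmat h))"
  note zlt = \<open>norm z < 1\<close>
  have tr: "(\<Sum>a\<in>UNIV. A.cR h $ a $ a) = complex_of_real (chi_plus h)"
    "(\<Sum>a\<in>UNIV. B.cR h $ a $ a) = complex_of_real (chi_minus h)"
    "(\<Sum>a\<in>UNIV. A.triv h $ a $ a) = 1" for h
    by (simp_all add: A.cR_def B.cR_def chi_plus_RR chi_minus_RR A.triv_def mat_def)
  note P = A.mult_FV_series[OF zlt A.grep_cR, unfolded tr]
  note Q = B.mult_FV_series[OF zlt B.grep_cR, unfolded tr]
  note T = A.mult_FV_series[OF zlt A.grep_triv, unfolded tr]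
  have low: "A.mult_FV A.cR n + (if 2 \<le> n then A.mult_FV A.triv (n - 2) else 0) + (if n = 0 then 1 else 0)
      = curl_mult G (2 + real n) + (if 2 \<le> n then curl_mult G (- (2 + real (n - 2))) else 0)
        + A.mult_FV A.triv n + (if 2 \<le> n then A.mult_FV A.cR (n - 2) else 0)" for n
  proof -
    consider "n = 0" | "n = 1" | "2 \<le> n" by linarith
    then show ?thesis
    proof cases
      case 1 then show ?thesis using A.curl_mult_lowest A.mult_FV_triv_0 by simp
    next
      \<comment> \<open>The partner eigenvalue here is -1, which frame B excludes; for n \<ge> 2 it
        is -n = -(2 + (n - 2)), the shifted coefficient of the other series.\<close>
      case 2 then show ?thesis using A.mult_FV_step[of 1] B.curl_mult_s by (simp add: add.commute)
    next
      case 3 then show ?thesis using A.mult_FV_step[of n] by (simp add: add.commute of_nat_diff)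
    qed
  qed
  have low': "B.mult_FV B.cR n + (if 2 \<le> n then A.mult_FV A.triv (n - 2) else 0) + (if n = 0 then 1 else 0)
      = curl_mult G (- (2 + real n)) + (if 2 \<le> n then curl_mult G (2 + real (n - 2)) else 0)
        + A.mult_FV A.triv n + (if 2 \<le> n then B.mult_FV B.cR (n - 2) else 0)" for n
  proof -
    consider "n = 0" | "n = 1" | "2 \<le> n" by linarith
    then show ?thesis
    proof cases
      case 1 then show ?thesis using B.curl_mult_lowest A.mult_FV_triv_0 by simp
    next
      case 2 then show ?thesis using B.mult_FV_step[of 1] A.curl_mult_s by (simp add: add.commute)
    next
      case 3 then show ?thesis using B.mult_FV_step[of n] by (simp add: add.commute of_nat_diff)
    qed
  qed
  have le: "curl_mult G (2 + real n) \<le> A.mult_FV A.cR n" "curl_mult G (- (2 + real n)) \<le> B.mult_FV B.cR n" for n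
    using A.curl_mult_le[of n] B.curl_mult_le[of n] by (simp_all add: add.commute)
  have S: "?M f - ?M (\<lambda>_. 1) - z^2 * (?M g - ?M (\<lambda>_. 1))
      = 1 / of_nat (card G) * (\<Sum>h\<in>G. (f h - 1 - z^2 * (g h - 1)) / det (mat 1 - mat z ** cmat h))" for f g
    by (simp only: sum_distrib_left sum_subtractf[symmetric] right_diff_distrib diff_divide_distrib)
      (simp add: sum_distrib_left sum_subtractf sum.distrib algebra_simps diff_divide_distrib)
  show ?thesis
    using coupled_generating_functions[OF zlt P Q T(2) le low low'] unfolding S by (intro conjI)
qed

end
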